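(* Let $N\ge 2$, $0<R<1$, $\sigma_c,\sigma_s>0$, and let $D_0=B_R$, $\Omega_0=B_1$ be the concentric open balls in $\mathbb{R}^N$ centered at the origin of radius $R$ and $1$. Then $(D_0,\Omega_0)$ is a critical shape for the functional $E$ under the fixed volume constraint, i.e. $E'(D_0,\Omega_0)(\Phi)=0$ for every $\Phi\in\mathcal{A}$ such that, for all small $t\ge 0$, $\mathrm{Vol}\big((\mathrm{Id}+\Phi(t))(D_0)\big)=\mathrm{Vol}(D_0)$ and $\mathrm{Vol}\big((\mathrm{Id}+\Phi(t))(\Omega_0)\big)=\mathrm{Vol}(\Omega_0)$.
   Context: For bounded domains $D\subset\Omega\subset\mathbb{R}^N$ with $\overline D\subset\Omega$, set $\sigma=\sigma_c$ in $D$ and $\sigma=\sigma_s$ in $\Omega\setminus D$. Let $u\in H_0^1(\Omega)$ be the unique weak solution of $-\mathrm{div}(\sigma\nabla u)=1$ in $\Omega$, $u=0$ on $\partial\Omega$, i.e. $\int_\Omega\sigma\nabla u\cdot\nabla\psi=\int_\Omega\psi$ for all $\psi\in H^1_0(\Omega)$. The functional $E$ is $E(D,\Omega)=\int_\Omega\sigma|\nabla u|^2=\int_\Omega u$. $\mathcal{C}^{2,\infty}(\mathbb{R}^N,\mathbb{R}^N)$ is the space $\mathcal{C}^2\cap W^{2,\infty}$ with the $W^{2,\infty}$ norm, and $\mathcal{A}=\{\Phi\in \mathcal{C}^2([0,1),\mathcal{C}^{2,\infty}(\mathbb{R}^N,\mathbb{R}^N)) : \Phi(0)=0\}$. For $\Phi\in\mathcal{A}$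 put $D_t=(\mathrm{Id}+\Phi(t))(D)$, $\Omega_t=(\mathrm{Id}+\Phi(t))(\Omega)$ for small $t\ge 0$. The first order shape derivative is $E'(D,\Omega)(\Phi)=\frac{d}{dt}\big|_{t=0}E(D_t,\Omega_t)$. *)

theory Defs
  imports "HOL-Analysis.Analysis"
begin

section \<open>Continuously differentiable functions\<close>

text \<open>Unspecified at points where \<open>f\<close> is not differentiable; all uses below require
  differentiability.\<close>

definition pderiv_dir :: "'a::euclidean_space \<Rightarrow> ('a \<Rightarrow> 'b::real_normed_vector) \<Rightarrow> 'a \<Rightarrow> 'b"
  where "pderiv_dir i f x = frechet_derivative f (at x) i"

definition C1_fun :: "('a::euclidean_space \<Rightarrow> 'b::real_normed_vector) \<Rightarrow> bool"
  where "C1_fun f \<longleftrightarrow> (\<forall>x. f differentiable (at x)) \<and>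
                     (\<forall>i\<in>Basis. continuous_on UNIV (pderiv_dir i f))"

definition C2_fun :: "('a::euclidean_space \<Rightarrow> 'b::real_normed_vector) \<Rightarrow> bool"
  where "C2_fun f \<longleftrightarrow> (\<forall>x. f differentiable (at x)) \<and> (\<forall>i\<in>Basis. C1_fun (pderiv_dir i f))"

definition C1c :: "'a::euclidean_space set \<Rightarrow> ('a \<Rightarrow> real) set"
  where "C1c \<Omega> = {\<phi>. C1_fun \<phi> \<and> compact (closure {x. \<phi> x \<noteq> 0}) \<and> closure {x. \<phi> x \<noteq> 0} \<subseteq> \<Omega>}"


section \<open>The Sobolev spaces \<open>H\<^sup>1\<close> and \<open>H\<^sub>0\<^sup>1\<close>\<close>

text \<open>Elements of these spaces are represented by functions on the whole space of which only
  the values almost everywhere on \<open>\<Omega>\<close> matter.\<close>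

definition L2 :: "'a::euclidean_space set \<Rightarrow> ('a \<Rightarrow> 'b::euclidean_space) set"
  where "L2 \<Omega> = {u \<in> borel_measurable (lebesgue_on \<Omega>).
                   integrable (lebesgue_on \<Omega>) (\<lambda>x. (norm (u x))\<^sup>2)}"

definition has_weak_gradient ::
    "'a::euclidean_space set \<Rightarrow> ('a \<Rightarrow> real) \<Rightarrow> ('a \<Rightarrow> 'a) \<Rightarrow> bool"
  where "has_weak_gradient \<Omega> u g \<longleftrightarrow>
    (\<forall>\<phi>\<in>C1c \<Omega>. \<forall>i\<in>Basis.
       (\<integral>x. u x * pderiv_dir i \<phi> x \<partial>lebesgue_on \<Omega>) = - (\<integral>x. (g x \<bullet> i) * \<phi> x \<partial>lebesgue_on \<Omega>))"

definition H1 :: "'a::euclidean_space set \<Rightarrow> ('a \<Rightarrow> real) set"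
  where "H1 \<Omega> = {u \<in> L2 \<Omega>. \<exists>g\<in>L2 \<Omega>. has_weak_gradient \<Omega> u g}"

text \<open>The weak gradient is unique almost everywhere on an open set \<open>\<Omega>\<close>, so the choice of a
  representative does not affect the integrals below.\<close>

definition wgrad :: "'a::euclidean_space set \<Rightarrow> ('a \<Rightarrow> real) \<Rightarrow> 'a \<Rightarrow> 'a"
  where "wgrad \<Omega> u = (SOME g. g \<in> L2 \<Omega> \<and> has_weak_gradient \<Omega> u g)"

definition H1_norm :: "'a::euclidean_space set \<Rightarrow> ('a \<Rightarrow> real) \<Rightarrow> real"
  where "H1_norm \<Omega> u =
    sqrt ((\<integral>x. (u x)\<^sup>2 \<partial>lebesgue_on \<Omega>) + (\<integral>x. (norm (wgrad \<Omega> u x))\<^sup>2 \<partial>lebesgue_on \<Omega>))"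

text \<open>As in Brezis, \<open>H\<^sub>0\<^sup>1(\<Omega>)\<close> is the closure of \<open>C\<^sub>c\<^sup>1(\<Omega>)\<close> in \<open>H\<^sup>1(\<Omega>)\<close>.
  By mollification, using smooth compactly supported functions instead of \<^term>\<open>C1c \<Omega>\<close>, here and in
  \<^const>\<open>has_weak_gradient\<close>, gives the same space and the same weak gradients.\<close>

definition H10 :: "'a::euclidean_space set \<Rightarrow> ('a \<Rightarrow> real) set"
  where "H10 \<Omega> = {u \<in> H1 \<Omega>. \<forall>\<epsilon>>0. \<exists>\<phi>\<in>C1c \<Omega>. H1_norm \<Omega> (\<lambda>x. u x - \<phi> x) < \<epsilon>}"


section \<open>The state equation and the energy\<close>

definition conductivity :: "real \<Rightarrow> real \<Rightarrow> 'a set \<Rightarrow> 'a \<Rightarrow> real"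
  where "conductivity \<sigma>c \<sigma>s D x = (if x \<in> D then \<sigma>c else \<sigma>s)"

definition weak_solution ::
    "real \<Rightarrow> real \<Rightarrow> 'a::euclidean_space set \<Rightarrow> 'a set \<Rightarrow> ('a \<Rightarrow> real) \<Rightarrow> bool"
  where "weak_solution \<sigma>c \<sigma>s D \<Omega> u \<longleftrightarrow> u \<in> H10 \<Omega> \<and>
    (\<forall>\<psi>\<in>H10 \<Omega>. (\<integral>x. conductivity \<sigma>c \<sigma>s D x * (wgrad \<Omega> u x \<bullet> wgrad \<Omega> \<psi> x) \<partial>lebesgue_on \<Omega>)
                 = (\<integral>x. \<psi> x \<partial>lebesgue_on \<Omega>))"

text \<open>The weak solution is unique up to a null set, hence \<open>SOME\<close> instead of \<open>THE\<close>.\<close>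

definition state :: "real \<Rightarrow> real \<Rightarrow> 'a::euclidean_space set \<Rightarrow> 'a set \<Rightarrow> 'a \<Rightarrow> real"
  where "state \<sigma>c \<sigma>s D \<Omega> = (SOME u. weak_solution \<sigma>c \<sigma>s D \<Omega> u)"

definition energy :: "real \<Rightarrow> real \<Rightarrow> 'a::euclidean_space set \<Rightarrow> 'a set \<Rightarrow> real"
  where "energy \<sigma>c \<sigma>s D \<Omega> =
    (\<integral>x. conductivity \<sigma>c \<sigma>s D x * (norm (wgrad \<Omega> (state \<sigma>c \<sigma>s D \<Omega>) x))\<^sup>2 \<partial>lebesgue_on \<Omega>)"

lemma energy_eq_integral_state:
  assumes "\<exists>u. weak_solution \<sigma>c \<sigma>s D \<Omega> u"
  shows "energy \<sigma>c \<sigma>s D \<Omega> = (\<integral>x. state \<sigma>c \<sigma>s D \<Omega> x \<partial>lebesgue_on \<Omega>)"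
proof -
  have "weak_solution \<sigma>c \<sigma>s D \<Omega> (state \<sigma>c \<sigma>s D \<Omega>)"
    unfolding state_def using assms by (rule someI_ex)
  then show ?thesis
    by (auto simp: weak_solution_def energy_def power2_norm_eq_inner)
qed


section \<open>Perturbations\<close>

text \<open>The space \<open>C\<^sup>2 \<inter> W\<^sup>2\<^sup>,\<^sup>\<infinity>\<close> and its norm. The weak derivatives of a \<open>C\<^sup>2\<close> function are the
  classical ones, and the essential supremum of a continuous function is its supremum.\<close>

definition C2inf :: "('a::euclidean_space \<Rightarrow> 'b::real_normed_vector) set"
  where "C2inf = {f. C2_fun f \<and> bounded (range f) \<and>
    (\<forall>i\<in>Basis. bounded (range (pderiv_dir i f))) \<and>
    (\<forall>i\<in>Basis. \<forall>j\<in>Basis. bounded (range (pderiv_dir j (pderiv_dir i f))))}"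

definition W2inf_norm :: "('a::euclidean_space \<Rightarrow> 'b::real_normed_vector) \<Rightarrow> real"
  where "W2inf_norm f = (SUP x. norm (f x)) + (\<Sum>i\<in>Basis. SUP x. norm (pderiv_dir i f x)) +
    (\<Sum>i\<in>Basis. \<Sum>j\<in>Basis. SUP x. norm (pderiv_dir j (pderiv_dir i f) x))"

text \<open>Continuity and differentiability of curves \<open>[0,1) \<rightarrow> C\<^sup>2\<^sup>,\<^sup>\<infinity>\<close> with respect to this norm
  (one-sided at \<open>0\<close>).\<close>

definition cont_curve :: "(real \<Rightarrow> 'a::euclidean_space \<Rightarrow> 'a) \<Rightarrow> bool"
  where "cont_curve \<Phi> \<longleftrightarrow> (\<forall>t\<in>{0..<1}. \<Phi> t \<in> C2inf \<and>
    ((\<lambda>s. W2inf_norm (\<lambda>x. \<Phi> s x - \<Phi> t x)) \<longlongrightarrow> 0) (at t within {0..<1}))"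

definition curve_has_deriv ::
    "(real \<Rightarrow> 'a::euclidean_space \<Rightarrow> 'a) \<Rightarrow> (real \<Rightarrow> 'a \<Rightarrow> 'a) \<Rightarrow> bool"
  where "curve_has_deriv \<Phi> \<Phi>' \<longleftrightarrow> (\<forall>t\<in>{0..<1}. \<Phi> t \<in> C2inf \<and> \<Phi>' t \<in> C2inf \<and>
    ((\<lambda>s. W2inf_norm (\<lambda>x. (\<Phi> s x - \<Phi> t x) /\<^sub>R (s - t) - \<Phi>' t x)) \<longlongrightarrow> 0)
      (at t within {0..<1}))"

definition perturbations :: "(real \<Rightarrow> 'a::euclidean_space \<Rightarrow> 'a) set"
  where "perturbations = {\<Phi>. \<Phi> 0 = (\<lambda>x. 0) \<and>
    (\<exists>\<Phi>' \<Phi>''. curve_has_deriv \<Phi> \<Phi>' \<and> curve_has_deriv \<Phi>' \<Phi>'' \<and> cont_curve \<Phi>'')}"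

definition deform :: "(real \<Rightarrow> 'a::euclidean_space \<Rightarrow> 'a) \<Rightarrow> real \<Rightarrow> 'a set \<Rightarrow> 'a set"
  where "deform \<Phi> t S = (\<lambda>x. x + \<Phi> t x) ` S"

text \<open>Perturbations live on \<open>[0,1)\<close>, so the shape derivative is a one-sided derivative at \<open>0\<close>.\<close>

definition has_shape_derivative ::
    "('a::euclidean_space set \<Rightarrow> 'a set \<Rightarrow> real) \<Rightarrow> 'a set \<Rightarrow> 'a set \<Rightarrow>
     (real \<Rightarrow> 'a \<Rightarrow> 'a) \<Rightarrow> real \<Rightarrow> bool"
  where "has_shape_derivative F D \<Omega> \<Phi> d \<longleftrightarrow>
    ((\<lambda>t. F (deform \<Phi> t D) (deform \<Phi> t \<Omega>)) has_real_derivative d) (at 0 within {0..<1})"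

definition preserves_volume ::
    "(real \<Rightarrow> 'a::euclidean_space \<Rightarrow> 'a) \<Rightarrow> 'a set \<Rightarrow> bool"
  where "preserves_volume \<Phi> S \<longleftrightarrow>
    (\<exists>\<epsilon>>0. \<forall>t. 0 \<le> t \<and> t < \<epsilon> \<longrightarrow> measure lebesgue (deform \<Phi> t S) = measure lebesgue S)"

definition critical_shape_fixed_volume ::
    "('a::euclidean_space set \<Rightarrow> 'a set \<Rightarrow> real) \<Rightarrow> 'a set \<Rightarrow> 'a set \<Rightarrow> bool"
  where "critical_shape_fixed_volume F D \<Omega> \<longleftrightarrow>
    (\<forall>\<Phi>\<in>perturbations. preserves_volume \<Phi> D \<and> preserves_volume \<Phi> \<Omega> \<longrightarrow>
       has_shape_derivative F D \<Omega> \<Phi> 0)"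

end

theory Submission
  imports Defs
begin

text \<open>
  The solution \<open>u\<close> on concentric balls satisfies \<open>\<sigma> \<nabla>u = - q\<close> with \<open>q x = x / N\<close>, a field that is smooth
  across the interface and has \<open>div q = 1\<close>. For arbitrary \<open>D \<subseteq> \<Omega>\<close> the field \<open>q\<close> is admissible in
  Thomson's principle, which gives \<open>E \<le> Q\<close> for \<open>Q = \<integral>\<^sub>\<Omega> |q|\<^sup>2 / \<sigma>\<close>, while Dirichlet's principle reads
  \<open>Q - \<integral>\<^sub>\<Omega> \<sigma> |\<nabla>v + q / \<sigma>|\<^sup>2 \<le> E\<close> for every test function \<open>v\<close>. If \<open>v\<close> is the solution on the balls
  transported to the perturbed domains, then \<open>\<sigma> \<nabla>v + q\<close> is uniformly \<open>O(t)\<close>, so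
  \<open>E(D\<^sub>t, \<Omega>\<^sub>t) = Q(D\<^sub>t, \<Omega>\<^sub>t) + O(t\<^sup>2)\<close>. Finally \<open>Q\<close> is a combination of the second moments of \<open>D\<^sub>t\<close> and
  \<open>\<Omega>\<^sub>t\<close>. With the volume fixed, the second moment may be taken of \<open>|x|\<^sup>2 - r\<^sup>2\<close>, which is \<open>O(t)\<close> on
  the symmetric difference of the perturbed ball and the ball of radius \<open>r\<close>, a set of measure
  \<open>o(1)\<close>; hence \<open>Q\<close> changes by \<open>o(t)\<close>.
\<close>

section \<open>Square integrable functions\<close>

text \<open>The state depends on t through its domain and its coefficient, and its gradient jumps
  across the moving interface, which makes it awkward to differentiate in t. The proof works around
  this: E is an extremal value, so a test function with error O(t) costs only O(t^2), and the same q
  serves for every t because div q = 1 involves neither the domain nor the coefficient.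

  With the weights \<open>W g\<close> = sqrt(\<sigma>) g and \<open>P\<close> = q / sqrt(\<sigma>)
  the variational principles become geometry in L2: \<open>W\<close> applied to the gradient of the
  state is the orthogonal projection of -\<open>P\<close>, and Q - E is a squared distance. Since
  the state is chosen by \<open>SOME\<close>, existence of a weak solution is what gives the energy
  its meaning.

  Test functions have to be C1 with compact support, while the transported solution has a kink at
  the interface and reaches the boundary. Hence its radial profile is smoothed and cut off, and the
  lower bound is read off in the limit. The perturbation enters through a bound K t on \<Phi>(t) and
  its first partial derivatives.\<close>

definition sqint :: "'a::euclidean_space set \<Rightarrow> ('a \<Rightarrow> 'b::euclidean_space) \<Rightarrow> real"
  where "sqint \<Omega> f = (\<integral>x. (norm (f x))\<^sup>2 \<partial>lebesgue_on \<Omega>)"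

lemma L2_measurable: "f \<in> L2 \<Omega> \<Longrightarrow> f \<in> borel_measurable (lebesgue_on \<Omega>)"
  and L2_integrable: "f \<in> L2 \<Omega> \<Longrightarrow> integrable (lebesgue_on \<Omega>) (\<lambda>x. (norm (f x))\<^sup>2)"
  by (auto simp: L2_def)

lemma L2_bound:
  assumes f: "f \<in> borel_measurable (lebesgue_on \<Omega>)" and g: "g \<in> L2 \<Omega>"
    and le: "AE x in lebesgue_on \<Omega>. norm (f x) \<le> c * norm (g x)"
  shows "f \<in> L2 \<Omega>"
proof -
  have "integrable (lebesgue_on \<Omega>) (\<lambda>x. (norm (f x))\<^sup>2)"
  proof (rule Bochner_Integration.integrable_bound)
    show "integrable (lebesgue_on \<Omega>) (\<lambda>x. c\<^sup>2 * (norm (g x))\<^sup>2)"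
      using L2_integrable[OF g] by simp
    show "(\<lambda>x. (norm (f x))\<^sup>2) \<in> borel_measurable (lebesgue_on \<Omega>)"
      using f by measurable
    show "AE x in lebesgue_on \<Omega>. norm ((norm (f x))\<^sup>2) \<le> norm (c\<^sup>2 * (norm (g x))\<^sup>2)"
      using le
    proof eventually_elim
      case (elim x)
      then have "(norm (f x))\<^sup>2 \<le> (c * norm (g x))\<^sup>2" by (intro power_mono) auto
      then show ?case by (simp add: power_mult_distrib)
    qed
  qed
  with f show ?thesis by (simp add: L2_def)
qed

lemma norm_add_sq_le: "(norm (a + b))\<^sup>2 \<le> 2 * (norm a)\<^sup>2 + 2 * (norm (b::'b::real_inner))\<^sup>2"
proof -
  have "0 \<le> (norm (a - b))\<^sup>2" by simp
  then show ?thesis by (simp add: power2_norm_eq_inner inner_simps inner_commute)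
qed

lemma L2_add:
  assumes f: "f \<in> L2 \<Omega>" and g: "g \<in> L2 \<Omega>"
  shows "(\<lambda>x. f x + g x) \<in> L2 \<Omega>"
proof -
  note [measurable] = L2_measurable[OF f] L2_measurable[OF g]
  have "integrable (lebesgue_on \<Omega>) (\<lambda>x. (norm (f x + g x))\<^sup>2)"
  proof (rule Bochner_Integration.integrable_bound)
    show "integrable (lebesgue_on \<Omega>) (\<lambda>x. 2 * (norm (f x))\<^sup>2 + 2 * (norm (g x))\<^sup>2)"
      using L2_integrable[OF f] L2_integrable[OF g] by simp
    show "(\<lambda>x. (norm (f x + g x))\<^sup>2) \<in> borel_measurable (lebesgue_on \<Omega>)"
      by measurable
    show "AE x in lebesgue_on \<Omega>. norm ((norm (f x + g x))\<^sup>2)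
        \<le> norm (2 * (norm (f x))\<^sup>2 + 2 * (norm (g x))\<^sup>2)"
      using norm_add_sq_le by (intro AE_I2) (auto)
  qed
  then show ?thesis by (simp add: L2_def)
qed

lemma L2_mult_bounded:
  assumes c: "c \<in> borel_measurable (lebesgue_on \<Omega>)" and b: "\<And>x. x \<in> \<Omega> \<Longrightarrow> \<bar>c x\<bar> \<le> B"
    and f: "f \<in> L2 \<Omega>"
  shows "(\<lambda>x. c x *\<^sub>R f x) \<in> L2 \<Omega>"
  using c L2_measurable[OF f] b
  by (intro L2_bound[OF _ f, where c=B] AE_I2) (auto intro!: mult_right_mono)

lemma L2_scaleR: "f \<in> L2 \<Omega> \<Longrightarrow> (\<lambda>x. c *\<^sub>R f x) \<in> L2 \<Omega>"
  by (rule L2_mult_bounded[where B="\<bar>c\<bar>"]) auto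

lemma L2_diff: "f \<in> L2 \<Omega> \<Longrightarrow> g \<in> L2 \<Omega> \<Longrightarrow> (\<lambda>x. f x - g x) \<in> L2 \<Omega>"
  using L2_add[OF _ L2_scaleR[of g \<Omega> "-1"], of f] by simp

lemma L2_inner_integrable:
  assumes f: "f \<in> L2 \<Omega>" and g: "g \<in> L2 \<Omega>"
  shows "integrable (lebesgue_on \<Omega>) (\<lambda>x. f x \<bullet> g x)"
proof (rule Bochner_Integration.integrable_bound)
  note [measurable] = L2_measurable[OF f] L2_measurable[OF g]
  show "integrable (lebesgue_on \<Omega>) (\<lambda>x. (norm (f x))\<^sup>2 + (norm (g x))\<^sup>2)"
    using L2_integrable[OF f] L2_integrable[OF g] by simp
  show "(\<lambda>x. f x \<bullet> g x) \<in> borel_measurable (lebesgue_on \<Omega>)"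
    by measurable
  have "\<bar>a \<bullet> b\<bar> \<le> (norm a)\<^sup>2 + (norm b)\<^sup>2" for a b :: 'b
  proof -
    have "\<bar>a \<bullet> b\<bar> \<le> norm a * norm b" by (rule Cauchy_Schwarz_ineq2)
    moreover have "2 * norm a * norm b \<le> (norm a)\<^sup>2 + (norm b)\<^sup>2" by (rule sum_squares_bound)
    moreover have "0 \<le> norm a * norm b" by simp
    ultimately show ?thesis by linarith
  qed
  then show "AE x in lebesgue_on \<Omega>. norm (f x \<bullet> g x) \<le> norm ((norm (f x))\<^sup>2 + (norm (g x))\<^sup>2)"
    by (intro AE_I2) auto
qed

lemma L2_inner_const:
  assumes "f \<in> L2 \<Omega>" shows "(\<lambda>x. f x \<bullet> v) \<in> L2 \<Omega>"
  using L2_measurable[OF assms]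
  by (intro L2_bound[OF _ assms, where c="norm v"])
     (auto intro!: AE_I2 simp: mult.commute[of "norm v"] Cauchy_Schwarz_ineq2)

lemma sqint_nonneg [simp]: "0 \<le> sqint \<Omega> f"
  by (simp add: sqint_def)

lemma sqint_scaleR: "sqint \<Omega> (\<lambda>x. c *\<^sub>R f x) = c\<^sup>2 * sqint \<Omega> f"
  by (simp add: sqint_def power_mult_distrib)

lemma sqint_minus_commute: "sqint \<Omega> (\<lambda>x. f x - g x) = sqint \<Omega> (\<lambda>x. g x - f x)"
  by (simp add: sqint_def norm_minus_commute)

text \<open>The squared norm along a line is a quadratic polynomial in s. Cauchy-Schwarz, the first
  variation and the energy identities all come from this expansion.\<close>

lemma sqint_expand:
  assumes f: "f \<in> L2 \<Omega>" and g: "g \<in> L2 \<Omega>"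
  shows "sqint \<Omega> (\<lambda>x. f x + s *\<^sub>R g x)
    = sqint \<Omega> f + 2 * s * (\<integral>x. f x \<bullet> g x \<partial>lebesgue_on \<Omega>) + s\<^sup>2 * sqint \<Omega> g"
proof -
  have "(norm (f x + s *\<^sub>R g x))\<^sup>2 = (norm (f x))\<^sup>2 + 2 * s * (f x \<bullet> g x) + s\<^sup>2 * (norm (g x))\<^sup>2" for x
    unfolding power2_norm_eq_inner
    by (simp add: inner_simps inner_commute power2_eq_square algebra_simps)
  then show ?thesis
    unfolding sqint_def
    using L2_integrable[OF f] L2_integrable[OF g] L2_inner_integrable[OF f g] by simp
qed

text \<open>The polynomial of \<open>sqint_expand\<close> is nonnegative for every s, so its
  discriminant cannot be positive.\<close>

lemma L2_Cauchy_Schwarz: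
  assumes f: "f \<in> L2 \<Omega>" and g: "g \<in> L2 \<Omega>"
  shows "(\<integral>x. f x \<bullet> g x \<partial>lebesgue_on \<Omega>)\<^sup>2 \<le> sqint \<Omega> f * sqint \<Omega> g"
proof -
  define A B C where "A = sqint \<Omega> f" and "B = (\<integral>x. f x \<bullet> g x \<partial>lebesgue_on \<Omega>)" and "C = sqint \<Omega> g"
  have q: "0 \<le> A + 2 * s * B + s\<^sup>2 * C" for s
    unfolding A_def B_def C_def sqint_expand[OF f g, symmetric] by simp
  have "B\<^sup>2 \<le> A * C"
  proof (cases "C = 0")
    case True
    have "B = 0"
    proof (rule ccontr)
      assume "B \<noteq> 0"
      \<comment> \<open>With C = 0 the polynomial is affine, and this s would give it the value
        -1.\<close>
      moreover have "0 \<le> A + 2 * (- (A + 1) / (2 * B)) * B"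
        using q[of "- (A + 1) / (2 * B)"] True by simp
      ultimately show False by (simp add: field_simps)
    qed
    then show ?thesis using True by simp
  next
    case False
    then have C: "C > 0" by (simp add: C_def order_less_le)
    have "0 \<le> (A + 2 * (- B / C) * B + (- B / C)\<^sup>2 * C) * C"
      using q[of "- B / C"] C by simp
    also have "\<dots> = A * C - B\<^sup>2" using C by (simp add: field_simps power2_eq_square)
    finally show ?thesis by simp
  qed
  then show ?thesis by (simp add: A_def B_def C_def)
qed

section \<open>Sets of finite measure, convergence and completeness in L2\<close>

lemma L2_const:
  assumes "\<Omega> \<in> lmeasurable" shows "(\<lambda>x. c) \<in> L2 \<Omega>"
proof -
  interpret finite_measure "lebesgue_on \<Omega>" using assms by (rule finite_measure_lebesgue_on)
  show ?thesis by (simp add: L2_def)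
qed

lemma L2_bounded:
  assumes "\<Omega> \<in> lmeasurable" "f \<in> borel_measurable (lebesgue_on \<Omega>)" "\<And>x. x \<in> \<Omega> \<Longrightarrow> norm (f x) \<le> B"
  shows "f \<in> L2 \<Omega>"
  using assms by (intro L2_bound[OF _ L2_const[OF assms(1), of "1::real"], where c=B]) (auto intro: AE_I2)

lemma L2_integrable_real:
  assumes "\<Omega> \<in> lmeasurable" "(f::_ \<Rightarrow> real) \<in> L2 \<Omega>"
  shows "integrable (lebesgue_on \<Omega>) f"
  using L2_inner_integrable[OF assms(2) L2_const[OF assms(1), of 1]] by simp

text \<open>Convergence in the L2 seminorm, written with its square. Membership in \<open>L2\<close>
  is carried separately, and limits are determined up to null sets.\<close>

definition L2_limit :: "'a::euclidean_space set \<Rightarrow> (nat \<Rightarrow> 'a \<Rightarrow> 'b::euclidean_space) \<Rightarrow> ('a \<Rightarrow> 'b) \<Rightarrow> bool"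
  where "L2_limit \<Omega> f g \<longleftrightarrow> (\<lambda>n. sqint \<Omega> (\<lambda>x. f n x - g x)) \<longlonglongrightarrow> 0"

lemma L2_limit_inner:
  assumes f: "\<And>n. f n \<in> L2 \<Omega>" and g: "g \<in> L2 \<Omega>" and h: "h \<in> L2 \<Omega>" and lim: "L2_limit \<Omega> f g"
  shows "(\<lambda>n. \<integral>x. f n x \<bullet> h x \<partial>lebesgue_on \<Omega>) \<longlonglongrightarrow> (\<integral>x. g x \<bullet> h x \<partial>lebesgue_on \<Omega>)"
proof -
  have "(\<lambda>n. ((\<integral>x. f n x \<bullet> h x \<partial>lebesgue_on \<Omega>) - (\<integral>x. g x \<bullet> h x \<partial>lebesgue_on \<Omega>))\<^sup>2) \<longlonglongrightarrow> 0"
  proof (rule tendsto_sandwich[of "\<lambda>_. 0", OF _ _ tendsto_const])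
    show "(\<lambda>n. sqint \<Omega> (\<lambda>x. f n x - g x) * sqint \<Omega> h) \<longlonglongrightarrow> 0"
      using lim tendsto_mult_left_zero unfolding L2_limit_def by blast
    have "((\<integral>x. f n x \<bullet> h x \<partial>lebesgue_on \<Omega>) - (\<integral>x. g x \<bullet> h x \<partial>lebesgue_on \<Omega>))\<^sup>2
        \<le> sqint \<Omega> (\<lambda>x. f n x - g x) * sqint \<Omega> h" for n
      using L2_Cauchy_Schwarz[OF L2_diff[OF f[of n] g] h]
        L2_inner_integrable[OF f[of n] h] L2_inner_integrable[OF g h]
      by (simp add: inner_diff_left)
    then show "\<forall>\<^sub>F n in sequentially. ((\<integral>x. f n x \<bullet> h x \<partial>lebesgue_on \<Omega>) - (\<integral>x. g x \<bullet> h x \<partial>lebesgue_on \<Omega>))\<^sup>2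
        \<le> sqint \<Omega> (\<lambda>x. f n x - g x) * sqint \<Omega> h" by simp
  qed simp
  then show ?thesis by (simp add: LIM_zero_iff)
qed

lemma L2_limit_inner_const:
  assumes f: "\<And>n. f n \<in> L2 \<Omega>" and g: "g \<in> L2 \<Omega>" and lim: "L2_limit \<Omega> f g"
  shows "L2_limit \<Omega> (\<lambda>n x. f n x \<bullet> v) (\<lambda>x. g x \<bullet> v)"
  unfolding L2_limit_def
proof (rule tendsto_sandwich[of "\<lambda>_. 0", OF _ _ tendsto_const])
  show "(\<lambda>n. (norm v)\<^sup>2 * sqint \<Omega> (\<lambda>x. f n x - g x)) \<longlonglongrightarrow> 0"
    using lim tendsto_mult_right_zero unfolding L2_limit_def by blast
  have "sqint \<Omega> (\<lambda>x. f n x \<bullet> v - g x \<bullet> v) \<le> (norm v)\<^sup>2 * sqint \<Omega> (\<lambda>x. f n x - g x)" for n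
    unfolding sqint_def integral_mult_right_zero[symmetric]
  proof (rule integral_mono)
    show "integrable (lebesgue_on \<Omega>) (\<lambda>x. (norm (f n x \<bullet> v - g x \<bullet> v))\<^sup>2)"
      using L2_integrable[OF L2_inner_const[OF L2_diff[OF f[of n] g], of v]] by (simp add: inner_diff_left)
    show "integrable (lebesgue_on \<Omega>) (\<lambda>x. (norm v)\<^sup>2 * (norm (f n x - g x))\<^sup>2)"
      using L2_integrable[OF L2_diff[OF f[of n] g]] by simp
    show "(norm (f n x \<bullet> v - g x \<bullet> v))\<^sup>2 \<le> (norm v)\<^sup>2 * (norm (f n x - g x))\<^sup>2" for x
      using Cauchy_Schwarz_ineq[of "f n x - g x" v]
      by (simp add: inner_diff_left[symmetric] power2_norm_eq_inner mult.commute)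
  qed
  then show "\<forall>\<^sub>F n in sequentially. sqint \<Omega> (\<lambda>x. f n x \<bullet> v - g x \<bullet> v) \<le> (norm v)\<^sup>2 * sqint \<Omega> (\<lambda>x. f n x - g x)"
    by simp
qed simp

lemma L2_limit_mult_bounded:
  assumes c: "c \<in> borel_measurable (lebesgue_on \<Omega>)" and b: "\<And>x. x \<in> \<Omega> \<Longrightarrow> \<bar>c x\<bar> \<le> B"
    and f: "\<And>n. f n \<in> L2 \<Omega>" and g: "g \<in> L2 \<Omega>" and lim: "L2_limit \<Omega> f g"
  shows "L2_limit \<Omega> (\<lambda>n x. c x *\<^sub>R f n x) (\<lambda>x. c x *\<^sub>R g x)"
  unfolding L2_limit_def
proof (rule tendsto_sandwich[of "\<lambda>_. 0", OF _ _ tendsto_const])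
  show "(\<lambda>n. B\<^sup>2 * sqint \<Omega> (\<lambda>x. f n x - g x)) \<longlonglongrightarrow> 0"
    using lim tendsto_mult_right_zero unfolding L2_limit_def by blast
  have "sqint \<Omega> (\<lambda>x. c x *\<^sub>R f n x - c x *\<^sub>R g x) \<le> B\<^sup>2 * sqint \<Omega> (\<lambda>x. f n x - g x)" for n
    unfolding sqint_def integral_mult_right_zero[symmetric] scaleR_diff_right[symmetric]
  proof (rule integral_mono)
    show "integrable (lebesgue_on \<Omega>) (\<lambda>x. (norm (c x *\<^sub>R (f n x - g x)))\<^sup>2)"
      using L2_integrable[OF L2_mult_bounded[OF c b L2_diff[OF f[of n] g]]] by blast
    show "integrable (lebesgue_on \<Omega>) (\<lambda>x. B\<^sup>2 * (norm (f n x - g x))\<^sup>2)"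
      using L2_integrable[OF L2_diff[OF f[of n] g]] by simp
    fix x assume "x \<in> space (lebesgue_on \<Omega>)"
    then have "\<bar>c x\<bar>\<^sup>2 \<le> B\<^sup>2" using b[of x] by (intro power_mono) auto
    then show "(norm (c x *\<^sub>R (f n x - g x)))\<^sup>2 \<le> B\<^sup>2 * (norm (f n x - g x))\<^sup>2"
      by (simp add: power_mult_distrib mult_right_mono)
  qed
  then show "\<forall>\<^sub>F n in sequentially. sqint \<Omega> (\<lambda>x. c x *\<^sub>R f n x - c x *\<^sub>R g x) \<le> B\<^sup>2 * sqint \<Omega> (\<lambda>x. f n x - g x)"
    by simp
qed simp

text \<open>Riesz-Fischer. On a set of finite measure an L2-Cauchy sequence is L1-Cauchy, so a
  subsequence converges almost everywhere; Fatou's lemma transfers the Cauchy estimate to its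
  pointwise limit.\<close>

lemma L2_complete:
  fixes f :: "nat \<Rightarrow> 'a::euclidean_space \<Rightarrow> 'b::euclidean_space"
  assumes \<Omega>: "\<Omega> \<in> lmeasurable" and f: "\<And>n. f n \<in> L2 \<Omega>"
    and C: "\<And>e. e > 0 \<Longrightarrow> \<exists>N. \<forall>i\<ge>N. \<forall>j\<ge>N. sqint \<Omega> (\<lambda>x. f i x - f j x) < e"
  obtains g where "g \<in> L2 \<Omega>" "L2_limit \<Omega> f g"
proof -
  let ?M = "lebesgue_on \<Omega>"
  interpret finite_measure ?M using \<Omega> by (rule finite_measure_lebesgue_on)
  note [measurable] = L2_measurable[OF f]
  have L1: "integrable ?M h" if "h \<in> L2 \<Omega>" for h :: "'a \<Rightarrow> 'b"
  proof (rule Bochner_Integration.integrable_bound)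
    show "integrable ?M (\<lambda>x. 1 + (norm (h x))\<^sup>2)" using L2_integrable[OF that] by simp
    show "h \<in> borel_measurable ?M" using that by (rule L2_measurable)
    have "a \<le> 1 + a\<^sup>2" for a :: real 
      using sum_squares_bound[of 1 a] zero_le_power2[of a] unfolding one_power2 by linarith
    then show "AE x in ?M. norm (h x) \<le> norm (1 + (norm (h x))\<^sup>2)" by (intro AE_I2) auto
  qed
  \<comment> \<open>V is the measure of \<Omega>, the constant in the comparison of L1 with L2.
    Dividing by V + 1 below covers V = 0.\<close>
  define V where "V = sqint \<Omega> (\<lambda>x. 1::real)"
  have V: "V \<ge> 0" by (simp add: V_def)
  have cs: "(\<integral>x. norm (f i x - f j x) \<partial>?M)\<^sup>2 \<le> sqint \<Omega> (\<lambda>x. f i x - f j x) * V" for i j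
  proof -
    have "(\<lambda>x. norm (f i x - f j x)) \<in> L2 \<Omega>"
      using L2_diff[OF f[of i] f[of j]] by (simp add: L2_def)
    from L2_Cauchy_Schwarz[OF this L2_const[OF \<Omega>, of 1]] show ?thesis
      by (simp add: V_def sqint_def)
  qed
  obtain r where r: "strict_mono r" and ae: "AE x in ?M. Cauchy (\<lambda>i. f (r i) x)"
  proof (rule cauchy_L1_AE_cauchy_subseq[of ?M f])
    show "integrable ?M (f n)" for n by (rule L1[OF f])
    fix e :: real assume e: "e > 0"
    obtain N where N: "\<forall>i\<ge>N. \<forall>j\<ge>N. sqint \<Omega> (\<lambda>x. f i x - f j x) < e\<^sup>2 / (V + 1)"
      using C[of "e\<^sup>2 / (V + 1)"] e V by auto
    have "(\<integral>x. norm (f i x - f j x) \<partial>?M) < e" if "i \<ge> N" "j \<ge> N" for i j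
    proof -
      have "(\<integral>x. norm (f i x - f j x) \<partial>?M)\<^sup>2 \<le> e\<^sup>2 / (V + 1) * V"
        by (rule order_trans[OF cs[of i j] mult_right_mono]) (use N that V less_imp_le in blast)+
      also have "\<dots> < e\<^sup>2" using V e by (simp add: field_simps)
      finally show ?thesis by (rule power2_less_imp_less) (use e in simp)
    qed
    then show "\<exists>N. \<forall>i\<ge>N. \<forall>j\<ge>N. LINT x|?M. norm (f i x - f j x) < e" by blast
  qed blast
  define g where "g x = lim (\<lambda>i. f (r i) x)" for x
  have [measurable]: "g \<in> borel_measurable ?M" unfolding g_def by measurable
  have conv: "AE x in ?M. (\<lambda>i. f (r i) x) \<longlonglongrightarrow> g x"
    using ae unfolding g_def by eventually_elim (simp add: Cauchy_convergent_iff convergent_LIMSEQ_iff)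
  \<comment> \<open>Fatou is applied along the subsequence with the index n left free, so the bound
    concerns the whole sequence and not only the subsequence.\<close>
  have key: "(\<integral>\<^sup>+x. ennreal ((norm (f n x - g x))\<^sup>2) \<partial>?M) \<le> ennreal e"
    if n: "\<forall>i\<ge>N. \<forall>j\<ge>N. sqint \<Omega> (\<lambda>x. f i x - f j x) < e" "n \<ge> N" for n N e
  proof -
    have "(\<integral>\<^sup>+x. ennreal ((norm (f n x - g x))\<^sup>2) \<partial>?M)
        = (\<integral>\<^sup>+x. liminf (\<lambda>i. ennreal ((norm (f n x - f (r i) x))\<^sup>2)) \<partial>?M)"
    proof (rule nn_integral_cong_AE)
      show "AE x in ?M. ennreal ((norm (f n x - g x))\<^sup>2) = liminf (\<lambda>i. ennreal ((norm (f n x - f (r i) x))\<^sup>2))"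
        using conv
      proof eventually_elim
        case (elim x)
        then have "(\<lambda>i. ennreal ((norm (f n x - f (r i) x))\<^sup>2)) \<longlonglongrightarrow> ennreal ((norm (f n x - g x))\<^sup>2)"
          by (intro tendsto_intros)
        then show ?case by (rule lim_imp_Liminf[OF sequentially_bot, symmetric])
      qed
    qed
    also have "\<dots> \<le> liminf (\<lambda>i. \<integral>\<^sup>+x. ennreal ((norm (f n x - f (r i) x))\<^sup>2) \<partial>?M)"
      by (rule nn_integral_liminf) measurable
    also have "\<dots> \<le> liminf (\<lambda>i. ennreal e)"
    proof (rule Liminf_mono)
      show "\<forall>\<^sub>F i in sequentially. (\<integral>\<^sup>+x. ennreal ((norm (f n x - f (r i) x))\<^sup>2) \<partial>?M) \<le> ennreal e"
        using eventually_ge_at_top[of N]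
      proof eventually_elim
        case (elim i)
        then have "r i \<ge> N" using seq_suble[OF r, of i] by linarith
        then have "sqint \<Omega> (\<lambda>x. f n x - f (r i) x) < e" using n by blast
        then show ?case
          using L2_integrable[OF L2_diff[OF f[of n] f[of "r i"]]]
          by (simp add: nn_integral_eq_integral sqint_def ennreal_leI)
      qed
    qed
    also have "\<dots> = ennreal e" by (simp add: Liminf_const)
    finally show ?thesis .
  qed
  have diff: "(\<lambda>x. f n x - g x) \<in> L2 \<Omega>"
    if "\<forall>i\<ge>N. \<forall>j\<ge>N. sqint \<Omega> (\<lambda>x. f i x - f j x) < e" "n \<ge> N" for n N e
  proof -
    have "integrable ?M (\<lambda>x. (norm (f n x - g x))\<^sup>2)"
    proof (rule integrableI_bounded)
      have "(\<integral>\<^sup>+x. ennreal (norm ((norm (f n x - g x))\<^sup>2)) \<partial>?M) \<le> ennreal e"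
        using key[OF that] by simp
      then show "(\<integral>\<^sup>+x. ennreal (norm ((norm (f n x - g x))\<^sup>2)) \<partial>?M) < \<infinity>"
        using le_less_trans by fastforce
    qed measurable
    then show ?thesis by (simp add: L2_def)
  qed
  show thesis
  proof
    obtain N where "\<forall>i\<ge>N. \<forall>j\<ge>N. sqint \<Omega> (\<lambda>x. f i x - f j x) < 1" using C[of 1] by auto
    \<comment> \<open>Here g is recovered as f N - (f N - g).\<close>
    from L2_diff[OF f[of N] diff[OF this order_refl]] show "g \<in> L2 \<Omega>" by simp
    show "L2_limit \<Omega> f g"
      unfolding L2_limit_def
    proof (rule LIMSEQ_I)
      fix e :: real assume e: "e > 0"
      obtain N where N: "\<forall>i\<ge>N. \<forall>j\<ge>N. sqint \<Omega> (\<lambda>x. f i x - f j x) < e / 2" using C[of "e/2"] e by auto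
      have le: "sqint \<Omega> (\<lambda>x. f n x - g x) \<le> e / 2" if "n \<ge> N" for n
        using key[OF N that] L2_integrable[OF diff[OF N that]] e
        by (simp add: nn_integral_eq_integral sqint_def)
      have "norm (sqint \<Omega> (\<lambda>x. f n x - g x) - 0) < e" if "n \<ge> N" for n
        using le_less_trans[OF le[OF that], of e] e by simp
      then show "\<exists>no. \<forall>n\<ge>no. norm (sqint \<Omega> (\<lambda>x. f n x - g x) - 0) < e" by blast
    qed
  qed
qed


section \<open>Continuously differentiable functions\<close>

lemma C1_fun_has_derivative:
  "C1_fun f \<Longrightarrow> (f has_derivative frechet_derivative f (at x)) (at x)"
  by (simp add: C1_fun_def frechet_derivative_works)

lemma pderiv_dir_eq: "(f has_derivative D) (at x) \<Longrightarrow> pderiv_dir i f x = D i"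
  by (simp add: pderiv_dir_def frechet_derivative_at[symmetric])

lemma C1_funI:
  assumes "\<And>x. (f has_derivative D x) (at x)" "\<And>i. i \<in> Basis \<Longrightarrow> continuous_on UNIV (\<lambda>x. D x i)"
  shows "C1_fun f"
  using assms(2) pderiv_dir_eq[OF assms(1)] differentiableI[OF assms(1)] unfolding C1_fun_def
  by (auto cong: continuous_on_cong)

lemma C1_fun_continuous: "C1_fun f \<Longrightarrow> continuous_on S f"
  by (meson C1_fun_has_derivative continuous_at_imp_continuous_on has_derivative_continuous)

lemma C1_fun_continuous_pderiv: "C1_fun f \<Longrightarrow> i \<in> Basis \<Longrightarrow> continuous_on S (pderiv_dir i f)"
  unfolding C1_fun_def using continuous_on_subset by blast

lemma frechet_derivative_sum_Basis:
  assumes "C1_fun f"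
  shows "frechet_derivative f (at x) v = (\<Sum>i\<in>Basis. (v \<bullet> i) *\<^sub>R pderiv_dir i f x)"
proof -
  interpret bounded_linear "frechet_derivative f (at x)"
    using C1_fun_has_derivative[OF assms] by (rule has_derivative_bounded_linear)
  have "frechet_derivative f (at x) (\<Sum>i\<in>Basis. (v \<bullet> i) *\<^sub>R i) = (\<Sum>i\<in>Basis. (v \<bullet> i) *\<^sub>R pderiv_dir i f x)"
    by (simp add: sum scaleR pderiv_dir_def)
  then show ?thesis by (simp add: euclidean_representation)
qed

lemma C1_fun_continuous_frechet_derivative:
  assumes "C1_fun f" shows "continuous_on S (\<lambda>x. frechet_derivative f (at x) v)"
  unfolding frechet_derivative_sum_Basis[OF assms]
  by (intro continuous_intros C1_fun_continuous_pderiv assms)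

lemma C1_fun_add:
  assumes f: "C1_fun f" and g: "C1_fun g"
  shows "C1_fun (\<lambda>x. f x + g x)" "pderiv_dir i (\<lambda>x. f x + g x) x = pderiv_dir i f x + pderiv_dir i g x"
proof -
  have D: "((\<lambda>x. f x + g x) has_derivative (\<lambda>v. frechet_derivative f (at x) v + frechet_derivative g (at x) v)) (at x)" for x
    by (intro derivative_intros C1_fun_has_derivative f g)
  show "C1_fun (\<lambda>x. f x + g x)"
    by (rule C1_funI[OF D]) (intro continuous_intros C1_fun_continuous_frechet_derivative f g)
  show "pderiv_dir i (\<lambda>x. f x + g x) x = pderiv_dir i f x + pderiv_dir i g x"
    using pderiv_dir_eq[OF D] by (simp add: pderiv_dir_def)
qed

lemma C1_fun_scaleR:
  assumes f: "C1_fun f"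
  shows "C1_fun (\<lambda>x. c *\<^sub>R f x)" "pderiv_dir i (\<lambda>x. c *\<^sub>R f x) x = c *\<^sub>R pderiv_dir i f x"
proof -
  have D: "((\<lambda>x. c *\<^sub>R f x) has_derivative (\<lambda>v. c *\<^sub>R frechet_derivative f (at x) v)) (at x)" for x
    by (intro derivative_intros C1_fun_has_derivative f)
  show "C1_fun (\<lambda>x. c *\<^sub>R f x)"
    by (rule C1_funI[OF D]) (intro continuous_intros C1_fun_continuous_frechet_derivative f)
  show "pderiv_dir i (\<lambda>x. c *\<^sub>R f x) x = c *\<^sub>R pderiv_dir i f x"
    using pderiv_dir_eq[OF D] by (simp add: pderiv_dir_def)
qed

lemma C1_fun_mult:
  fixes f g :: "'a::euclidean_space \<Rightarrow> real"
  assumes f: "C1_fun f" and g: "C1_fun g"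
  shows "C1_fun (\<lambda>x. f x * g x)"
    "pderiv_dir i (\<lambda>x. f x * g x) x = f x * pderiv_dir i g x + pderiv_dir i f x * g x"
proof -
  have D: "((\<lambda>x. f x * g x) has_derivative (\<lambda>v. f x * frechet_derivative g (at x) v + frechet_derivative f (at x) v * g x)) (at x)" for x
    by (intro derivative_intros C1_fun_has_derivative f g)
  show "C1_fun (\<lambda>x. f x * g x)"
    by (rule C1_funI[OF D])
       (intro continuous_intros C1_fun_continuous_frechet_derivative C1_fun_continuous f g)
  show "pderiv_dir i (\<lambda>x. f x * g x) x = f x * pderiv_dir i g x + pderiv_dir i f x * g x"
    using pderiv_dir_eq[OF D] by (simp add: pderiv_dir_def)
qed

lemma C1_fun_inner:
  "C1_fun (\<lambda>x. x \<bullet> v)" "pderiv_dir i (\<lambda>x. x \<bullet> v) x = i \<bullet> v"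
proof -
  have D: "((\<lambda>x. x \<bullet> v) has_derivative (\<lambda>w. w \<bullet> v)) (at x)" for x
    by (intro derivative_intros)
  show "C1_fun (\<lambda>x. x \<bullet> v)" by (rule C1_funI[OF D]) (intro continuous_intros)
  show "pderiv_dir i (\<lambda>x. x \<bullet> v) x = i \<bullet> v" by (rule pderiv_dir_eq[OF D])
qed

lemma C1_fun_const: "C1_fun (\<lambda>x. c)"
  by (rule C1_funI[where D="\<lambda>_ _. 0"]) auto

lemma C1_fun_diff_const: "C1_fun f \<Longrightarrow> C1_fun (\<lambda>x. f x - c)"
  using C1_fun_add(1)[OF _ C1_fun_const[of "-c"], of f] by simp

lemma C1_fun_real_compose:
  fixes f :: "'a::euclidean_space \<Rightarrow> real"
  assumes f: "C1_fun f" and h: "\<And>x. (h has_real_derivative h' (f x)) (at (f x))"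
    and c: "continuous_on (range f) h'"
  shows "C1_fun (\<lambda>x. h (f x))" "pderiv_dir i (\<lambda>x. h (f x)) x = h' (f x) * pderiv_dir i f x"
proof -
  have D: "((\<lambda>x. h (f x)) has_derivative (\<lambda>v. h' (f x) * frechet_derivative f (at x) v)) (at x)" for x
    using has_derivative_compose[OF C1_fun_has_derivative[OF f] h[unfolded has_field_derivative_def]] .
  have "continuous_on UNIV (\<lambda>x. h' (f x))"
    by (rule continuous_on_compose2[OF c C1_fun_continuous[OF f]]) auto
  then show "C1_fun (\<lambda>x. h (f x))"
    by (intro C1_funI[OF D] continuous_intros C1_fun_continuous_frechet_derivative f)
  show "pderiv_dir i (\<lambda>x. h (f x)) x = h' (f x) * pderiv_dir i f x"
    using pderiv_dir_eq[OF D] by (simp add: pderiv_dir_def)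
qed

lemma C1_fun_prod:
  fixes f :: "'i \<Rightarrow> 'a::euclidean_space \<Rightarrow> real"
  assumes "finite I" "\<And>i. i \<in> I \<Longrightarrow> C1_fun (f i)"
  shows "C1_fun (\<lambda>x. \<Prod>i\<in>I. f i x)"
  using assms by (induction I rule: finite_induct) (auto intro!: C1_fun_const C1_fun_mult)

section \<open>Classical gradients and compactly supported test functions\<close>

definition grad :: "('a::euclidean_space \<Rightarrow> real) \<Rightarrow> 'a \<Rightarrow> 'a"
  where "grad \<phi> x = (\<Sum>i\<in>Basis. pderiv_dir i \<phi> x *\<^sub>R i)"

lemma grad_inner_Basis: "i \<in> Basis \<Longrightarrow> grad \<phi> x \<bullet> i = pderiv_dir i \<phi> x"
  by (simp add: grad_def inner_sum_left inner_Basis if_distrib cong: if_cong)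

lemma grad_inner: "C1_fun \<phi> \<Longrightarrow> frechet_derivative \<phi> (at x) v = grad \<phi> x \<bullet> v"
  by (simp add: frechet_derivative_sum_Basis grad_def inner_sum_left mult.commute inner_commute[of v])

lemma grad_add: "C1_fun f \<Longrightarrow> C1_fun g \<Longrightarrow> grad (\<lambda>x. f x + g x) x = grad f x + grad g x"
  by (simp add: grad_def C1_fun_add scaleR_left_distrib sum.distrib)

lemma grad_scaleR: "C1_fun f \<Longrightarrow> grad (\<lambda>x. c * f x) x = c *\<^sub>R grad f x"
  using C1_fun_scaleR(2)[of f _ c] by (simp add: grad_def scaleR_sum_right)

lemma C1_fun_continuous_grad: "C1_fun \<phi> \<Longrightarrow> continuous_on S (grad \<phi>)"
  unfolding grad_def by (intro continuous_intros C1_fun_continuous_pderiv)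

lemma C1cI:
  assumes "C1_fun \<phi>" "compact K" "K \<subseteq> \<Omega>" "\<And>x. x \<notin> K \<Longrightarrow> \<phi> x = 0"
  shows "\<phi> \<in> C1c \<Omega>"
proof -
  have sub: "closure {x. \<phi> x \<noteq> 0} \<subseteq> K"
    using assms by (intro closure_minimal compact_imp_closed) auto
  have "bounded {x. \<phi> x \<noteq> 0}"
    by (rule bounded_subset[OF compact_imp_bounded[OF assms(2)]]) (use assms(4) in auto)
  then show ?thesis using assms(1) order_trans[OF sub assms(3)] by (simp add: C1c_def compact_closure)
qed

lemma C1c_C1: "\<phi> \<in> C1c \<Omega> \<Longrightarrow> C1_fun \<phi>"
  by (simp add: C1c_def)

text \<open>Off its closed support \<phi> agrees with 0 on an open set, so one compact K serves both
  \<phi> and its derivatives.\<close>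

lemma C1c_support:
  assumes "\<phi> \<in> C1c \<Omega>"
  obtains K where "compact K" "K \<subseteq> \<Omega>" "\<And>x. x \<notin> K \<Longrightarrow> \<phi> x = 0" "\<And>x i. x \<notin> K \<Longrightarrow> pderiv_dir i \<phi> x = 0"
proof
  let ?K = "closure {x. \<phi> x \<noteq> 0}"
  show "compact ?K" "?K \<subseteq> \<Omega>" using assms by (auto simp: C1c_def)
  show z: "\<phi> x = 0" if "x \<notin> ?K" for x
    using that closure_subset[of "{x. \<phi> x \<noteq> 0}"] by auto
  show "pderiv_dir i \<phi> x = 0" if "x \<notin> ?K" for x i
  proof -
    have "((\<lambda>x. 0) has_derivative (\<lambda>_. 0)) (at x)" by simp
    then have "(\<phi> has_derivative (\<lambda>_. 0)) (at x)"
      by (rule has_derivative_transform_within_open[where s="- ?K"])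
         (simp only: open_Compl closed_closure, simp only: Compl_iff that not_False_eq_True,
           rule z[symmetric], simp only: Compl_iff not_False_eq_True)
    then show ?thesis by (simp add: pderiv_dir_eq)
  qed
qed

lemma C1c_zero: "(\<lambda>x. 0) \<in> C1c \<Omega>"
  by (rule C1cI[OF C1_fun_const, of "{}"]) auto

lemma C1c_mult:
  assumes "\<phi> \<in> C1c \<Omega>" "C1_fun w" shows "(\<lambda>x. \<phi> x * w x) \<in> C1c \<Omega>"
proof -
  obtain K where K: "compact K" "K \<subseteq> \<Omega>" "\<And>x. x \<notin> K \<Longrightarrow> \<phi> x = 0"
    using assms(1) by (elim C1c_support) blast
  show ?thesis
    by (rule C1cI[OF C1_fun_mult(1)[OF C1c_C1[OF assms(1)] assms(2)] K(1,2)]) (use K in simp)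
qed

lemma C1c_add:
  assumes "\<phi> \<in> C1c \<Omega>" "\<psi> \<in> C1c \<Omega>" shows "(\<lambda>x. \<phi> x + \<psi> x) \<in> C1c \<Omega>"
proof -
  obtain K where K: "compact K" "K \<subseteq> \<Omega>" "\<And>x. x \<notin> K \<Longrightarrow> \<phi> x = 0"
    using assms(1) by (elim C1c_support) blast
  obtain L where L: "compact L" "L \<subseteq> \<Omega>" "\<And>x. x \<notin> L \<Longrightarrow> \<psi> x = 0"
    using assms(2) by (elim C1c_support) blast
  show ?thesis
    by (intro C1cI[of _ "K \<union> L"] C1_fun_add C1c_C1[OF assms(1)] C1c_C1[OF assms(2)] compact_Un) (use K L in auto)
qed

lemma C1c_scale: "\<phi> \<in> C1c \<Omega> \<Longrightarrow> (\<lambda>x. c * \<phi> x) \<in> C1c \<Omega>"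
  using C1c_mult[OF _ C1_fun_const[of c]] by (simp add: mult.commute)

lemma C1c_diff: "\<phi> \<in> C1c \<Omega> \<Longrightarrow> \<psi> \<in> C1c \<Omega> \<Longrightarrow> (\<lambda>x. \<phi> x - \<psi> x) \<in> C1c \<Omega>"
  using C1c_add[OF _ C1c_scale[of \<psi> \<Omega> "-1"]] by simp

lemma grad_diff: "C1_fun f \<Longrightarrow> C1_fun g \<Longrightarrow> grad (\<lambda>x. f x - g x) x = grad f x - grad g x"
  using grad_add[of f "\<lambda>x. -1 * g x"] grad_scaleR[of g "-1"] C1_fun_scaleR(1)[of g "-1"] by simp

lemma C1c_bounded:
  assumes "\<phi> \<in> C1c \<Omega>"
  obtains B where "\<And>x. norm (\<phi> x) \<le> B" "\<And>x. norm (grad \<phi> x) \<le> B"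
proof -
  obtain K where K: "compact K" "\<And>x. x \<notin> K \<Longrightarrow> \<phi> x = 0" "\<And>x i. x \<notin> K \<Longrightarrow> pderiv_dir i \<phi> x = 0"
    using assms by (elim C1c_support) blast
  have "bounded (\<phi> ` K)" "bounded (grad \<phi> ` K)"
    using C1_fun_continuous[OF C1c_C1[OF assms]] C1_fun_continuous_grad[OF C1c_C1[OF assms]] K(1)
    by (auto intro!: compact_imp_bounded compact_continuous_image)
  then obtain a b where "\<And>x. x \<in> K \<Longrightarrow> norm (\<phi> x) \<le> a" "\<And>x. x \<in> K \<Longrightarrow> norm (grad \<phi> x) \<le> b"
    unfolding bounded_iff by auto
  then have "norm (\<phi> x) \<le> max 0 (max a b)" "norm (grad \<phi> x) \<le> max 0 (max a b)" for x
    using K(2,3)[of x] by (cases "x \<in> K"; force simp: grad_def)+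
  then show thesis by (rule that)
qed

lemma continuous_borel_measurable_lebesgue_on:
  "continuous_on UNIV f \<Longrightarrow> f \<in> borel_measurable (lebesgue_on \<Omega>)"
  for f :: "'a::euclidean_space \<Rightarrow> 'b::topological_space"
  by (intro measurable_restrict_space1 measurable_completion)
     (simp add: borel_measurable_continuous_onI)

lemma C1c_L2:
  assumes \<Omega>: "\<Omega> \<in> lmeasurable" and \<phi>: "\<phi> \<in> C1c \<Omega>"
  shows "\<phi> \<in> L2 \<Omega>" "grad \<phi> \<in> L2 \<Omega>"
proof -
  obtain B where "\<And>x. norm (\<phi> x) \<le> B" "\<And>x. norm (grad \<phi> x) \<le> B" using C1c_bounded[OF \<phi>] by metis
  then show "\<phi> \<in> L2 \<Omega>" "grad \<phi> \<in> L2 \<Omega>"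
    using C1_fun_continuous[OF C1c_C1[OF \<phi>]] C1_fun_continuous_grad[OF C1c_C1[OF \<phi>]]
    by (auto intro!: L2_bounded[OF \<Omega>] continuous_borel_measurable_lebesgue_on)
qed

text \<open>The integral of a difference quotient vanishes by translation invariance.\<close>

lemma integral_pderiv_C1c:
  assumes \<Omega>: "\<Omega> \<in> sets lebesgue" and \<phi>: "\<phi> \<in> C1c \<Omega>" and i: "i \<in> Basis"
  shows "(\<integral>x. pderiv_dir i \<phi> x \<partial>lebesgue_on \<Omega>) = 0"
proof -
  obtain K where K: "compact K" "K \<subseteq> \<Omega>" "\<And>x. x \<notin> K \<Longrightarrow> \<phi> x = 0" "\<And>x i. x \<notin> K \<Longrightarrow> pderiv_dir i \<phi> x = 0"
    using \<phi> by (elim C1c_support) blast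
  obtain B where B: "\<And>x. norm (grad \<phi> x) \<le> B" using C1c_bounded[OF \<phi>] by metis
  note C1 = C1c_C1[OF \<phi>]
  have [measurable]: "\<phi> \<in> borel_measurable borel" "pderiv_dir i \<phi> \<in> borel_measurable borel"
    using C1_fun_continuous[OF C1] C1_fun_continuous_pderiv[OF C1 i]
    by (auto intro!: borel_measurable_continuous_onI)
  \<comment> \<open>The increments 1/(n+1) are at most 1, so this closed unit neighbourhood of K
    contains the supports of all the difference quotients.\<close>
  define L where "L = (\<Union>x\<in>K. \<Union>y\<in>cball 0 1. {x + y})"
  have L: "compact L" unfolding L_def using K(1) by (intro compact_sums' compact_cball)
  \<comment> \<open>The Lipschitz constant bounds every difference quotient, so B times the
    indicator of L is the dominating function.\<close>
  have Lip: "\<bar>\<phi> y - \<phi> x\<bar> \<le> B * norm (y - x)" for x y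
  proof -
    have "onorm (frechet_derivative \<phi> (at x)) \<le> B" for x
    proof (rule onorm_le)
      show "norm (frechet_derivative \<phi> (at x) v) \<le> B * norm v" for v
        using Cauchy_Schwarz_ineq2[of "grad \<phi> x" v] mult_right_mono[OF B[of x], of "norm v"]
        by (simp add: grad_inner[OF C1])
    qed
    then have "norm (\<phi> y - \<phi> x) \<le> B * norm (y - x)"
      by (intro differentiable_bound[of UNIV _ "\<lambda>x. frechet_derivative \<phi> (at x)"])
         (auto intro!: C1_fun_has_derivative C1)
    then show ?thesis by simp
  qed
  obtain c where c: "\<And>x. norm (\<phi> x) \<le> c" using C1c_bounded[OF \<phi>] by metis
  have int_\<phi>: "integrable lborel \<phi>"
  proof (rule integrableI_bounded_set[of K])
    show "AE x\<in>K in lborel. norm (\<phi> x) \<le> c" using c by auto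
    show "emeasure lborel K < \<infinity>" using emeasure_compact_finite[OF K(1)] by simp
    show "K \<in> sets lborel" using K(1) by (simp add: compact_imp_closed borel_closed)
  qed (use K in auto)
  define s where "s n x = (\<phi> (x + inverse (real (Suc n)) *\<^sub>R i) - \<phi> x) / inverse (real (Suc n))" for n x
  have "(\<lambda>n. \<integral>x. s n x \<partial>lborel) \<longlonglongrightarrow> (\<integral>x. pderiv_dir i \<phi> x \<partial>lborel)"
  proof (rule integral_dominated_convergence)
    show "integrable lborel (\<lambda>x. B * indicator L x)"
      using L emeasure_compact_finite[OF L]
      by (auto intro!: integrable_mult_right integrable_real_indicator simp: compact_imp_closed borel_closed)
    have "(\<lambda>n. s n x) \<longlonglongrightarrow> pderiv_dir i \<phi> x" for x
    proof -
      have "((\<lambda>h::real. x + h *\<^sub>R i) has_derivative (\<lambda>h. h *\<^sub>R i)) (at 0)"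
        by (auto intro!: derivative_eq_intros)
      from has_derivative_compose[OF this, of \<phi> "frechet_derivative \<phi> (at x)"]
      have "((\<lambda>h. \<phi> (x + h *\<^sub>R i)) has_derivative (\<lambda>h. h *\<^sub>R pderiv_dir i \<phi> x)) (at 0)"
        using C1_fun_has_derivative[OF C1, of x] by (simp add: grad_inner[OF C1] grad_inner_Basis[OF i])
      then have "((\<lambda>h. \<phi> (x + h *\<^sub>R i)) has_real_derivative pderiv_dir i \<phi> x) (at 0)"
        by (simp add: has_field_derivative_def mult_commute_abs)
      then have "((\<lambda>h. (\<phi> (x + h *\<^sub>R i) - \<phi> x) / h) \<longlongrightarrow> pderiv_dir i \<phi> x) (at 0)"
        by (simp add: DERIV_def)
      moreover have "filterlim (\<lambda>n. inverse (real (Suc n))) (at 0) sequentially"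
        by (simp add: filterlim_at LIMSEQ_inverse_real_of_nat del: of_nat_Suc)
      ultimately show ?thesis unfolding s_def by (rule filterlim_compose)
    qed
    then show "AE x in lborel. (\<lambda>n. s n x) \<longlonglongrightarrow> pderiv_dir i \<phi> x" by auto
    have "norm (s n x) \<le> B * indicator L x" for n x
    proof (cases "x \<in> L")
      case True
      have "norm (s n x) = \<bar>\<phi> (x + inverse (real (Suc n)) *\<^sub>R i) - \<phi> x\<bar> / inverse (real (Suc n))"
        unfolding s_def by (simp add: abs_mult del: of_nat_Suc)
      also have "\<dots> \<le> B * norm (inverse (real (Suc n)) *\<^sub>R i) / inverse (real (Suc n))"
        using Lip[of "x + inverse (real (Suc n)) *\<^sub>R i" x] by (intro divide_right_mono) auto
      also have "\<dots> = B" using i by (simp del: of_nat_Suc)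
      finally show ?thesis using True by simp
    next
      case False
      have "x \<notin> K"
      proof
        assume "x \<in> K" then have "x + 0 \<in> L" unfolding L_def by (intro UN_I[of x] UN_I[of 0]) auto
        with False show False by simp
      qed
      moreover have "x + inverse (real (Suc n)) *\<^sub>R i \<notin> K"
      proof
        assume "x + inverse (real (Suc n)) *\<^sub>R i \<in> K"
        then have "(x + inverse (real (Suc n)) *\<^sub>R i) + (- (inverse (real (Suc n)) *\<^sub>R i)) \<in> L"
          unfolding L_def using i
          by (intro UN_I[of "x + inverse (real (Suc n)) *\<^sub>R i"] UN_I[of "- (inverse (real (Suc n)) *\<^sub>R i)"])
             (auto simp: inverse_eq_divide)
        with False show False by simp
      qed
      ultimately show ?thesis using False K(3) by (simp add: s_def)
    qed
    then show "AE x in lborel. norm (s n x) \<le> B * indicator L x" for n by auto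
  qed (auto simp: s_def)
  moreover have "(\<integral>x. s n x \<partial>lborel) = 0" for n
  proof -
    define a where "a = inverse (real (Suc n)) *\<^sub>R i"
    have eq: "(\<integral>x. \<phi> (a + x) \<partial>lborel) = (\<integral>x. \<phi> x \<partial>lborel)"
      using integral_distr[of "(+) a" lborel borel \<phi>] by (simp add: lborel_distr_plus)
    have "integrable lborel (\<lambda>x. \<phi> (a + x))"
      using int_\<phi> integrable_distr_eq[of "(+) a" lborel borel \<phi>] by (simp add: lborel_distr_plus)
    then show ?thesis using int_\<phi> eq unfolding s_def a_def[symmetric] by (simp add: add.commute)
  qed
  ultimately have "(\<integral>x. pderiv_dir i \<phi> x \<partial>lborel) = 0" by (simp add: LIMSEQ_const_iff)
  moreover have "(\<integral>x. pderiv_dir i \<phi> x \<partial>lborel) = (\<integral>x. pderiv_dir i \<phi> x \<partial>lebesgue)"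
    by (simp add: integral_completion)
  moreover have "\<dots> = (\<integral>x. (if x \<in> \<Omega> then pderiv_dir i \<phi> x else 0) \<partial>lebesgue)"
    using K by (intro Bochner_Integration.integral_cong) auto
  moreover have "\<dots> = (\<integral>x. pderiv_dir i \<phi> x \<partial>lebesgue_on \<Omega>)"
    by (rule Lebesgue_Measure.integral_restrict_UNIV[OF \<Omega>])
  ultimately show ?thesis by simp
qed

text \<open>The product \<phi> w is again compactly supported in \<Omega>, so the integral of its
  derivative vanishes. Since w may be nonzero on the boundary, it can be a coordinate
  function.\<close>

lemma C1c_integration_by_parts:
  assumes \<Omega>: "\<Omega> \<in> lmeasurable" and \<phi>: "\<phi> \<in> C1c \<Omega>" and w: "C1_fun w" and i: "i \<in> Basis"
    and int: "integrable (lebesgue_on \<Omega>) (\<lambda>x. \<phi> x * pderiv_dir i w x)"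
      "integrable (lebesgue_on \<Omega>) (\<lambda>x. pderiv_dir i \<phi> x * w x)"
  shows "(\<integral>x. \<phi> x * pderiv_dir i w x \<partial>lebesgue_on \<Omega>) = - (\<integral>x. pderiv_dir i \<phi> x * w x \<partial>lebesgue_on \<Omega>)"
proof -
  have "(\<integral>x. pderiv_dir i (\<lambda>x. \<phi> x * w x) x \<partial>lebesgue_on \<Omega>) = 0"
    using \<Omega> by (intro integral_pderiv_C1c C1c_mult \<phi> w i) auto
  then show ?thesis
    using int by (simp add: C1_fun_mult[OF C1c_C1[OF \<phi>] w])
qed


section \<open>Weak gradients\<close>

text \<open>Squaring removes the corner of the positive part: at 0 the difference quotient is at
  most |h|. Products of such functions give C1 bumps.\<close>

lemma has_real_derivative_square_positive_part:
  "((\<lambda>s. (max 0 s)\<^sup>2) has_real_derivative 2 * max 0 x) (at x)"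
proof (cases x "0::real" rule: linorder_cases)
  case less
  have "((\<lambda>s. 0) has_real_derivative 2 * max 0 x) (at x)" using less by simp
  then show ?thesis
    by (rule has_field_derivative_transform_within_open[of _ _ _ "{..<0}"]) (use less in auto)
next
  case greater
  have "((\<lambda>s. s\<^sup>2) has_real_derivative 2 * max 0 x) (at x)"
    using greater by (auto intro!: derivative_eq_intros)
  then show ?thesis
    by (rule has_field_derivative_transform_within_open[of _ _ _ "{0<..}"]) (use greater in auto)
next
  case equal
  have "((\<lambda>h::real. (max 0 h)\<^sup>2 / h) \<longlongrightarrow> 0) (at 0)"
  proof (rule Lim_null_comparison)
    show "((\<lambda>h::real. \<bar>h\<bar>) \<longlongrightarrow> 0) (at 0)" by (intro tendsto_rabs_zero tendsto_ident_at)
    show "\<forall>\<^sub>F h in at (0::real). norm ((max 0 h)\<^sup>2 / h) \<le> \<bar>h\<bar>"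
      by (auto simp: eventually_at_filter power2_eq_square max_def)
  qed
  then show ?thesis using equal by (simp add: DERIV_def)
qed

text \<open>Every open box is the set where some \<open>C\<^sup>1\<close> function \<open>\<rho> \<ge> 0\<close> does not vanish, so its
  indicator function is the limit of \<open>n \<rho> / (1 + n \<rho>)\<close>.\<close>

lemma box_C1_function:
  fixes a b :: "'a::euclidean_space"
  obtains \<rho> :: "'a \<Rightarrow> real" where "C1_fun \<rho>" "\<And>x. 0 \<le> \<rho> x" "\<And>x. \<rho> x > 0 \<longleftrightarrow> x \<in> box a b"
proof
  \<comment> \<open>The second factor is the squared positive part of
    \<open>b \<bullet> i - x \<bullet> i\<close>, written as an inner product with -i minus a
    constant so that the same C1 rules apply to both factors.\<close>
  define \<rho> where "\<rho> x = (\<Prod>i\<in>Basis. (max 0 (x \<bullet> i - a \<bullet> i))\<^sup>2 * (max 0 (x \<bullet> (- i) - (- (b \<bullet> i))))\<^sup>2)" for x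
  show "C1_fun \<rho>"
    unfolding \<rho>_def
    by (intro C1_fun_prod C1_fun_mult(1) finite_Basis
        C1_fun_real_compose(1)[where h="\<lambda>s. (max 0 s)\<^sup>2" and h'="\<lambda>s. 2 * max 0 s"]
        C1_fun_diff_const C1_fun_inner has_real_derivative_square_positive_part continuous_intros)
  show pos: "0 \<le> \<rho> x" for x unfolding \<rho>_def by (intro prod_nonneg) simp
  have "(max 0 (x \<bullet> i - a \<bullet> i))\<^sup>2 * (max 0 (x \<bullet> (- i) - (- (b \<bullet> i))))\<^sup>2 = 0
      \<longleftrightarrow> \<not> (a \<bullet> i < x \<bullet> i \<and> x \<bullet> i < b \<bullet> i)" for x i
    by (auto simp: max_def)
  then have "\<rho> x = 0 \<longleftrightarrow> x \<notin> box a b" for x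
    unfolding \<rho>_def by (simp add: mem_box)
  then show "\<rho> x > 0 \<longleftrightarrow> x \<in> box a b" for x using pos[of x] by (simp add: order_less_le)
qed

lemma integral_box_eq_0:
  assumes \<Omega>: "\<Omega> \<in> lmeasurable" and g: "g \<in> L2 \<Omega>"
    and 0: "\<And>\<phi>. \<phi> \<in> C1c \<Omega> \<Longrightarrow> (\<integral>x. g x * \<phi> x \<partial>lebesgue_on \<Omega>) = (0::real)"
    and ab: "cbox a b \<subseteq> \<Omega>"
  shows "(\<integral>x. g x * indicator (box a b) x \<partial>lebesgue_on \<Omega>) = 0"
proof -
  note [measurable] = L2_measurable[OF g]
  obtain \<rho> :: "'a \<Rightarrow> real" where C1: "C1_fun \<rho>" and pos: "\<And>x. 0 \<le> \<rho> x" and box: "\<And>x. \<rho> x > 0 \<longleftrightarrow> x \<in> box a b"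
    using box_C1_function by blast
  define \<phi> where "\<phi> n x = real n * \<rho> x / (1 + real n * \<rho> x)" for n x
  have C1c: "\<phi> n \<in> C1c \<Omega>" for n
  proof (rule C1cI[of _ "cbox a b"])
    have nz: "1 + real n * s \<noteq> 0" if "s \<in> range \<rho>" for s
      using that pos by (auto simp: add_nonneg_eq_0_iff)
    show "C1_fun (\<phi> n)"
      unfolding \<phi>_def
    proof (rule C1_fun_real_compose(1)[OF C1, where h="\<lambda>s. real n * s / (1 + real n * s)"
            and h'="\<lambda>s. (real n * (1 + real n * s) - real n * s * real n) / ((1 + real n * s) * (1 + real n * s))"])
      show "((\<lambda>s. real n * s / (1 + real n * s)) has_real_derivative
          (real n * (1 + real n * \<rho> x) - real n * \<rho> x * real n) / ((1 + real n * \<rho> x) * (1 + real n * \<rho> x))) (at (\<rho> x))" for x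
        using nz by (auto intro!: derivative_eq_intros)
      show "continuous_on (range \<rho>) (\<lambda>s. (real n * (1 + real n * s) - real n * s * real n) / ((1 + real n * s) * (1 + real n * s)))"
        using nz by (intro continuous_intros) auto
    qed
    show "\<phi> n x = 0" if "x \<notin> cbox a b" for x
    proof -
      have "\<not> \<rho> x > 0" using that box box_subset_cbox by blast
      then have "\<rho> x = 0" using pos[of x] by simp
      then show ?thesis by (simp add: \<phi>_def)
    qed
  qed (use ab in auto)
  have [measurable]: "\<phi> n \<in> borel_measurable (lebesgue_on \<Omega>)" for n
    by (rule L2_measurable[OF C1c_L2(1)[OF \<Omega> C1c]])
  have [measurable]: "(indicator (box a b) :: 'a \<Rightarrow> real) \<in> borel_measurable (lebesgue_on \<Omega>)"
    by (intro measurable_restrict_space1 borel_measurable_indicator) simp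
  have "(\<lambda>n. \<integral>x. g x * \<phi> n x \<partial>lebesgue_on \<Omega>) \<longlonglongrightarrow> (\<integral>x. g x * indicator (box a b) x \<partial>lebesgue_on \<Omega>)"
  proof (rule integral_dominated_convergence)
    show "integrable (lebesgue_on \<Omega>) (\<lambda>x. norm (g x))"
      by (intro integrable_norm L2_integrable_real[OF \<Omega> g])
    have "(\<lambda>n. \<phi> n x) \<longlonglongrightarrow> indicator (box a b) x" for x
    proof (cases "x \<in> box a b")
      case True
      then have r: "\<rho> x > 0" by (simp add: box)
      have "(\<lambda>n. 1 - 1 / (1 + real n * \<rho> x)) \<longlonglongrightarrow> 1 - 0"
      proof (intro tendsto_intros tendsto_divide_0[OF tendsto_const] filterlim_at_top_imp_at_infinity
          filterlim_tendsto_add_at_top[OF tendsto_const])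
        show "filterlim (\<lambda>n. real n * \<rho> x) at_top sequentially"
          by (rule filterlim_at_top_mult_tendsto_pos[OF tendsto_const r filterlim_real_sequentially])
      qed
      moreover have "1 - 1 / (1 + real n * \<rho> x) = \<phi> n x" for n
      proof -
        have "1 + real n * \<rho> x \<noteq> 0" using r by (simp add: add_nonneg_eq_0_iff)
        then show ?thesis by (simp add: \<phi>_def field_simps)
      qed
      ultimately show ?thesis using True by simp
    next
      case False
      then have "\<rho> x = 0" using box[of x] pos[of x] by simp
      then show ?thesis using False by (simp add: \<phi>_def)
    qed
    then show "AE x in lebesgue_on \<Omega>. (\<lambda>n. g x * \<phi> n x) \<longlonglongrightarrow> g x * indicator (box a b) x"
      by (intro AE_I2 tendsto_mult tendsto_const)
    have "\<bar>\<phi> n x\<bar> \<le> 1" for n x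
      using pos[of x] by (simp add: \<phi>_def divide_le_eq_1 add_pos_nonneg)
    then show "AE x in lebesgue_on \<Omega>. norm (g x * \<phi> n x) \<le> norm (g x)" for n
      by (intro AE_I2) (simp add: abs_mult mult_left_le)
  qed measurable
  then show ?thesis by (simp add: 0[OF C1c] LIMSEQ_const_iff)
qed

text \<open>By Lebesgue differentiation g is almost everywhere the limit of its averages over
  shrinking cubes with corner x, and these averages vanish by \<open>integral_box_eq_0\<close> once
  the cube lies in \<Omega>.\<close>

lemma fundamental_lemma_C1c:
  assumes op: "open \<Omega>" and \<Omega>: "\<Omega> \<in> lmeasurable" and g: "g \<in> L2 \<Omega>"
    and 0: "\<And>\<phi>. \<phi> \<in> C1c \<Omega> \<Longrightarrow> (\<integral>x. g x * \<phi> x \<partial>lebesgue_on \<Omega>) = (0::real)"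
  shows "AE x in lebesgue_on \<Omega>. g x = 0"
proof -
  have \<Omega>': "\<Omega> \<in> sets lebesgue" using \<Omega> by auto
  define G where "G x = (if x \<in> \<Omega> then g x else 0)" for x
  have int: "integrable lebesgue G"
    unfolding G_def[abs_def]
    by (rule Lebesgue_Measure.integrable_restrict_UNIV[OF \<Omega>', THEN iffD2, OF L2_integrable_real[OF \<Omega> g]])
  have "G integrable_on cbox a b" for a b
    by (rule integrable_on_subcbox[OF integrable_on_lebesgue[OF int]]) auto
  then obtain N where N: "negligible N"
    and lim: "\<And>x e. x \<notin> N \<Longrightarrow> 0 < e \<Longrightarrow> \<exists>d>0. \<forall>h. 0 < h \<and> h < d \<longrightarrow>
                norm (integral (cbox x (x + h *\<^sub>R One)) G /\<^sub>R h ^ DIM('a) - G x) < e"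
    using integrable_ccontinuous_explicit[of G] by blast
  have cbox: "integral (cbox a b) G = 0" if "cbox a b \<subseteq> \<Omega>" for a b
  proof -
    have eq: "(\<lambda>x. if x \<in> box a b then G x else 0) = (\<lambda>x. if x \<in> \<Omega> then g x * indicator (box a b) x else 0)"
      using that box_subset_cbox by (force simp: G_def indicator_def)
    have "integrable (lebesgue_on \<Omega>) (\<lambda>x. g x * indicator (box a b) x)"
    proof (rule Bochner_Integration.integrable_bound[OF L2_integrable_real[OF \<Omega> g]])
      show "(\<lambda>x. g x * indicator (box a b) x) \<in> borel_measurable (lebesgue_on \<Omega>)"
        by (intro borel_measurable_times L2_measurable[OF g] measurable_restrict_space1
            borel_measurable_indicator) simp
    qed (auto simp: indicator_def)
    then have "integrable lebesgue (\<lambda>x. if x \<in> box a b then G x else 0)"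
      unfolding eq by (rule Lebesgue_Measure.integrable_restrict_UNIV[OF \<Omega>', THEN iffD2])
    then have "integral UNIV (\<lambda>x. if x \<in> box a b then G x else 0) = (\<integral>x. (if x \<in> box a b then G x else 0) \<partial>lebesgue)"
      by (rule integral_lebesgue)
    also have "\<dots> = 0"
      unfolding eq Lebesgue_Measure.integral_restrict_UNIV[OF \<Omega>']
      by (rule integral_box_eq_0[OF \<Omega> g 0 that])
    finally show ?thesis
      by (simp add: Henstock_Kurzweil_Integration.integral_restrict_UNIV integral_open_interval)
  qed
  have zero: "g x = 0" if x: "x \<in> \<Omega>" "x \<notin> N" for x
  proof (rule ccontr)
    assume "g x \<noteq> 0"
    then obtain d where d: "d > 0" and dlim: "\<forall>h. 0 < h \<and> h < d \<longrightarrow>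
        norm (integral (cbox x (x + h *\<^sub>R One)) G /\<^sub>R h ^ DIM('a) - G x) < \<bar>g x\<bar>"
      using lim[of x "\<bar>g x\<bar>"] x by auto
    obtain r where r: "r > 0" "cball x r \<subseteq> \<Omega>"
      using op x(1) by (auto simp: open_contains_cball)
    \<comment> \<open>The l1 bound on the norm keeps a cube of side at most r / N inside the closed
      ball of radius r; halving d makes h < d strict.\<close>
    define h where "h = min (d / 2) (r / DIM('a))"
    have h: "0 < h" "h < d" "h \<le> r / DIM('a)" using d r by (auto simp: h_def)
    have "cbox x (x + h *\<^sub>R One) \<subseteq> cball x r"
    proof
      fix y assume y: "y \<in> cbox x (x + h *\<^sub>R One)"
      have "norm (y - x) \<le> (\<Sum>i\<in>Basis. \<bar>(y - x) \<bullet> i\<bar>)" by (rule norm_le_l1)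
      also have "\<dots> \<le> (\<Sum>i\<in>(Basis::'a set). h)"
        using y by (intro sum_mono) (auto simp: mem_box inner_simps)
      also have "\<dots> \<le> r" using h by (simp add: field_simps)
      finally show "y \<in> cball x r" by (simp add: dist_norm norm_minus_commute)
    qed
    with r have "integral (cbox x (x + h *\<^sub>R One)) G = 0" by (intro cbox) auto
    with dlim[rule_format, of h] h x show False by (simp add: G_def)
  qed
  have "AE x in lebesgue. x \<notin> N" using N by (simp add: negligible_iff_null_sets AE_not_in)
  then have "AE x in lebesgue. x \<in> \<Omega> \<longrightarrow> g x = 0" using zero by auto
  then show ?thesis using \<Omega>' by (simp add: AE_restrict_space_iff)
qed

lemma C1_fun_pderiv_L2:
  assumes "\<Omega> \<in> lmeasurable" "\<phi> \<in> C1c \<Omega>" "i \<in> Basis"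
  shows "pderiv_dir i \<phi> \<in> L2 \<Omega>"
  using L2_inner_const[OF C1c_L2(2)[OF assms(1,2)], of i] assms(3) by (simp add: grad_inner_Basis)

text \<open>The fundamental lemma applies to each coordinate of g - h. This is what makes the choice
  in \<open>wgrad\<close> harmless.\<close>

lemma weak_gradient_unique:
  assumes op: "open \<Omega>" and \<Omega>: "\<Omega> \<in> lmeasurable" and g: "g \<in> L2 \<Omega>" and h: "h \<in> L2 \<Omega>"
    and ug: "has_weak_gradient \<Omega> u g" and uh: "has_weak_gradient \<Omega> u h"
  shows "AE x in lebesgue_on \<Omega>. g x = h x"
proof -
  have "AE x in lebesgue_on \<Omega>. (g x - h x) \<bullet> i = 0" if i: "i \<in> Basis" for i
  proof (rule fundamental_lemma_C1c[OF op \<Omega> L2_inner_const[OF L2_diff[OF g h]]])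
    fix \<phi> assume \<phi>: "\<phi> \<in> C1c \<Omega>"
    have "integrable (lebesgue_on \<Omega>) (\<lambda>x. (g x \<bullet> i) * \<phi> x)" "integrable (lebesgue_on \<Omega>) (\<lambda>x. (h x \<bullet> i) * \<phi> x)"
      using L2_inner_integrable[OF L2_inner_const[OF g] C1c_L2(1)[OF \<Omega> \<phi>]]
        L2_inner_integrable[OF L2_inner_const[OF h] C1c_L2(1)[OF \<Omega> \<phi>]] by simp_all
    moreover have "(\<integral>x. (g x \<bullet> i) * \<phi> x \<partial>lebesgue_on \<Omega>) = (\<integral>x. (h x \<bullet> i) * \<phi> x \<partial>lebesgue_on \<Omega>)"
      using ug uh \<phi> i unfolding has_weak_gradient_def by fastforce
    ultimately show "(\<integral>x. ((g x - h x) \<bullet> i) * \<phi> x \<partial>lebesgue_on \<Omega>) = 0"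
      by (simp add: inner_diff_left left_diff_distrib)
  qed
  then have "AE x in lebesgue_on \<Omega>. \<forall>i\<in>Basis. (g x - h x) \<bullet> i = 0"
    by (simp add: AE_finite_all)
  then show ?thesis by eventually_elim (auto simp: inner_diff_left intro: euclidean_eqI)
qed

lemma C1c_has_weak_gradient:
  assumes \<Omega>: "\<Omega> \<in> lmeasurable" and \<phi>: "\<phi> \<in> C1c \<Omega>"
  shows "has_weak_gradient \<Omega> \<phi> (grad \<phi>)"
  unfolding has_weak_gradient_def
proof (intro ballI)
  fix \<psi> i assume \<psi>: "\<psi> \<in> C1c \<Omega>" and i: "i \<in> (Basis :: 'a set)"
  show "(\<integral>x. \<phi> x * pderiv_dir i \<psi> x \<partial>lebesgue_on \<Omega>) = - (\<integral>x. (grad \<phi> x \<bullet> i) * \<psi> x \<partial>lebesgue_on \<Omega>)"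
    unfolding grad_inner_Basis[OF i]
    using L2_inner_integrable[OF C1c_L2(1)[OF \<Omega> \<phi>] C1_fun_pderiv_L2[OF \<Omega> \<psi> i]]
      L2_inner_integrable[OF C1_fun_pderiv_L2[OF \<Omega> \<phi> i] C1c_L2(1)[OF \<Omega> \<psi>]]
    by (intro C1c_integration_by_parts \<Omega> \<phi> C1c_C1[OF \<psi>] i) simp_all
qed

lemma has_weak_gradient_diff:
  assumes \<Omega>: "\<Omega> \<in> lmeasurable" and "u \<in> L2 \<Omega>" "v \<in> L2 \<Omega>" "g \<in> L2 \<Omega>" "h \<in> L2 \<Omega>"
    and "has_weak_gradient \<Omega> u g" "has_weak_gradient \<Omega> v h"
  shows "has_weak_gradient \<Omega> (\<lambda>x. u x - v x) (\<lambda>x. g x - h x)"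
  unfolding has_weak_gradient_def
proof (intro ballI)
  fix \<psi> i assume \<psi>: "\<psi> \<in> C1c \<Omega>" and i: "i \<in> (Basis :: 'a set)"
  note p = C1_fun_pderiv_L2[OF \<Omega> \<psi> i] and c = C1c_L2(1)[OF \<Omega> \<psi>]
  have "integrable (lebesgue_on \<Omega>) (\<lambda>x. u x * pderiv_dir i \<psi> x)" "integrable (lebesgue_on \<Omega>) (\<lambda>x. v x * pderiv_dir i \<psi> x)"
    "integrable (lebesgue_on \<Omega>) (\<lambda>x. (g x \<bullet> i) * \<psi> x)" "integrable (lebesgue_on \<Omega>) (\<lambda>x. (h x \<bullet> i) * \<psi> x)"
    using L2_inner_integrable[OF assms(2) p] L2_inner_integrable[OF assms(3) p]
      L2_inner_integrable[OF L2_inner_const[OF assms(4)] c] L2_inner_integrable[OF L2_inner_const[OF assms(5)] c]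
    by simp_all
  then show "(\<integral>x. (u x - v x) * pderiv_dir i \<psi> x \<partial>lebesgue_on \<Omega>) = - (\<integral>x. ((g x - h x) \<bullet> i) * \<psi> x \<partial>lebesgue_on \<Omega>)"
    using assms(6,7) \<psi> i by (simp add: has_weak_gradient_def left_diff_distrib inner_diff_left)
qed

text \<open>Both sides of the defining identity are L2 pairings with a fixed test function, hence
  continuous under \<open>L2_limit\<close>.\<close>

lemma has_weak_gradient_limit:
  assumes \<Omega>: "\<Omega> \<in> lmeasurable" and \<phi>: "\<And>n. \<phi> n \<in> C1c \<Omega>"
    and u: "u \<in> L2 \<Omega>" and g: "g \<in> L2 \<Omega>"
    and lu: "L2_limit \<Omega> \<phi> u" and lg: "L2_limit \<Omega> (\<lambda>n. grad (\<phi> n)) g"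
  shows "has_weak_gradient \<Omega> u g"
  unfolding has_weak_gradient_def
proof (intro ballI)
  fix \<psi> i assume \<psi>: "\<psi> \<in> C1c \<Omega>" and i: "i \<in> (Basis :: 'a set)"
  note p = C1_fun_pderiv_L2[OF \<Omega> \<psi> i] and c = C1c_L2(1)[OF \<Omega> \<psi>]
  have A: "(\<lambda>n. \<integral>x. \<phi> n x * pderiv_dir i \<psi> x \<partial>lebesgue_on \<Omega>) \<longlonglongrightarrow> (\<integral>x. u x * pderiv_dir i \<psi> x \<partial>lebesgue_on \<Omega>)"
    using L2_limit_inner[OF C1c_L2(1)[OF \<Omega> \<phi>] u p lu] by simp
  have B: "(\<lambda>n. \<integral>x. (grad (\<phi> n) x \<bullet> i) * \<psi> x \<partial>lebesgue_on \<Omega>) \<longlonglongrightarrow> (\<integral>x. (g x \<bullet> i) * \<psi> x \<partial>lebesgue_on \<Omega>)"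
    using L2_limit_inner[OF L2_inner_const[OF C1c_L2(2)[OF \<Omega> \<phi>]] L2_inner_const[OF g] c
        L2_limit_inner_const[OF C1c_L2(2)[OF \<Omega> \<phi>] g lg]] by simp
  have C: "(\<integral>x. \<phi> n x * pderiv_dir i \<psi> x \<partial>lebesgue_on \<Omega>) = - (\<integral>x. (grad (\<phi> n) x \<bullet> i) * \<psi> x \<partial>lebesgue_on \<Omega>)" for n
    using C1c_has_weak_gradient[OF \<Omega> \<phi>[of n]] \<psi> i by (simp add: has_weak_gradient_def)
  show "(\<integral>x. u x * pderiv_dir i \<psi> x \<partial>lebesgue_on \<Omega>) = - (\<integral>x. (g x \<bullet> i) * \<psi> x \<partial>lebesgue_on \<Omega>)"
    by (rule LIMSEQ_unique[OF A]) (use tendsto_minus[OF B] in \<open>simp add: C\<close>)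
qed

section \<open>The chosen gradient up to null sets, and \<open>H10\<close> by sequences\<close>

lemma sqint_cong_AE:
  assumes "f \<in> L2 \<Omega>" "g \<in> L2 \<Omega>" "AE x in lebesgue_on \<Omega>. f x = g x"
  shows "sqint \<Omega> f = sqint \<Omega> g"
  unfolding sqint_def
proof (rule integral_cong_AE)
  show "AE x in lebesgue_on \<Omega>. (norm (f x))\<^sup>2 = (norm (g x))\<^sup>2" using assms(3) by auto
qed (use L2_integrable[OF assms(1)] L2_integrable[OF assms(2)] in auto)

lemma wgrad_eq:
  assumes "open \<Omega>" "\<Omega> \<in> lmeasurable" "g \<in> L2 \<Omega>" "has_weak_gradient \<Omega> u g"
  shows "wgrad \<Omega> u \<in> L2 \<Omega>" "has_weak_gradient \<Omega> u (wgrad \<Omega> u)" "AE x in lebesgue_on \<Omega>. wgrad \<Omega> u x = g x"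
proof -
  have "wgrad \<Omega> u \<in> L2 \<Omega> \<and> has_weak_gradient \<Omega> u (wgrad \<Omega> u)"
    unfolding wgrad_def by (rule someI[of _ g]) (use assms in simp)
  then show "wgrad \<Omega> u \<in> L2 \<Omega>" "has_weak_gradient \<Omega> u (wgrad \<Omega> u)" by auto
  then show "AE x in lebesgue_on \<Omega>. wgrad \<Omega> u x = g x"
    by (intro weak_gradient_unique[OF assms(1,2) _ assms(3) _ assms(4)])
qed

lemma H1_norm_eq:
  assumes "open \<Omega>" "\<Omega> \<in> lmeasurable" "g \<in> L2 \<Omega>" "has_weak_gradient \<Omega> u g"
  shows "H1_norm \<Omega> u = sqrt (sqint \<Omega> u + sqint \<Omega> g)"
  using sqint_cong_AE[OF wgrad_eq(1)[OF assms] assms(3) wgrad_eq(3)[OF assms]]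
  by (simp add: H1_norm_def sqint_def)

text \<open>Sequential form of the closure in the definition of \<open>H10\<close>. The limit g must
  first be recognised as a weak gradient of u, because \<open>H1_norm\<close> of u - \<phi> n is
  computed from a weak gradient of that difference.\<close>

lemma H10I:
  assumes op: "open \<Omega>" and \<Omega>: "\<Omega> \<in> lmeasurable" and \<phi>: "\<And>n. \<phi> n \<in> C1c \<Omega>"
    and u: "u \<in> L2 \<Omega>" and g: "g \<in> L2 \<Omega>"
    and lu: "L2_limit \<Omega> \<phi> u" and lg: "L2_limit \<Omega> (\<lambda>n. grad (\<phi> n)) g"
  shows "u \<in> H10 \<Omega>" "AE x in lebesgue_on \<Omega>. wgrad \<Omega> u x = g x"
proof -
  have ug: "has_weak_gradient \<Omega> u g" by (rule has_weak_gradient_limit[OF \<Omega> \<phi> u g lu lg])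
  then show "AE x in lebesgue_on \<Omega>. wgrad \<Omega> u x = g x" by (rule wgrad_eq[OF op \<Omega> g])
  have H: "H1_norm \<Omega> (\<lambda>x. u x - \<phi> n x) = sqrt (sqint \<Omega> (\<lambda>x. \<phi> n x - u x) + sqint \<Omega> (\<lambda>x. grad (\<phi> n) x - g x))" for n
    using H1_norm_eq[OF op \<Omega> L2_diff[OF g C1c_L2(2)[OF \<Omega> \<phi>]]
        has_weak_gradient_diff[OF \<Omega> u C1c_L2(1)[OF \<Omega> \<phi>] g C1c_L2(2)[OF \<Omega> \<phi>] ug C1c_has_weak_gradient[OF \<Omega> \<phi>]], of n]
    by (simp add: sqint_minus_commute[of _ u] sqint_minus_commute[of _ g])
  have "(\<lambda>n. H1_norm \<Omega> (\<lambda>x. u x - \<phi> n x)) \<longlonglongrightarrow> sqrt (0 + 0)"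
    unfolding H by (intro tendsto_intros lu[unfolded L2_limit_def] lg[unfolded L2_limit_def])
  then have lim: "(\<lambda>n. H1_norm \<Omega> (\<lambda>x. u x - \<phi> n x)) \<longlonglongrightarrow> 0" by simp
  have "\<exists>\<phi>\<in>C1c \<Omega>. H1_norm \<Omega> (\<lambda>x. u x - \<phi> x) < e" if "e > 0" for e
    using order_tendstoD(2)[OF lim that] \<phi> by (auto simp: eventually_sequentially)
  then show "u \<in> H10 \<Omega>" using u g ug by (auto simp: H10_def H1_def)
qed

lemma H10D:
  assumes op: "open \<Omega>" and \<Omega>: "\<Omega> \<in> lmeasurable" and u: "u \<in> H10 \<Omega>"
  obtains \<phi> where "u \<in> L2 \<Omega>" "wgrad \<Omega> u \<in> L2 \<Omega>" "\<And>n. \<phi> n \<in> C1c \<Omega>"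
    "L2_limit \<Omega> \<phi> u" "L2_limit \<Omega> (\<lambda>n. grad (\<phi> n)) (wgrad \<Omega> u)"
proof -
  have L: "u \<in> L2 \<Omega>" using u by (simp add: H10_def H1_def)
  obtain g where g: "g \<in> L2 \<Omega>" "has_weak_gradient \<Omega> u g" using u by (auto simp: H10_def H1_def)
  note w = wgrad_eq(1,2)[OF op \<Omega> g]
  have "\<exists>\<phi>\<in>C1c \<Omega>. H1_norm \<Omega> (\<lambda>x. u x - \<phi> x) < inverse (real (Suc n))" for n
    using u by (simp add: H10_def del: of_nat_Suc)
  then obtain \<phi> where \<phi>: "\<And>n. \<phi> n \<in> C1c \<Omega>" and H: "\<And>n. H1_norm \<Omega> (\<lambda>x. u x - \<phi> n x) < inverse (real (Suc n))"
    by metis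
  have b: "sqrt (sqint \<Omega> (\<lambda>x. \<phi> n x - u x) + sqint \<Omega> (\<lambda>x. grad (\<phi> n) x - wgrad \<Omega> u x)) < inverse (real (Suc n))" for n
    using H1_norm_eq[OF op \<Omega> L2_diff[OF w(1) C1c_L2(2)[OF \<Omega> \<phi>]]
        has_weak_gradient_diff[OF \<Omega> L C1c_L2(1)[OF \<Omega> \<phi>] w(1) C1c_L2(2)[OF \<Omega> \<phi>] w(2) C1c_has_weak_gradient[OF \<Omega> \<phi>]], of n] H[of n]
    by (simp add: sqint_minus_commute[of _ u] sqint_minus_commute[of _ "wgrad \<Omega> u"])
  have "(\<lambda>n. sqrt (sqint \<Omega> (\<lambda>x. \<phi> n x - u x) + sqint \<Omega> (\<lambda>x. grad (\<phi> n) x - wgrad \<Omega> u x))) \<longlonglongrightarrow> 0"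
    by (rule tendsto_sandwich[OF _ _ tendsto_const LIMSEQ_inverse_real_of_nat])
       (use b in \<open>auto intro!: always_eventually simp: less_imp_le simp del: of_nat_Suc\<close>)
  then have "(\<lambda>n. (sqrt (sqint \<Omega> (\<lambda>x. \<phi> n x - u x) + sqint \<Omega> (\<lambda>x. grad (\<phi> n) x - wgrad \<Omega> u x)))\<^sup>2) \<longlonglongrightarrow> 0\<^sup>2"
    by (rule tendsto_power)
  then have lim: "(\<lambda>n. sqint \<Omega> (\<lambda>x. \<phi> n x - u x) + sqint \<Omega> (\<lambda>x. grad (\<phi> n) x - wgrad \<Omega> u x)) \<longlonglongrightarrow> 0"
    by (simp add: real_sqrt_pow2)
  have "L2_limit \<Omega> \<phi> u" unfolding L2_limit_def
    by (rule tendsto_sandwich[OF _ _ tendsto_const lim]) auto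
  moreover have "L2_limit \<Omega> (\<lambda>n. grad (\<phi> n)) (wgrad \<Omega> u)" unfolding L2_limit_def
    by (rule tendsto_sandwich[OF _ _ tendsto_const lim]) auto
  ultimately show thesis using that L w(1) \<phi> by blast
qed

lemma C1c_H10:
  assumes op: "open \<Omega>" and \<Omega>: "\<Omega> \<in> lmeasurable" and \<phi>: "\<phi> \<in> C1c \<Omega>"
  shows "\<phi> \<in> H10 \<Omega>" "AE x in lebesgue_on \<Omega>. wgrad \<Omega> \<phi> x = grad \<phi> x"
  by (rule H10I[OF op \<Omega> \<phi> C1c_L2[OF \<Omega> \<phi>]]; simp add: L2_limit_def sqint_def)+


section \<open>Existence of weak solutions\<close>

locale two_phase =
  fixes \<sigma>c \<sigma>s :: real and D \<Omega> :: "'a::euclidean_space set"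
  assumes pos: "0 < \<sigma>c" "0 < \<sigma>s"
    and open_\<Omega>: "open \<Omega>" and bounded_\<Omega>: "bounded \<Omega>" and D_sets: "D \<in> sets lebesgue"
begin

abbreviation "\<sigma> \<equiv> conductivity \<sigma>c \<sigma>s D"

definition W :: "('a \<Rightarrow> 'a) \<Rightarrow> 'a \<Rightarrow> 'a" where "W g x = sqrt (\<sigma> x) *\<^sub>R g x"

text \<open>The flux \<open>q = x / N\<close> satisfies \<open>div q = 1\<close>; in the unknown \<open>W \<nabla>u\<close> the state equation becomes
  \<open>W \<nabla>u + P \<bottom> W \<nabla>\<psi>\<close> in \<open>L\<^sup>2\<close>, so that \<open>W \<nabla>u\<close> is the projection of \<open>-P\<close>.\<close>

definition P :: "'a \<Rightarrow> 'a" where "P x = (1 / sqrt (\<sigma> x)) *\<^sub>R (x /\<^sub>R DIM('a))"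

lemma lmeasurable: "\<Omega> \<in> lmeasurable"
  using lmeasurable_open[OF bounded_\<Omega> open_\<Omega>] .

lemma \<sigma>_pos: "0 < \<sigma> x" and \<sigma>_bounds: "min \<sigma>c \<sigma>s \<le> \<sigma> x" "\<sigma> x \<le> max \<sigma>c \<sigma>s"
  using pos by (auto simp: conductivity_def)

lemma \<sigma>_measurable [measurable]: "\<sigma> \<in> borel_measurable (lebesgue_on \<Omega>)"
proof -
  have "(\<lambda>x. if x \<in> D then \<sigma>c else \<sigma>s) \<in> borel_measurable lebesgue"
    using D_sets by measurable
  then show ?thesis unfolding conductivity_def[abs_def] by (rule measurable_restrict_space1)
qed

lemma sqrt_\<sigma>_bound: "\<bar>sqrt (\<sigma> x)\<bar> \<le> sqrt (max \<sigma>c \<sigma>s)"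
  using \<sigma>_pos[of x] \<sigma>_bounds[of x] by simp

lemma W_L2: "g \<in> L2 \<Omega> \<Longrightarrow> W g \<in> L2 \<Omega>"
  unfolding W_def[abs_def] using sqrt_\<sigma>_bound by (intro L2_mult_bounded) auto

lemma W_limit: "(\<And>n. f n \<in> L2 \<Omega>) \<Longrightarrow> g \<in> L2 \<Omega> \<Longrightarrow> L2_limit \<Omega> f g \<Longrightarrow> L2_limit \<Omega> (\<lambda>n. W (f n)) (W g)"
  unfolding W_def[abs_def] using sqrt_\<sigma>_bound by (intro L2_limit_mult_bounded) auto

lemma W_inner: "W g x \<bullet> W h x = \<sigma> x * (g x \<bullet> h x)"
  using \<sigma>_pos[of x] by (simp add: W_def mult.assoc[symmetric])

lemma W_norm: "(norm (W g x))\<^sup>2 = \<sigma> x * (norm (g x))\<^sup>2"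
  by (simp add: power2_norm_eq_inner W_inner)

text \<open>Ellipticity: a bound on the weighted gradient controls the gradient itself, which makes
  minimising sequences Cauchy.\<close>

lemma W_lower: "g \<in> L2 \<Omega> \<Longrightarrow> min \<sigma>c \<sigma>s * sqint \<Omega> g \<le> sqint \<Omega> (W g)"
  unfolding sqint_def integral_mult_right_zero[symmetric]
  using L2_integrable[of g] L2_integrable[OF W_L2[of g]] \<sigma>_bounds
  by (intro integral_mono) (auto simp: W_norm intro: mult_right_mono)

section \<open>The flux q, its divergence identity and the Poincare inequality\<close>

lemma q_L2: "(\<lambda>x. x /\<^sub>R DIM('a)) \<in> L2 \<Omega>"
proof -
  obtain B where "\<And>x. x \<in> \<Omega> \<Longrightarrow> norm x \<le> B" using bounded_\<Omega> by (auto simp: bounded_iff)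
  then have "(\<lambda>x. x) \<in> L2 \<Omega>"
    by (intro L2_bounded[OF lmeasurable] continuous_borel_measurable_lebesgue_on continuous_intros)
  then show ?thesis by (rule L2_scaleR)
qed

lemma P_L2: "P \<in> L2 \<Omega>"
  unfolding P_def[abs_def]
proof (rule L2_mult_bounded[OF _ _ q_L2])
  show "\<bar>1 / sqrt (\<sigma> x)\<bar> \<le> 1 / sqrt (min \<sigma>c \<sigma>s)" for x
    using \<sigma>_bounds[of x] pos by (auto intro!: divide_left_mono mult_pos_pos simp: \<sigma>_pos)
qed measurable

lemma P_inner: "P x \<bullet> W g x = (x /\<^sub>R DIM('a)) \<bullet> g x"
  using \<sigma>_pos[of x] by (simp add: P_def W_def)

text \<open>Weak form of div q = 1. Integrating by parts against each coordinate function already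
  yields the integral of \<phi>; the N resulting identities are averaged.\<close>

lemma integral_C1c_eq:
  assumes \<phi>: "\<phi> \<in> C1c \<Omega>"
  shows "(\<integral>x. \<phi> x \<partial>lebesgue_on \<Omega>) = - (\<integral>x. (x /\<^sub>R DIM('a)) \<bullet> grad \<phi> x \<partial>lebesgue_on \<Omega>)"
proof -
  let ?M = "lebesgue_on \<Omega>"
  have i: "(\<integral>x. \<phi> x \<partial>?M) = - (\<integral>x. pderiv_dir i \<phi> x * (x \<bullet> i) \<partial>?M)"
    and int: "integrable ?M (\<lambda>x. pderiv_dir i \<phi> x * (x \<bullet> i))" if i: "i \<in> Basis" for i
  proof -
    have "(\<lambda>x. (x /\<^sub>R DIM('a)) \<bullet> (DIM('a) *\<^sub>R i)) \<in> L2 \<Omega>" by (rule L2_inner_const[OF q_L2])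
    then have "(\<lambda>x. x \<bullet> i) \<in> L2 \<Omega>" by (simp flip: mult.assoc)
    from L2_inner_integrable[OF C1_fun_pderiv_L2[OF lmeasurable \<phi> i] this]
    show int: "integrable ?M (\<lambda>x. pderiv_dir i \<phi> x * (x \<bullet> i))" by simp
    then show "(\<integral>x. \<phi> x \<partial>?M) = - (\<integral>x. pderiv_dir i \<phi> x * (x \<bullet> i) \<partial>?M)"
      using C1c_integration_by_parts[OF lmeasurable \<phi> C1_fun_inner(1)[of i] i]
        L2_integrable_real[OF lmeasurable C1c_L2(1)[OF lmeasurable \<phi>]] i
      by (simp add: C1_fun_inner)
  qed
  have "DIM('a) * (\<integral>x. \<phi> x \<partial>?M) = (\<Sum>i\<in>(Basis::'a set). \<integral>x. \<phi> x \<partial>?M)" by simp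
  also have "\<dots> = (\<Sum>i\<in>Basis. - (\<integral>x. pderiv_dir i \<phi> x * (x \<bullet> i) \<partial>?M))"
    by (rule sum.cong[OF refl i])
  also have "\<dots> = - (\<integral>x. (\<Sum>i\<in>Basis. pderiv_dir i \<phi> x * (x \<bullet> i)) \<partial>?M)"
    using int by (simp add: sum_negf)
  also have "(\<lambda>x. \<Sum>i\<in>Basis. pderiv_dir i \<phi> x * (x \<bullet> i)) = (\<lambda>x. x \<bullet> grad \<phi> x)"
    by (simp add: grad_def inner_sum_right)
  finally show ?thesis by (simp add: field_simps)
qed

text \<open>The divergence identity for \<phi>^2 bounds its integral by twice the pairing of \<phi>
  q with the gradient. On \<Omega> one has |q| \<le> |x| \<le> B, so Cauchy-Schwarz gives the
  constant 4 B^2 after one factor \<open>sqint \<Omega> \<phi>\<close> is cancelled.\<close>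

lemma Poincare:
  obtains C where "0 \<le> C" "\<And>\<phi>. \<phi> \<in> C1c \<Omega> \<Longrightarrow> sqint \<Omega> \<phi> \<le> C * sqint \<Omega> (grad \<phi>)"
proof -
  let ?M = "lebesgue_on \<Omega>"
  obtain B where B: "\<And>x. x \<in> \<Omega> \<Longrightarrow> norm x \<le> B" using bounded_\<Omega> by (auto simp: bounded_iff)
  show thesis
  proof
    show "0 \<le> 4 * B\<^sup>2" by simp
    fix \<phi> assume \<phi>: "\<phi> \<in> C1c \<Omega>"
    note C1 = C1c_C1[OF \<phi>]
    define Q where "Q x = \<phi> x *\<^sub>R (x /\<^sub>R DIM('a))" for x
    obtain b where b: "\<And>x. norm (\<phi> x) \<le> b" using C1c_bounded[OF \<phi>] by metis
    have Q: "Q \<in> L2 \<Omega>" unfolding Q_def[abs_def]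
      by (rule L2_mult_bounded[OF L2_measurable[OF C1c_L2(1)[OF lmeasurable \<phi>]] _ q_L2, of b]) (use b in simp)
    have "sqint \<Omega> Q \<le> B\<^sup>2 * sqint \<Omega> \<phi>"
      unfolding sqint_def integral_mult_right_zero[symmetric]
    proof (rule integral_mono)
      fix x assume "x \<in> space ?M"
      then have x: "norm x \<le> B" using B by simp
      have "norm (x /\<^sub>R DIM('a)) \<le> norm x"
        using DIM_positive[where 'a='a] by (simp add: divide_le_eq field_simps mult_le_cancel_left1)
      then have "(norm (x /\<^sub>R DIM('a)))\<^sup>2 \<le> B\<^sup>2" 
        by (intro power_mono[OF order_trans[OF _ x] norm_ge_zero])
      then have "(norm (x /\<^sub>R DIM('a)))\<^sup>2 * (norm (\<phi> x))\<^sup>2 \<le> B\<^sup>2 * (norm (\<phi> x))\<^sup>2"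
        by (rule mult_right_mono) simp
      then show "(norm (Q x))\<^sup>2 \<le> B\<^sup>2 * (norm (\<phi> x))\<^sup>2"
        unfolding Q_def norm_scaleR[of "\<phi> x"] power_mult_distrib
        by (simp only: real_norm_def mult.commute[of "\<bar>\<phi> x\<bar>\<^sup>2"])
    qed (use L2_integrable[OF Q] L2_integrable[OF C1c_L2(1)[OF lmeasurable \<phi>]] in auto)
    have "grad (\<lambda>x. \<phi> x * \<phi> x) x = (2 * \<phi> x) *\<^sub>R grad \<phi> x" for x
      by (simp add: grad_def C1_fun_mult[OF C1 C1] scaleR_sum_right mult.assoc)
    then have "sqint \<Omega> \<phi> = - (\<integral>x. 2 * (Q x \<bullet> grad \<phi> x) \<partial>?M)"
      using integral_C1c_eq[OF C1c_mult[OF \<phi> C1]] by (simp add: sqint_def power2_eq_square Q_def mult.assoc)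
    then have "(sqint \<Omega> \<phi>)\<^sup>2 = 4 * (\<integral>x. Q x \<bullet> grad \<phi> x \<partial>?M)\<^sup>2" by (simp add: power2_eq_square)
    also have "\<dots> \<le> 4 * (sqint \<Omega> Q * sqint \<Omega> (grad \<phi>))"
      using L2_Cauchy_Schwarz[OF Q C1c_L2(2)[OF lmeasurable \<phi>]] by simp
    also have "\<dots> \<le> 4 * (B\<^sup>2 * sqint \<Omega> \<phi> * sqint \<Omega> (grad \<phi>))"
      using \<open>sqint \<Omega> Q \<le> _\<close> by (intro mult_left_mono mult_right_mono) auto
    finally have "sqint \<Omega> \<phi> * sqint \<Omega> \<phi> \<le> sqint \<Omega> \<phi> * (4 * B\<^sup>2 * sqint \<Omega> (grad \<phi>))"
      by (simp add: power2_eq_square mult_ac)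
    then show "sqint \<Omega> \<phi> \<le> 4 * B\<^sup>2 * sqint \<Omega> (grad \<phi>)"
      using sqint_nonneg[of \<Omega> \<phi>] sqint_nonneg[of \<Omega> "grad \<phi>"]
      by (cases "sqint \<Omega> \<phi> = 0") (auto simp: mult_le_cancel_left)
  qed
qed

text \<open>Extends the divergence identity to \<open>H10\<close> by density. It rewrites the load
  as an L2 pairing with -\<open>P\<close>, turning the state equation into an orthogonality
  relation; it is also the admissibility of q in Thomson's principle.\<close>

lemma H10_integral_eq:
  assumes u: "u \<in> H10 \<Omega>"
  shows "(\<integral>x. u x \<partial>lebesgue_on \<Omega>) = - (\<integral>x. P x \<bullet> W (wgrad \<Omega> u) x \<partial>lebesgue_on \<Omega>)"
proof -
  obtain \<phi> where L: "u \<in> L2 \<Omega>" "wgrad \<Omega> u \<in> L2 \<Omega>" and \<phi>: "\<And>n. \<phi> n \<in> C1c \<Omega>"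
    and lim: "L2_limit \<Omega> \<phi> u" "L2_limit \<Omega> (\<lambda>n. grad (\<phi> n)) (wgrad \<Omega> u)"
    using H10D[OF open_\<Omega> lmeasurable u] by metis
  have "(\<lambda>n. \<integral>x. \<phi> n x \<bullet> 1 \<partial>lebesgue_on \<Omega>) \<longlonglongrightarrow> (\<integral>x. u x \<bullet> 1 \<partial>lebesgue_on \<Omega>)"
    by (rule L2_limit_inner[OF C1c_L2(1)[OF lmeasurable \<phi>] L(1) L2_const[OF lmeasurable] lim(1)])
  moreover have "(\<lambda>n. \<integral>x. grad (\<phi> n) x \<bullet> (x /\<^sub>R DIM('a)) \<partial>lebesgue_on \<Omega>)
      \<longlonglongrightarrow> (\<integral>x. wgrad \<Omega> u x \<bullet> (x /\<^sub>R DIM('a)) \<partial>lebesgue_on \<Omega>)"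
    by (rule L2_limit_inner[OF C1c_L2(2)[OF lmeasurable \<phi>] L(2) q_L2 lim(2)])
  ultimately have "(\<integral>x. u x \<bullet> 1 \<partial>lebesgue_on \<Omega>) = - (\<integral>x. wgrad \<Omega> u x \<bullet> (x /\<^sub>R DIM('a)) \<partial>lebesgue_on \<Omega>)"
    using integral_C1c_eq[OF \<phi>] by (intro LIMSEQ_unique) (auto intro!: tendsto_minus simp: inner_commute)
  then show ?thesis by (simp add: P_inner inner_commute)
qed

section \<open>The direct method for the state equation, and the energy bounds\<close>

lemma W_combination:
  assumes "C1_fun \<phi>" "C1_fun \<psi>"
  shows "W (grad (\<lambda>x. \<phi> x + s * \<psi> x)) x = W (grad \<phi>) x + s *\<^sub>R W (grad \<psi>) x"
proof -
  have "C1_fun (\<lambda>x. s * \<psi> x)" using C1_fun_scaleR(1)[OF assms(2), of s] by simp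
  then show ?thesis
    using assms by (simp add: W_def grad_add grad_scaleR scaleR_right_distrib)
qed

lemma sqint_parallelogram:
  assumes f: "f \<in> L2 \<Omega>" and g: "g \<in> L2 \<Omega>"
  shows "sqint \<Omega> (\<lambda>x. f x - g x) = 2 * sqint \<Omega> f + 2 * sqint \<Omega> g - 4 * sqint \<Omega> (\<lambda>x. (1/2) *\<^sub>R (f x + g x))"
  using sqint_expand[OF f g, of "1"] sqint_expand[OF f g, of "-1"] sqint_scaleR[of \<Omega> "1/2" "\<lambda>x. f x + g x"]
  by (simp add: power2_eq_square)

text \<open>Direct method: the squared distance from \<open>W\<close> of a gradient to
  -\<open>P\<close> is minimised over \<open>C1c\<close>. The parallelogram law makes a minimising
  sequence Cauchy, completeness and Poincare provide its limit in \<open>H10\<close>, and the first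
  variation is the state equation.\<close>

lemma weak_solution_exists: "\<exists>u. weak_solution \<sigma>c \<sigma>s D \<Omega> u"
proof -
  let ?M = "lebesgue_on \<Omega>"
  define F where "F \<phi> x = W (grad \<phi>) x + P x" for \<phi> x
  define d where "d = (INF \<phi>\<in>C1c \<Omega>. sqint \<Omega> (F \<phi>))"
  have F_L2: "F \<phi> \<in> L2 \<Omega>" if "\<phi> \<in> C1c \<Omega>" for \<phi>
    unfolding F_def[abs_def] by (intro L2_add W_L2 P_L2 C1c_L2 lmeasurable that)
  have bdd: "bdd_below ((\<lambda>\<phi>. sqint \<Omega> (F \<phi>)) ` C1c \<Omega>)" by (rule bdd_belowI[of _ 0]) auto
  have d_le: "d \<le> sqint \<Omega> (F \<phi>)" if "\<phi> \<in> C1c \<Omega>" for \<phi>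
    unfolding d_def by (rule cINF_lower[OF bdd that])
  have "\<exists>\<phi>\<in>C1c \<Omega>. sqint \<Omega> (F \<phi>) < d + inverse (real (Suc n))" for n
    using cINF_less_iff[OF _ bdd, of "d + inverse (real (Suc n))"] C1c_zero[of \<Omega>]
    unfolding d_def[symmetric] by auto
  then obtain \<phi> where \<phi>: "\<And>n. \<phi> n \<in> C1c \<Omega>" and near: "\<And>n. sqint \<Omega> (F (\<phi> n)) < d + inverse (real (Suc n))"
    by metis
  have lim_d: "(\<lambda>n. sqint \<Omega> (F (\<phi> n))) \<longlonglongrightarrow> d"
  proof (rule tendsto_sandwich[OF _ _ tendsto_const LIMSEQ_inverse_real_of_nat_add])
    show "\<forall>\<^sub>F n in sequentially. d \<le> sqint \<Omega> (F (\<phi> n))" using d_le \<phi> by simp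
    show "\<forall>\<^sub>F n in sequentially. sqint \<Omega> (F (\<phi> n)) \<le> d + inverse (real (Suc n))"
      using near by (auto intro!: always_eventually less_imp_le)
  qed
  \<comment> \<open>The midpoint of two test functions is a test function, so its value is at least
    d; the parallelogram law then bounds the difference by the two excesses over d.\<close>
  have mid: "sqint \<Omega> (W (grad (\<lambda>x. \<phi> i x - \<phi> j x))) \<le> 2 * inverse (real (Suc i)) + 2 * inverse (real (Suc j))" for i j
  proof -
    have "(\<lambda>x. (1/2) * \<phi> i x + (1/2) * \<phi> j x) \<in> C1c \<Omega>" by (intro C1c_add C1c_scale \<phi>)
    moreover have "F (\<lambda>x. (1/2) * \<phi> i x + (1/2) * \<phi> j x) = (\<lambda>x. (1/2) *\<^sub>R (F (\<phi> i) x + F (\<phi> j) x))"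
    proof
      fix x
      have half: "P x = (1/2) *\<^sub>R P x + (1/2) *\<^sub>R P x" by (simp flip: scaleR_left_distrib)
      have "W (grad (\<lambda>x. (1/2) * \<phi> i x + (1/2) * \<phi> j x)) x = (1/2) *\<^sub>R W (grad (\<phi> i)) x + (1/2) *\<^sub>R W (grad (\<phi> j)) x"
        unfolding W_def grad_add[OF C1c_C1[OF C1c_scale[OF \<phi>]] C1c_C1[OF C1c_scale[OF \<phi>]]]
          grad_scaleR[OF C1c_C1[OF \<phi>]]
        by (simp add: scaleR_right_distrib)
      then show "F (\<lambda>x. (1/2) * \<phi> i x + (1/2) * \<phi> j x) x = (1/2) *\<^sub>R (F (\<phi> i) x + F (\<phi> j) x)"
        unfolding F_def scaleR_right_distrib by (subst half) (simp only: add_ac)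
    qed
    ultimately have "d \<le> sqint \<Omega> (\<lambda>x. (1/2) *\<^sub>R (F (\<phi> i) x + F (\<phi> j) x))" using d_le by metis
    moreover have "W (grad (\<lambda>x. \<phi> i x - \<phi> j x)) = (\<lambda>x. F (\<phi> i) x - F (\<phi> j) x)"
      using W_combination[OF C1c_C1[OF \<phi>[of i]] C1c_C1[OF \<phi>[of j]], of "-1"] by (simp add: F_def fun_eq_iff)
    ultimately show ?thesis
      using sqint_parallelogram[OF F_L2[OF \<phi>[of i]] F_L2[OF \<phi>[of j]]] near[of i] near[of j] by simp
  qed
  define m where "m = min \<sigma>c \<sigma>s"
  have m: "m > 0" using pos by (simp add: m_def)
  obtain C where C: "0 \<le> C" "\<And>\<phi>. \<phi> \<in> C1c \<Omega> \<Longrightarrow> sqint \<Omega> \<phi> \<le> C * sqint \<Omega> (grad \<phi>)" using Poincare by blast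
  have grad_le: "sqint \<Omega> (grad (\<lambda>x. \<phi> i x - \<phi> j x)) \<le> (2 * inverse (real (Suc i)) + 2 * inverse (real (Suc j))) / m" for i j
    using W_lower[OF C1c_L2(2)[OF lmeasurable C1c_diff[OF \<phi> \<phi>]], of i j] mid[of i j] m
    by (simp add: m_def[symmetric] pos_le_divide_eq mult.commute)
  \<comment> \<open>Used with K = C for the functions and K = 1 for their gradients. The denominator
    K + 1 allows K = 0.\<close>
  have Cauchy: "\<exists>N. \<forall>i\<ge>N. \<forall>j\<ge>N. K * ((2 * inverse (real (Suc i)) + 2 * inverse (real (Suc j))) / m) < e"
    if e: "e > 0" and K: "K \<ge> 0" for e K
  proof -
    define c where "c = e / (K + 1)"
    define e' where "e' = c * m / 4"
    have "e' > 0" using e K m by (simp add: e'_def c_def)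
    then obtain N where N: "\<And>n. n \<ge> N \<Longrightarrow> inverse (real (Suc n)) < e'"
      using LIMSEQ_inverse_real_of_nat[THEN order_tendstoD(2)] by (auto simp: eventually_sequentially)
    have "K * ((2 * inverse (real (Suc i)) + 2 * inverse (real (Suc j))) / m) < e" if "i \<ge> N" "j \<ge> N" for i j
    proof -
      have "K * ((2 * inverse (real (Suc i)) + 2 * inverse (real (Suc j))) / m) \<le> K * ((2 * e' + 2 * e') / m)"
        using N[OF that(1)] N[OF that(2)] m K by (intro mult_left_mono divide_right_mono) auto
      also have "(2 * e' + 2 * e') / m = c" using m by (simp add: e'_def)
      also have "K * c = e * (K / (K + 1))" by (simp add: c_def)
      also have "\<dots> < e * 1" using e K by (intro mult_strict_left_mono) (simp add: divide_less_eq)+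
      finally show ?thesis by simp
    qed
    then show ?thesis by blast
  qed
  have sq_le: "sqint \<Omega> (\<lambda>x. \<phi> i x - \<phi> j x) \<le> C * ((2 * inverse (real (Suc i)) + 2 * inverse (real (Suc j))) / m)" for i j
    using C(2)[OF C1c_diff[OF \<phi> \<phi>], of i j] mult_left_mono[OF grad_le[of i j] C(1)] by linarith
  obtain u where u: "u \<in> L2 \<Omega>" "L2_limit \<Omega> \<phi> u"
  proof (rule L2_complete[OF lmeasurable C1c_L2(1)[OF lmeasurable \<phi>]])
    fix e :: real assume "e > 0"
    from Cauchy[OF this C(1)] show "\<exists>N. \<forall>i\<ge>N. \<forall>j\<ge>N. sqint \<Omega> (\<lambda>x. \<phi> i x - \<phi> j x) < e"
      by (elim exE, intro exI allI impI) (rule le_less_trans[OF sq_le], blast)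
  qed blast
  obtain g where g: "g \<in> L2 \<Omega>" "L2_limit \<Omega> (\<lambda>n. grad (\<phi> n)) g"
  proof (rule L2_complete[OF lmeasurable C1c_L2(2)[OF lmeasurable \<phi>]])
    fix e :: real assume "e > 0"
    from Cauchy[OF this zero_le_one] obtain N where
      N: "\<And>i j. N \<le> i \<Longrightarrow> N \<le> j \<Longrightarrow> (2 * inverse (real (Suc i)) + 2 * inverse (real (Suc j))) / m < e"
      unfolding mult_1 by blast
    have eq: "(\<lambda>x. grad (\<phi> i) x - grad (\<phi> j) x) = grad (\<lambda>x. \<phi> i x - \<phi> j x)" for i j
      by (simp add: fun_eq_iff grad_diff C1c_C1[OF \<phi>])
    show "\<exists>N. \<forall>i\<ge>N. \<forall>j\<ge>N. sqint \<Omega> (\<lambda>x. grad (\<phi> i) x - grad (\<phi> j) x) < e"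
      unfolding eq by (intro exI[of _ N] allI impI le_less_trans[OF grad_le] N)
  qed blast
  note H10 = H10I[OF open_\<Omega> lmeasurable \<phi> u(1) g(1) u(2) g(2)]
  have orth: "(\<integral>x. W g x \<bullet> W (grad \<psi>) x \<partial>?M) = - (\<integral>x. P x \<bullet> W (grad \<psi>) x \<partial>?M)" if \<psi>: "\<psi> \<in> C1c \<Omega>" for \<psi>
  proof -
    define w where "w = W (grad \<psi>)"
    have w: "w \<in> L2 \<Omega>" unfolding w_def by (intro W_L2 C1c_L2 lmeasurable \<psi>)
    define b where "b = (\<integral>x. W g x \<bullet> w x \<partial>?M) + (\<integral>x. P x \<bullet> w x \<partial>?M)"
    have "(\<lambda>n. \<integral>x. W (grad (\<phi> n)) x \<bullet> w x \<partial>?M) \<longlonglongrightarrow> (\<integral>x. W g x \<bullet> w x \<partial>?M)"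
      by (intro L2_limit_inner W_L2 C1c_L2 lmeasurable \<phi> g w W_limit)
    moreover have "(\<integral>x. F (\<phi> n) x \<bullet> w x \<partial>?M) = (\<integral>x. W (grad (\<phi> n)) x \<bullet> w x \<partial>?M) + (\<integral>x. P x \<bullet> w x \<partial>?M)" for n
      using L2_inner_integrable[OF W_L2[OF C1c_L2(2)[OF lmeasurable \<phi>]] w, of n] L2_inner_integrable[OF P_L2 w]
      by (simp add: F_def inner_add_left)
    ultimately have lim: "(\<lambda>n. \<integral>x. F (\<phi> n) x \<bullet> w x \<partial>?M) \<longlonglongrightarrow> b"
      unfolding b_def by (auto intro: tendsto_add)
    \<comment> \<open>The infimum need not be attained in \<open>C1c\<close>, so the variation is
      carried out at \<phi> n and the inequality passed to the limit.\<close>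
    have q: "0 \<le> 2 * s * b + s\<^sup>2 * sqint \<Omega> w" for s
    proof -
      have "d \<le> sqint \<Omega> (F (\<phi> n)) + 2 * s * (\<integral>x. F (\<phi> n) x \<bullet> w x \<partial>?M) + s\<^sup>2 * sqint \<Omega> w" for n
      proof -
        have "F (\<lambda>x. \<phi> n x + s * \<psi> x) = (\<lambda>x. F (\<phi> n) x + s *\<^sub>R w x)"
          using W_combination[OF C1c_C1[OF \<phi>[of n]] C1c_C1[OF \<psi>], of s] by (simp add: F_def fun_eq_iff w_def)
        moreover have "(\<lambda>x. \<phi> n x + s * \<psi> x) \<in> C1c \<Omega>" by (intro C1c_add C1c_scale \<phi> \<psi>)
        ultimately show ?thesis using d_le sqint_expand[OF F_L2[OF \<phi>] w] by metis
      qed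
      moreover have "(\<lambda>n. sqint \<Omega> (F (\<phi> n)) + 2 * s * (\<integral>x. F (\<phi> n) x \<bullet> w x \<partial>?M) + s\<^sup>2 * sqint \<Omega> w)
          \<longlonglongrightarrow> d + 2 * s * b + s\<^sup>2 * sqint \<Omega> w"
        by (intro tendsto_intros lim lim_d)
      ultimately have "d \<le> d + 2 * s * b + s\<^sup>2 * sqint \<Omega> w"
        by (intro LIMSEQ_le_const) auto
      then show ?thesis by simp
    qed
    have "b = 0"
    proof (rule ccontr)
      assume b: "b \<noteq> 0"
      \<comment> \<open>Adding 1 keeps c positive when w vanishes. The choice s = -b / c then makes
        the quadratic at most -b^2 / c < 0.\<close>
      define c where "c = sqint \<Omega> w + 1"
      have c: "c > 0" by (simp add: c_def add_nonneg_pos)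
      have "0 \<le> 2 * (- b / c) * b + (- b / c)\<^sup>2 * sqint \<Omega> w" by (rule q)
      also have "\<dots> \<le> 2 * (- b / c) * b + (- b / c)\<^sup>2 * c" by (intro add_left_mono mult_left_mono) (auto simp: c_def)
      also have "\<dots> = - (b\<^sup>2 / c)" using c by (simp add: power2_eq_square field_simps)
      also have "\<dots> < 0" using b c by simp
      finally show False by simp
    qed
    then show ?thesis by (simp add: b_def w_def)
  qed
  have "(\<integral>x. \<sigma> x * (wgrad \<Omega> u x \<bullet> wgrad \<Omega> \<psi> x) \<partial>?M) = (\<integral>x. \<psi> x \<partial>?M)" if \<psi>: "\<psi> \<in> H10 \<Omega>" for \<psi>
  proof -
    obtain \<eta> where L: "\<psi> \<in> L2 \<Omega>" "wgrad \<Omega> \<psi> \<in> L2 \<Omega>" and \<eta>: "\<And>n. \<eta> n \<in> C1c \<Omega>"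
      and lim: "L2_limit \<Omega> \<eta> \<psi>" "L2_limit \<Omega> (\<lambda>n. grad (\<eta> n)) (wgrad \<Omega> \<psi>)"
      using H10D[OF open_\<Omega> lmeasurable \<psi>] by metis
    have lW: "(\<lambda>n. \<integral>x. W (grad (\<eta> n)) x \<bullet> h x \<partial>?M) \<longlonglongrightarrow> (\<integral>x. W (wgrad \<Omega> \<psi>) x \<bullet> h x \<partial>?M)" if "h \<in> L2 \<Omega>" for h
      by (intro L2_limit_inner W_L2 C1c_L2 lmeasurable \<eta> L that W_limit lim)
    have "(\<integral>x. W (wgrad \<Omega> \<psi>) x \<bullet> W g x \<partial>?M) = - (\<integral>x. W (wgrad \<Omega> \<psi>) x \<bullet> P x \<partial>?M)"
      by (rule LIMSEQ_unique[OF lW[OF W_L2[OF g(1)]]])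
         (use tendsto_minus[OF lW[OF P_L2]] orth[OF \<eta>] in \<open>simp add: inner_commute\<close>)
    then have eq: "(\<integral>x. W g x \<bullet> W (wgrad \<Omega> \<psi>) x \<partial>?M) = (\<integral>x. \<psi> x \<partial>?M)"
      by (simp add: H10_integral_eq[OF \<psi>] inner_commute)
    have wL: "wgrad \<Omega> u \<in> L2 \<Omega>" using H10D[OF open_\<Omega> lmeasurable H10(1)] by metis
    have "(\<integral>x. W (wgrad \<Omega> u) x \<bullet> W (wgrad \<Omega> \<psi>) x \<partial>?M) = (\<integral>x. W g x \<bullet> W (wgrad \<Omega> \<psi>) x \<partial>?M)"
    proof (rule integral_cong_AE)
      show "AE x in ?M. W (wgrad \<Omega> u) x \<bullet> W (wgrad \<Omega> \<psi>) x = W g x \<bullet> W (wgrad \<Omega> \<psi>) x"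
        using H10(2) by eventually_elim (simp add: W_def)
    qed (use L2_inner_integrable[OF W_L2[OF wL] W_L2[OF L(2)]] L2_inner_integrable[OF W_L2[OF g(1)] W_L2[OF L(2)]] in auto)
    then show ?thesis using eq by (simp add: W_inner)
  qed
  then show ?thesis using H10(1) by (auto simp: weak_solution_def)
qed

text \<open>Both bounds are Pythagoras. With g the weak gradient of the state, |W g + P|^2 = |P|^2 -
  |W g|^2, which gives the upper bound; and for w the weighted gradient of a test function, |w - W
  g|^2 = |w + P|^2 - |P|^2 + |W g|^2, which gives the lower one.\<close>

lemma
  fixes \<phi> :: "'a \<Rightarrow> real"
  shows energy_le: "energy \<sigma>c \<sigma>s D \<Omega> \<le> sqint \<Omega> P"
    and energy_ge: "\<phi> \<in> C1c \<Omega> \<Longrightarrow> sqint \<Omega> P - sqint \<Omega> (\<lambda>x. W (grad \<phi>) x + P x) \<le> energy \<sigma>c \<sigma>s D \<Omega>"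
proof -
  let ?M = "lebesgue_on \<Omega>"
  define u where "u = state \<sigma>c \<sigma>s D \<Omega>"
  have u: "weak_solution \<sigma>c \<sigma>s D \<Omega> u"
    unfolding u_def state_def by (rule someI_ex[OF weak_solution_exists])
  then have H10: "u \<in> H10 \<Omega>" by (simp add: weak_solution_def)
  define g where "g = wgrad \<Omega> u"
  have g: "g \<in> L2 \<Omega>" using H10D[OF open_\<Omega> lmeasurable H10] unfolding g_def by metis
  have E: "energy \<sigma>c \<sigma>s D \<Omega> = sqint \<Omega> (W g)"
    by (simp add: energy_def sqint_def W_norm g_def u_def)
  have "sqint \<Omega> (W g) = (\<integral>x. u x \<partial>?M)"
    using u H10 by (auto simp: weak_solution_def sqint_def W_inner g_def power2_norm_eq_inner)
  then have gP: "sqint \<Omega> (W g) = - (\<integral>x. W g x \<bullet> P x \<partial>?M)"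
    by (simp add: H10_integral_eq[OF H10] g_def inner_commute)
  have "0 \<le> sqint \<Omega> (\<lambda>x. W g x + P x)" by simp
  also have "\<dots> = sqint \<Omega> P - sqint \<Omega> (W g)"
    using sqint_expand[OF W_L2[OF g] P_L2, of 1] gP by simp
  finally show "energy \<sigma>c \<sigma>s D \<Omega> \<le> sqint \<Omega> P" by (simp add: E)
  assume \<phi>: "\<phi> \<in> C1c \<Omega>"
  define w where "w = W (grad \<phi>)"
  have w: "w \<in> L2 \<Omega>" unfolding w_def by (intro W_L2 C1c_L2 lmeasurable \<phi>)
  have ae: "AE x in ?M. wgrad \<Omega> \<phi> x = grad \<phi> x" by (rule C1c_H10(2)[OF open_\<Omega> lmeasurable \<phi>])
  have \<phi>H: "\<phi> \<in> H10 \<Omega>" by (rule C1c_H10(1)[OF open_\<Omega> lmeasurable \<phi>])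
  have w\<phi>: "W (wgrad \<Omega> \<phi>) \<in> L2 \<Omega>" using H10D[OF open_\<Omega> lmeasurable \<phi>H] W_L2 by metis
  \<comment> \<open>The state equation speaks of the chosen weak gradient of \<phi>, the bound of
    the classical one; they agree almost everywhere.\<close>
  have swap: "(\<integral>x. h x \<bullet> W (wgrad \<Omega> \<phi>) x \<partial>?M) = (\<integral>x. h x \<bullet> w x \<partial>?M)" if h: "h \<in> L2 \<Omega>" for h
  proof (rule integral_cong_AE)
    show "AE x in ?M. h x \<bullet> W (wgrad \<Omega> \<phi>) x = h x \<bullet> w x"
      using ae by eventually_elim (simp add: W_def w_def)
  qed (use L2_inner_integrable[OF h w\<phi>] L2_inner_integrable[OF h w] in auto)
  have "(\<integral>x. W g x \<bullet> W (wgrad \<Omega> \<phi>) x \<partial>?M) = - (\<integral>x. P x \<bullet> W (wgrad \<Omega> \<phi>) x \<partial>?M)"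
    unfolding H10_integral_eq[OF \<phi>H, symmetric] using u \<phi>H by (simp add: weak_solution_def W_inner g_def)
  then have wP: "(\<integral>x. w x \<bullet> P x \<partial>?M) = - (\<integral>x. w x \<bullet> W g x \<partial>?M)"
    by (simp add: swap W_L2 g P_L2 inner_commute)
  have "0 \<le> sqint \<Omega> (\<lambda>x. w x - W g x)" by simp
  also have "\<dots> = sqint \<Omega> w - 2 * (\<integral>x. w x \<bullet> W g x \<partial>?M) + sqint \<Omega> (W g)"
    using sqint_expand[OF w W_L2[OF g], of "-1"] by simp
  also have "\<dots> = sqint \<Omega> (\<lambda>x. w x + P x) - sqint \<Omega> P + sqint \<Omega> (W g)"
    using sqint_expand[OF w P_L2, of 1] wP by simp
  finally show "sqint \<Omega> P - sqint \<Omega> (\<lambda>x. W (grad \<phi>) x + P x) \<le> energy \<sigma>c \<sigma>s D \<Omega>"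
    by (simp add: E w_def)
qed

end


section \<open>Radial test functions\<close>

text \<open>Prescribing the derivative of a radial profile fixes the flux directly; the profile
  itself never needs a formula, only that it vanishes beyond a.\<close>

lemma compactly_supported_primitive:
  fixes h :: "real \<Rightarrow> real"
  assumes h: "continuous_on UNIV h" and a: "0 \<le> a" and 0: "\<And>s. a \<le> s \<Longrightarrow> h s = 0"
  obtains f where "\<And>s. 0 \<le> s \<Longrightarrow> (f has_real_derivative h s) (at s)" "\<And>s. a \<le> s \<Longrightarrow> f s = 0"
proof
  \<comment> \<open>Normalised to vanish at a. Starting the integral at -1 gives a two-sided
    derivative at s = 0, the value of |x|^2 at the centre.\<close>
  define f where "f s = integral {-1..s} h - integral {-1..a} h" for s
  show "(f has_real_derivative h s) (at s)" if "0 \<le> s" for s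
  proof -
    have "((\<lambda>x. integral {-1..x} h) has_real_derivative h s) (at s within {-1..s+1})"
      using that by (intro integral_has_real_derivative continuous_on_subset[OF h]) auto
    moreover have "at s within {-1..s+1} = at s"
      using that by (intro at_within_interior) auto
    ultimately have "((\<lambda>x. integral {-1..x} h) has_real_derivative h s) (at s)" by simp
    from DERIV_diff[OF this DERIV_const] show ?thesis unfolding f_def by simp
  qed
  show "f s = 0" if "a \<le> s" for s
  proof -
    have "integral {-1..a} h + integral {a..s} h = integral {-1..s} h"
      using a that by (intro Henstock_Kurzweil_Integration.integral_combine integrable_continuous_real continuous_on_subset[OF h]) auto
    moreover have "integral {a..s} h = integral {a..s} (\<lambda>_. 0)"
      using 0 by (intro integral_cong) auto
    ultimately show ?thesis by (simp add: f_def)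
  qed
qed

definition clamp01 :: "real \<Rightarrow> real" where "clamp01 s = max 0 (min 1 s)"

lemma clamp01_bounds: "0 \<le> clamp01 s" "clamp01 s \<le> 1"
  by (auto simp: clamp01_def)

text \<open>For n > 0 the first factor rises or falls linearly from a to b on [r - 1/n, r]; the
  second is a cutoff, equal to 1 up to 1 - 2/n and to 0 from 1 - 1/n on.\<close>

definition ramp :: "real \<Rightarrow> real \<Rightarrow> real \<Rightarrow> nat \<Rightarrow> real \<Rightarrow> real"
  where "ramp a b r n s = (a + (b - a) * clamp01 (1 + real n * (s - r))) * clamp01 (real n * (1 - s) - 1)"

lemma ramp_continuous: "continuous_on S (ramp a b r n)"
  unfolding ramp_def clamp01_def by (intro continuous_intros)

lemma ramp_bound:
  assumes "0 \<le> a" "0 \<le> b" shows "\<bar>ramp a b r n s\<bar> \<le> max a b"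
proof -
  define c d where "c = clamp01 (1 + real n * (s - r))" and "d = clamp01 (real n * (1 - s) - 1)"
  have c: "0 \<le> c" "c \<le> 1" and d: "0 \<le> d" "d \<le> 1" by (auto simp: c_def d_def clamp01_bounds)
  have eq: "a + (b - a) * c = (1 - c) * a + c * b" by (simp add: algebra_simps)
  have 0: "0 \<le> a + (b - a) * c" unfolding eq using c assms by simp
  have "(1 - c) * a + c * b \<le> max a b"
    using c by (intro convex_bound_le) auto
  then have "(a + (b - a) * c) * d \<le> max a b * 1" unfolding eq using 0[unfolded eq] d by (intro mult_mono) auto
  then show ?thesis using 0 d by (simp add: ramp_def c_def[symmetric] d_def[symmetric])
qed

lemma ramp_eq_0: "n > 0 \<Longrightarrow> 1 - 1 / real n \<le> s \<Longrightarrow> ramp a b r n s = 0"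
  by (simp add: ramp_def clamp01_def field_simps)

text \<open>For fixed s the sequence is eventually constant. The transition lies to the left of r so
  that the limit at s = r is b, matching an open inner ball whose boundary carries
  \<sigma>s.\<close>

lemma ramp_limit:
  assumes "s < 1"
  shows "(\<lambda>n. ramp a b r n s) \<longlonglongrightarrow> (if s < r then a else b)"
proof (rule tendsto_eventually)
  have large: "eventually (\<lambda>n. 2 \<le> real n * c) sequentially" if "c > 0" for c :: real
    using filterlim_at_top_mult_tendsto_pos[OF tendsto_const that filterlim_real_sequentially]
    by (simp add: filterlim_at_top)
  have 1: "eventually (\<lambda>n. clamp01 (real n * (1 - s) - 1) = 1) sequentially"
    using large[of "1 - s"] assms by (auto elim!: eventually_mono simp: clamp01_def)
  have 2: "eventually (\<lambda>n. clamp01 (1 + real n * (s - r)) = (if s < r then 0 else 1)) sequentially"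
  proof (cases "s < r")
    case True
    have "eventually (\<lambda>n. 2 \<le> real n * (r - s)) sequentially" using True by (intro large) simp
    then show ?thesis using True by (auto elim!: eventually_mono simp: clamp01_def right_diff_distrib)
  next
    case False
    then show ?thesis by (auto intro!: always_eventually simp: clamp01_def min_def mult_less_0_iff)
  qed
  show "\<forall>\<^sub>F n in sequentially. ramp a b r n s = (if s < r then a else b)"
    using 1 2 by eventually_elim (simp add: ramp_def)
qed


section \<open>Small perturbations of the identity\<close>

text \<open>The bound L / N on each partial derivative adds up to L for the derivative. With L \<le>
  1/2, T is a bijection whose inverse and its derivative are bounded by the factor 2.\<close>

locale small_perturbation =
  fixes \<Phi> :: "'a::euclidean_space \<Rightarrow> 'a" and \<delta> L :: real
  assumes C1: "C1_fun \<Phi>" and \<delta>: "\<And>x. norm (\<Phi> x) \<le> \<delta>"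
    and pderiv_le: "\<And>i x. i \<in> Basis \<Longrightarrow> norm (pderiv_dir i \<Phi> x) \<le> L / DIM('a)"
    and L: "L \<le> 1 / 2"
begin

abbreviation D\<Phi> :: "'a \<Rightarrow> 'a \<Rightarrow> 'a" where "D\<Phi> x \<equiv> frechet_derivative \<Phi> (at x)"

definition T :: "'a \<Rightarrow> 'a" where "T x = x + \<Phi> x"

lemma L_nonneg: "0 \<le> L"
proof -
  obtain i :: 'a where i: "i \<in> Basis" using nonempty_Basis by blast
  have "0 \<le> L / DIM('a)" using pderiv_le[OF i, of 0] norm_ge_zero order_trans by blast
  then show ?thesis by (simp add: zero_le_divide_iff)
qed

lemma D\<Phi>_le: "norm (D\<Phi> x v) \<le> L * norm v"
proof -
  have "norm (D\<Phi> x v) \<le> (\<Sum>i\<in>Basis. norm ((v \<bullet> i) *\<^sub>R pderiv_dir i \<Phi> x))"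
    unfolding frechet_derivative_sum_Basis[OF C1] by (rule norm_sum)
  also have "\<dots> \<le> (\<Sum>i\<in>(Basis::'a set). norm v * (L / DIM('a)))"
    unfolding norm_scaleR using L_nonneg
    by (intro sum_mono mult_mono pderiv_le) (auto simp: Basis_le_norm)
  also have "\<dots> = L * norm v" by simp
  finally show ?thesis .
qed

lemma D\<Phi>_linear: "bounded_linear (D\<Phi> x)"
  using C1_fun_has_derivative[OF C1] by (rule has_derivative_bounded_linear)

lemma \<Phi>_Lipschitz: "norm (\<Phi> x - \<Phi> y) \<le> L * norm (x - y)"
  by (rule differentiable_bound[of UNIV \<Phi> D\<Phi>])
     (auto intro!: C1_fun_has_derivative C1 onorm_le D\<Phi>_le)

lemma T_lower: "norm (x - y) \<le> 2 * norm (T x - T y)"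
proof -
  have "norm (x - y) \<le> norm (T x - T y) + norm (\<Phi> x - \<Phi> y)"
    using norm_triangle_ineq4[of "T x - T y" "\<Phi> x - \<Phi> y"] by (simp add: T_def algebra_simps)
  also have "norm (\<Phi> x - \<Phi> y) \<le> 1/2 * norm (x - y)"
    using \<Phi>_Lipschitz[of x y] mult_right_mono[OF L, of "norm (x - y)"] by simp
  finally show ?thesis by simp
qed

text \<open>T x = y says that x is a fixed point of the contraction sending x to y - \<Phi>
  x.\<close>

lemma T_surj: "\<exists>x. T x = y"
proof -
  have "\<exists>!x. y - \<Phi> x = x"
  proof (rule banach_fix_type)
    show "\<forall>x z. dist (y - \<Phi> x) (y - \<Phi> z) \<le> L * dist x z"
      using \<Phi>_Lipschitz by (simp add: dist_norm norm_minus_commute)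
  qed (use L L_nonneg in auto)
  then show ?thesis by (auto simp: T_def algebra_simps)
qed

section \<open>The inverse map and its derivative\<close>

definition S :: "'a \<Rightarrow> 'a" where "S y = (SOME x. T x = y)"

lemma T_S: "T (S y) = y"
  unfolding S_def by (rule someI_ex[OF T_surj])

lemma S_T: "S (T x) = x"
  using T_lower[of "S (T x)" x] by (simp add: T_S)

text \<open>Deformed sets become preimages under the continuous map S, so openness and membership
  are read off at once.\<close>

lemma image_T: "T ` A = {y. S y \<in> A}"
proof safe
  fix y assume "S y \<in> A"
  then have "T (S y) \<in> T ` A" by (rule imageI)
  then show "y \<in> T ` A" by (simp add: T_S)
qed (simp add: S_T)

lemma S_eq: "y - S y = \<Phi> (S y)"
  using T_S[of y] by (simp add: T_def algebra_simps)

lemma S_Lipschitz: "norm (S y - S z) \<le> 2 * norm (y - z)"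
  using T_lower[of "S y" "S z"] by (simp add: T_S)

lemma S_continuous: "continuous_on A S"
  by (rule lipschitz_on_continuous_on[of 2]) (use S_Lipschitz in \<open>auto simp: lipschitz_on_def dist_norm\<close>)

lemma T_continuous: "continuous_on A T"
  unfolding T_def by (intro continuous_intros C1_fun_continuous C1)

text \<open>The candidate for the derivative of S at y: the inverse of the derivative of T at S y,
  which is bijective by \<open>DT_inj\<close> and \<open>DT_surj\<close>.\<close>

definition DS :: "'a \<Rightarrow> 'a \<Rightarrow> 'a" where "DS y = inv (\<lambda>v. v + D\<Phi> (S y) v)"

lemma DT_lower: "norm v \<le> 2 * norm (v + D\<Phi> x v)"
proof -
  have "norm v \<le> norm (v + D\<Phi> x v) + norm (D\<Phi> x v)"
    using norm_triangle_ineq4[of "v + D\<Phi> x v" "D\<Phi> x v"] by simp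
  also have "norm (D\<Phi> x v) \<le> 1/2 * norm v"
    using D\<Phi>_le[of x v] mult_right_mono[OF L, of "norm v"] by simp
  finally show ?thesis by simp
qed

lemma DT_linear: "linear (\<lambda>v. v + D\<Phi> x v)"
  using D\<Phi>_linear[of x] by (intro linear_compose_add linear_id[unfolded id_def]) (simp add: bounded_linear.linear)

lemma DT_inj: "inj (\<lambda>v. v + D\<Phi> x v)"
  using DT_lower[of _ x] by (subst linear_injective_0[OF DT_linear]) (metis mult_zero_right norm_le_zero_iff norm_zero)

lemma DT_surj: "surj (\<lambda>v. v + D\<Phi> x v)"
  by (rule linear_inj_imp_surj[OF DT_linear DT_inj])

lemma DS_eq: "DS y v + D\<Phi> (S y) (DS y v) = v"
  unfolding DS_def using surj_f_inv_f[OF DT_surj[of "S y"], of v] by simp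

lemma DS_unique: "w + D\<Phi> (S y) w = v \<Longrightarrow> DS y v = w"
  unfolding DS_def using inv_f_f[OF DT_inj[of "S y"], of w] by simp

lemma DS_le: "norm (DS y v) \<le> 2 * norm v"
  using DT_lower[of "DS y v" "S y"] by (simp add: DS_eq)

lemma DS_near_id: "norm (v - DS y v) \<le> 2 * L * norm v"
proof -
  have "v - DS y v = D\<Phi> (S y) (DS y v)" using DS_eq[of y v] by (simp add: algebra_simps)
  then have "norm (v - DS y v) \<le> L * norm (DS y v)" using D\<Phi>_le by simp
  also have "\<dots> \<le> L * (2 * norm v)" by (intro mult_left_mono DS_le L_nonneg)
  finally show ?thesis by simp
qed

lemma DS_linear: "bounded_linear (DS y)"
proof (rule bounded_linear_intro[of _ 2])
  interpret D: bounded_linear "D\<Phi> (S y)" by (rule D\<Phi>_linear)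
  show "DS y (v + w) = DS y v + DS y w" for v w
  proof (rule DS_unique)
    have "(DS y v + D\<Phi> (S y) (DS y v)) + (DS y w + D\<Phi> (S y) (DS y w)) = v + w" by (simp only: DS_eq)
    then show "DS y v + DS y w + D\<Phi> (S y) (DS y v + DS y w) = v + w" by (simp add: D.add add_ac)
  qed
  show "DS y (r *\<^sub>R v) = r *\<^sub>R DS y v" for r v
    by (rule DS_unique) (use DS_eq[of y v] in \<open>simp add: D.scaleR scaleR_right_distrib[symmetric]\<close>)
  show "norm (DS y v) \<le> norm v * 2" for v using DS_le[of y v] by simp
qed

lemma S_has_derivative: "(S has_derivative DS y) (at y)"
proof (rule has_derivative_inverse_basic[where f=T and T=UNIV])
  show "(T has_derivative (\<lambda>v. v + D\<Phi> (S y) v)) (at (S y))"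
    unfolding T_def[abs_def] by (intro derivative_intros C1_fun_has_derivative C1)
  show "DS y \<circ> (\<lambda>v. v + D\<Phi> (S y) v) = id" by (auto simp: DS_unique)
  show "continuous (at y) S" using S_continuous[of UNIV] by (simp add: continuous_on_eq_continuous_at)
qed (auto simp: T_S DS_linear)

text \<open>With w = \<open>DS y v\<close>, the derivative of T at S z sends
  \<open>DS z v - w\<close> to the difference of D\<Phi> at S y and at S z, applied to w. As that
  derivative is bounded below, continuity of D\<Phi> and S suffices.\<close>

lemma DS_continuous: "continuous_on UNIV (\<lambda>y. DS y v)"
proof (rule continuous_at_imp_continuous_on, rule ballI, unfold isCont_def)
  fix y
  define w where "w = DS y v"
  have le: "norm (DS z v - w) \<le> 2 * norm (D\<Phi> (S y) w - D\<Phi> (S z) w)" for z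
  proof -
    interpret D: bounded_linear "D\<Phi> (S z)" by (rule D\<Phi>_linear)
    have "(DS z v - w) + D\<Phi> (S z) (DS z v - w) = D\<Phi> (S y) w - D\<Phi> (S z) w"
      using DS_eq[of y v] DS_eq[of z v] by (simp add: D.diff w_def algebra_simps)
    then show ?thesis using DT_lower[of "DS z v - w" "S z"] by simp
  qed
  have "continuous_on UNIV (\<lambda>z. D\<Phi> (S z) w)"
    by (rule continuous_on_compose2[OF C1_fun_continuous_frechet_derivative[OF C1] S_continuous]) auto
  then have "((\<lambda>z. D\<Phi> (S z) w) \<longlongrightarrow> D\<Phi> (S y) w) (at y)"
    by (simp add: continuous_on_eq_continuous_at isCont_def)
  then have "((\<lambda>z. 2 * norm (D\<Phi> (S y) w - D\<Phi> (S z) w)) \<longlongrightarrow> 2 * norm (D\<Phi> (S y) w - D\<Phi> (S y) w)) (at y)"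
    by (intro tendsto_intros)
  then have lim: "((\<lambda>z. 2 * norm (D\<Phi> (S y) w - D\<Phi> (S z) w)) \<longlongrightarrow> 0) (at y)" by simp
  have "((\<lambda>z. DS z v - w) \<longlongrightarrow> 0) (at y)"
    by (rule Lim_null_comparison[OF always_eventually lim]) (rule allI, rule le)
  then show "((\<lambda>z. DS z v) \<longlongrightarrow> DS y v) (at y)" unfolding w_def by (rule LIM_zero_cancel)
qed

lemma open_image_T: "open A \<Longrightarrow> open (T ` A)"
  unfolding image_T using open_vimage[OF _ S_continuous, of A] by (simp add: vimage_def)

lemma image_T_ball_subset: "T ` ball 0 r \<subseteq> ball 0 (r + \<delta>)"
proof
  fix y assume "y \<in> T ` ball 0 r"
  then obtain x where "norm x < r" "y = x + \<Phi> x" by (auto simp: T_def)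
  then show "y \<in> ball 0 (r + \<delta>)" using norm_triangle_ineq[of x "\<Phi> x"] \<delta>[of x] by simp
qed

lemma ball_subset_image_T: "ball 0 (r - \<delta>) \<subseteq> T ` ball 0 r"
proof
  fix y :: 'a assume "y \<in> ball 0 (r - \<delta>)"
  moreover have "y - \<Phi> (S y) = S y" by (simp add: S_eq[symmetric])
  ultimately show "y \<in> T ` ball 0 r"
    using norm_triangle_ineq4[of y "\<Phi> (S y)"] \<delta>[of "S y"] unfolding image_T by simp
qed

lemma radial_C1_fun:
  assumes f: "\<And>s. 0 \<le> s \<Longrightarrow> (f has_real_derivative f' s) (at s)" and c: "continuous_on UNIV f'"
  shows "C1_fun (\<lambda>y. f ((norm (S y))\<^sup>2))"
    "pderiv_dir i (\<lambda>y. f ((norm (S y))\<^sup>2)) y = f' ((norm (S y))\<^sup>2) * (2 * (S y \<bullet> DS y i))"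
proof -
  have D: "((\<lambda>y. (norm (S y))\<^sup>2) has_derivative (\<lambda>v. 2 * (S y \<bullet> DS y v))) (at y)" for y
    unfolding power2_norm_eq_inner
    by (rule has_derivative_eq_rhs[OF has_derivative_inner[OF S_has_derivative S_has_derivative]])
       (simp add: inner_commute)
  have C: "C1_fun (\<lambda>y. (norm (S y))\<^sup>2)"
    by (rule C1_funI[OF D]) (intro continuous_intros S_continuous DS_continuous)
  have f': "(f has_real_derivative f' ((norm (S y))\<^sup>2)) (at ((norm (S y))\<^sup>2))" for y by (rule f) simp
  have c': "continuous_on (range (\<lambda>y. (norm (S y))\<^sup>2)) f'" using c by (rule continuous_on_subset) simp
  show "C1_fun (\<lambda>y. f ((norm (S y))\<^sup>2))" by (rule C1_fun_real_compose(1)[OF C f' c'])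
  show "pderiv_dir i (\<lambda>y. f ((norm (S y))\<^sup>2)) y = f' ((norm (S y))\<^sup>2) * (2 * (S y \<bullet> DS y i))"
    using C1_fun_real_compose(2)[OF C f' c', of i y] pderiv_dir_eq[OF D, of i y] by simp
qed

end


section \<open>The energy of perturbed balls\<close>

locale perturbed_balls = small_perturbation \<Phi> \<delta> L
  for \<Phi> :: "'a::euclidean_space \<Rightarrow> 'a" and \<delta> L +
  fixes \<sigma>c \<sigma>s R :: real
  assumes \<sigma>_pos': "0 < \<sigma>c" "0 < \<sigma>s" and R: "0 < R" "R < 1"

sublocale perturbed_balls \<subseteq> two_phase \<sigma>c \<sigma>s "T ` ball 0 R" "T ` ball 0 1"
proof
  show "bounded (T ` ball 0 1)" by (rule bounded_subset[OF bounded_ball image_T_ball_subset])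
  show "T ` ball 0 R \<in> sets lebesgue" using open_image_T[of "ball 0 R"] by simp
qed (use \<sigma>_pos' open_image_T in auto)

context perturbed_balls
begin

abbreviation "\<Omega> \<equiv> T ` ball 0 1"

text \<open>Half the gradient of |S|^2. It equals y when \<Phi> = 0, so y - Z y measures by how much
  the transported flux misses -q.\<close>

definition Z :: "'a \<Rightarrow> 'a" where "Z y = (\<Sum>i\<in>Basis. (S y \<bullet> DS y i) *\<^sub>R i)"

lemma S_less_1: "y \<in> \<Omega> \<Longrightarrow> norm (S y) < 1"
  unfolding image_T by simp

text \<open>A crude bound that serves only for domination in a limit of integrals.\<close>

lemma norm_Z_le:
  assumes "y \<in> \<Omega>" shows "norm (Z y) \<le> 2 * DIM('a)"
proof -
  have "norm (Z y) \<le> (\<Sum>i\<in>Basis. norm ((S y \<bullet> DS y i) *\<^sub>R i))" unfolding Z_def by (rule norm_sum)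
  also have "\<dots> \<le> (\<Sum>i\<in>(Basis::'a set). 2)"
  proof (rule sum_mono)
    fix i :: 'a assume i: "i \<in> Basis"
    have "\<bar>S y \<bullet> DS y i\<bar> \<le> norm (S y) * norm (DS y i)" by (rule Cauchy_Schwarz_ineq2)
    also have "\<dots> \<le> 1 * 2" using S_less_1[OF assms] DS_le[of y i] i by (intro mult_mono) auto
    finally show "norm ((S y \<bullet> DS y i) *\<^sub>R i) \<le> 2" using i by simp
  qed
  finally show ?thesis by simp
qed

text \<open>The source of the O(t) error. Each coordinate of y - Z y splits into the displacement y
  - S y, at most \<delta>, and S y paired with i - DS y i, at most 2 L because |S y| < 1.\<close>

lemma norm_diff_Z_le:
  assumes "y \<in> \<Omega>" shows "norm (y - Z y) \<le> DIM('a) * (\<delta> + 2 * L)"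
proof -
  have "norm (y - Z y) \<le> (\<Sum>i\<in>Basis. \<bar>(y - Z y) \<bullet> i\<bar>)" by (rule norm_le_l1)
  also have "\<dots> \<le> (\<Sum>i\<in>(Basis::'a set). \<delta> + 2 * L)"
  proof (rule sum_mono)
    fix i :: 'a assume i: "i \<in> Basis"
    have "Z y \<bullet> i = S y \<bullet> DS y i"
      using i by (simp add: Z_def inner_sum_left inner_Basis if_distrib cong: if_cong)
    then have "(y - Z y) \<bullet> i = (y - S y) \<bullet> i + S y \<bullet> (i - DS y i)"
      by (simp add: inner_diff_left inner_diff_right)
    then have "\<bar>(y - Z y) \<bullet> i\<bar> \<le> \<bar>(y - S y) \<bullet> i\<bar> + \<bar>S y \<bullet> (i - DS y i)\<bar>"
      by (simp only: abs_triangle_ineq)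
    also have "\<bar>(y - S y) \<bullet> i\<bar> \<le> \<delta>"
      using Basis_le_norm[OF i, of "y - S y"] \<delta>[of "S y"] by (simp add: S_eq)
    also have "\<bar>S y \<bullet> (i - DS y i)\<bar> \<le> norm (S y) * norm (i - DS y i)" by (rule Cauchy_Schwarz_ineq2)
    also have "norm (S y) * norm (i - DS y i) \<le> 1 * (2 * L)"
      using S_less_1[OF assms] DS_near_id[of i y] i by (intro mult_mono) auto
    finally show "\<bar>(y - Z y) \<bullet> i\<bar> \<le> \<delta> + 2 * L" by simp
  qed
  finally show ?thesis by simp
qed

text \<open>The test function is \<open>f(|T\<^sup>-\<^sup>1 y|\<^sup>2)\<close>, where \<open>- 2 f'\<close> approximates \<open>1 / (N \<sigma>)\<close>, i.e. the
  transported solution for concentric balls up to smoothing.\<close>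

lemma energy_lower:
  "sqint \<Omega> P - (\<delta> + 2 * L)\<^sup>2 / min \<sigma>c \<sigma>s * measure lebesgue \<Omega> \<le> energy \<sigma>c \<sigma>s (T ` ball 0 R) \<Omega>"
proof -
  define N where "N = real DIM('a)"
  have N: "N > 0" by (simp add: N_def)
  \<comment> \<open>The solution on the balls has gradient -x / (N \<sigma>). A profile f in s =
    |x|^2 has gradient 2 f' x, so f' should be -1 / (2 N \<sigma>): half of -a inside and half of -b
    outside.\<close>
  define a b where "a = 1 / (N * \<sigma>c)" and "b = 1 / (N * \<sigma>s)"
  have ab: "0 \<le> a" "0 \<le> b" using N pos by (auto simp: a_def b_def)
  \<comment> \<open>\<open>Suc n\<close> keeps the reciprocal meaningful at n = 0; e n below 1 is
    where the cutoff of h n takes over, so the support of f n stays inside the unit ball.\<close>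
  define h where "h n = ramp a b (R\<^sup>2) (Suc n)" for n
  define e where "e n = 1 - 1 / real (Suc n)" for n
  have e: "0 \<le> e n" "e n < 1" for n by (auto simp: e_def field_simps)
  have "\<exists>f. (\<forall>s\<ge>0. (f has_real_derivative - (h n s) / 2) (at s)) \<and> (\<forall>s\<ge>e n. f s = 0)" for n
  proof -
    have "continuous_on UNIV (\<lambda>s. - (h n s) / 2)"
      unfolding h_def by (intro continuous_intros ramp_continuous) simp
    moreover have "- (h n s) / 2 = 0" if "e n \<le> s" for s
      using ramp_eq_0[of "Suc n" s] that unfolding h_def e_def by simp
    ultimately show ?thesis
      by (rule compactly_supported_primitive[OF _ e(1)[of n]]) blast+
  qed
  then obtain f where f': "\<And>n s. 0 \<le> s \<Longrightarrow> (f n has_real_derivative - (h n s) / 2) (at s)"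
    and f0: "\<And>n s. e n \<le> s \<Longrightarrow> f n s = 0" by metis
  define v where "v n y = f n ((norm (S y))\<^sup>2)" for n y
  have h_cont: "continuous_on UNIV (\<lambda>s. - (h n s) / 2)" for n
    unfolding h_def by (intro continuous_intros ramp_continuous) simp
  have v: "C1_fun (v n)" and v': "pderiv_dir i (v n) y = - h n ((norm (S y))\<^sup>2) * (S y \<bullet> DS y i)" for n i y
    using radial_C1_fun[OF f' h_cont] unfolding v_def[abs_def] by auto
  have v_C1c: "v n \<in> C1c \<Omega>" for n
  proof (rule C1cI[OF v])
    show "compact (T ` cball 0 (sqrt (e n)))" by (intro compact_continuous_image T_continuous compact_cball)
    have "sqrt (e n) < 1" using e by simp
    then show "T ` cball 0 (sqrt (e n)) \<subseteq> \<Omega>"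
      by (intro image_mono) (simp add: cball_subset_ball_iff)
    fix y assume "y \<notin> T ` cball 0 (sqrt (e n))"
    then have "sqrt (e n) \<le> norm (S y)" unfolding image_T by simp
    then have "e n \<le> (norm (S y))\<^sup>2" by (rule sqrt_le_D)
    then show "v n y = 0" by (simp add: v_def f0)
  qed
  have grad_v: "grad (v n) y = - h n ((norm (S y))\<^sup>2) *\<^sub>R Z y" for n y
    unfolding grad_def v' Z_def scaleR_sum_right by simp
  \<comment> \<open>The pointwise limit of the defect: \<open>W\<close> of the gradient tends to -Z
    y / (N sqrt(\<sigma>)), while \<open>P\<close> is y / (N sqrt(\<sigma>)).\<close>
  define G where "G y = (1 / (N * sqrt (\<sigma> y))) *\<^sub>R (y - Z y)" for y
  have lim: "(\<lambda>n. W (grad (v n)) y + P y) \<longlonglongrightarrow> G y" if y: "y \<in> \<Omega>" for y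
  proof -
    have s: "(norm (S y))\<^sup>2 < 1" using S_less_1[OF y] by (simp add: power_less_one_iff abs_square_less_1)
    have "(norm (S y))\<^sup>2 < R\<^sup>2 \<longleftrightarrow> y \<in> T ` ball 0 R"
      unfolding image_T using R by (auto intro: power_strict_mono dest: power2_less_imp_less)
    then have "(if (norm (S y))\<^sup>2 < R\<^sup>2 then a else b) = 1 / (N * \<sigma> y)"
      by (simp add: a_def b_def conductivity_def)
    then have "(\<lambda>n. h n ((norm (S y))\<^sup>2)) \<longlonglongrightarrow> 1 / (N * \<sigma> y)"
      using LIMSEQ_Suc[OF ramp_limit[OF s, of a b "R\<^sup>2"]] unfolding h_def by simp
    then have "(\<lambda>n. sqrt (\<sigma> y) *\<^sub>R (- h n ((norm (S y))\<^sup>2) *\<^sub>R Z y) + P y)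
        \<longlonglongrightarrow> sqrt (\<sigma> y) *\<^sub>R (- (1 / (N * \<sigma> y)) *\<^sub>R Z y) + P y"
      by (intro tendsto_intros)
    moreover have "sqrt (\<sigma> y) *\<^sub>R (- (1 / (N * \<sigma> y)) *\<^sub>R Z y) + P y = G y"
    proof -
      have "sqrt (\<sigma> y) * (1 / (N * \<sigma> y)) = 1 / (N * sqrt (\<sigma> y))"
        using \<sigma>_pos[of y] N real_sqrt_mult_self[of "\<sigma> y"] by (simp add: field_simps)
      moreover have "P y = (1 / (N * sqrt (\<sigma> y))) *\<^sub>R y"
        by (simp add: P_def N_def divide_inverse mult.commute)
      ultimately show ?thesis by (simp add: G_def scaleR_diff_right)
    qed
    ultimately show ?thesis by (simp add: W_def grad_v)
  qed
  define C where "C = sqrt (max \<sigma>c \<sigma>s) * (max a b * (2 * N))"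
  have bound: "norm (W (grad (v n)) y) \<le> C" if y: "y \<in> \<Omega>" for n y
  proof -
    have "\<bar>h n ((norm (S y))\<^sup>2)\<bar> * norm (Z y) \<le> max a b * (2 * N)"
      using ramp_bound[OF ab] norm_Z_le[OF y] ab unfolding h_def N_def by (intro mult_mono) auto
    then have "\<bar>sqrt (\<sigma> y)\<bar> * (\<bar>h n ((norm (S y))\<^sup>2)\<bar> * norm (Z y)) \<le> C"
      unfolding C_def by (rule mult_mono[OF sqrt_\<sigma>_bound]) (use pos in auto)
    then show ?thesis unfolding W_def grad_v norm_scaleR by simp
  qed
  interpret finite_measure "lebesgue_on \<Omega>" using lmeasurable by (rule finite_measure_lebesgue_on)
  have WP: "(\<lambda>y. W (grad (v n)) y + P y) \<in> L2 \<Omega>" for n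
    by (intro L2_add W_L2 P_L2 C1c_L2 lmeasurable v_C1c)
  \<comment> \<open>Measurability of G is inherited from the functions converging to it on
    \<Omega>.\<close>
  have G_meas [measurable]: "G \<in> borel_measurable (lebesgue_on \<Omega>)"
    by (rule borel_measurable_LIMSEQ_metric[OF L2_measurable[OF WP]]) (use lim in simp)
  have "(\<lambda>n. sqint \<Omega> (\<lambda>y. W (grad (v n)) y + P y)) \<longlonglongrightarrow> sqint \<Omega> G"
    unfolding sqint_def
  proof (rule integral_dominated_convergence)
    show "(\<lambda>y. (norm (G y))\<^sup>2) \<in> borel_measurable (lebesgue_on \<Omega>)" by measurable
    show "(\<lambda>y. (norm (W (grad (v n)) y + P y))\<^sup>2) \<in> borel_measurable (lebesgue_on \<Omega>)" for n
      using L2_integrable[OF WP] by auto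
    show "integrable (lebesgue_on \<Omega>) (\<lambda>y. 2 * C\<^sup>2 + 2 * (norm (P y))\<^sup>2)"
      using L2_integrable[OF P_L2] by simp
    show "AE y in lebesgue_on \<Omega>. (\<lambda>n. (norm (W (grad (v n)) y + P y))\<^sup>2) \<longlonglongrightarrow> (norm (G y))\<^sup>2"
      by (intro AE_I2 tendsto_intros lim) simp
    show "AE y in lebesgue_on \<Omega>. norm ((norm (W (grad (v n)) y + P y))\<^sup>2) \<le> 2 * C\<^sup>2 + 2 * (norm (P y))\<^sup>2" for n
    proof (rule AE_I2)
      fix y assume "y \<in> space (lebesgue_on \<Omega>)"
      then have "(norm (W (grad (v n)) y))\<^sup>2 \<le> C\<^sup>2" using bound by (intro power_mono) auto
      then show "norm ((norm (W (grad (v n)) y + P y))\<^sup>2) \<le> 2 * C\<^sup>2 + 2 * (norm (P y))\<^sup>2"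
        using norm_add_sq_le[of "W (grad (v n)) y" "P y"] by simp
    qed
  qed
  then have "(\<lambda>n. sqint \<Omega> P - sqint \<Omega> (\<lambda>y. W (grad (v n)) y + P y)) \<longlonglongrightarrow> sqint \<Omega> P - sqint \<Omega> G"
    by (intro tendsto_intros)
  then have low: "sqint \<Omega> P - sqint \<Omega> G \<le> energy \<sigma>c \<sigma>s (T ` ball 0 R) \<Omega>"
    by (rule LIMSEQ_le_const2) (use energy_ge[OF v_C1c] in blast)
  define K where "K = (\<delta> + 2 * L)\<^sup>2 / min \<sigma>c \<sigma>s"
  have G_le: "(norm (G y))\<^sup>2 \<le> K" if y: "y \<in> \<Omega>" for y
  proof -
    \<comment> \<open>The factor N from the coordinatewise estimate cancels the 1 / N of q.\<close>
    have "norm (G y) \<le> (1 / (N * sqrt (\<sigma> y))) * (N * (\<delta> + 2 * L))"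
      using norm_diff_Z_le[OF y] N \<sigma>_pos[of y] unfolding G_def norm_scaleR N_def
      by (intro mult_mono) auto
    also have "\<dots> = (\<delta> + 2 * L) / sqrt (\<sigma> y)" using N by simp
    finally have "(norm (G y))\<^sup>2 \<le> ((\<delta> + 2 * L) / sqrt (\<sigma> y))\<^sup>2" by (intro power_mono) auto
    also have "\<dots> = (\<delta> + 2 * L)\<^sup>2 / \<sigma> y" using \<sigma>_pos[of y] by (simp add: power_divide)
    also have "\<dots> \<le> K" unfolding K_def using \<sigma>_bounds(1)[of y] pos \<sigma>_pos[of y]
      by (intro divide_left_mono) auto
    finally show ?thesis .
  qed
  have "sqint \<Omega> G \<le> (\<integral>y. K \<partial>lebesgue_on \<Omega>)"
    unfolding sqint_def
  proof (rule integral_mono)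
    show "integrable (lebesgue_on \<Omega>) (\<lambda>y. (norm (G y))\<^sup>2)"
      by (rule integrable_const_bound[of _ K]) (use G_le in auto)
  qed (use G_le in auto)
  also have "\<dots> = K * measure lebesgue \<Omega>"
    using lmeasurable by (simp add: measure_restrict_space)
  finally show ?thesis using low by (simp add: K_def)
qed

text \<open>On \<Omega>, 1 / \<sigma> is 1 / \<sigma>s plus (1 / \<sigma>c - 1 / \<sigma>s) times
  the indicator of the inner set.\<close>

lemma sqint_P:
  "sqint \<Omega> P = (sqint \<Omega> (\<lambda>x. x) / \<sigma>s + (1 / \<sigma>c - 1 / \<sigma>s) * sqint (T ` ball 0 R) (\<lambda>x. x)) / (DIM('a))\<^sup>2"
proof -
  let ?D = "T ` ball 0 R" and ?M = "lebesgue_on \<Omega>"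
  have sub: "?D \<subseteq> \<Omega>" using R by (intro image_mono) auto
  have \<Omega>': "\<Omega> \<in> sets lebesgue" using lmeasurable by auto
  have id: "(\<lambda>x. x) \<in> L2 \<Omega>" using L2_scaleR[OF q_L2, of "DIM('a)"] by simp
  have i1: "integrable ?M (\<lambda>x. (norm x)\<^sup>2)" by (rule L2_integrable[OF id])
  have i2: "integrable ?M (\<lambda>x. if x \<in> ?D then (norm x)\<^sup>2 else 0)"
  proof (rule Bochner_Integration.integrable_bound[OF i1])
    have "(\<lambda>x. if x \<in> ?D then (norm x)\<^sup>2 else 0) \<in> borel_measurable lebesgue"
      by (rule borel_measurable_if[OF D_sets, THEN iffD2])
         (intro continuous_borel_measurable_lebesgue_on continuous_intros)
    then show "(\<lambda>x. if x \<in> ?D then (norm x)\<^sup>2 else 0) \<in> borel_measurable ?M"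
      by (rule measurable_restrict_space1)
  qed auto
  have eq: "(norm (P x))\<^sup>2 = ((norm x)\<^sup>2 / \<sigma>s + (1 / \<sigma>c - 1 / \<sigma>s) * (if x \<in> ?D then (norm x)\<^sup>2 else 0)) / (DIM('a))\<^sup>2" for x
  proof -
    have "(norm (P x))\<^sup>2 = (norm x)\<^sup>2 / \<sigma> x / (DIM('a))\<^sup>2"
      using \<sigma>_pos[of x] by (simp add: P_def power_mult_distrib power_divide divide_inverse power_inverse mult_ac)
    also have "(norm x)\<^sup>2 / \<sigma> x = (norm x)\<^sup>2 / \<sigma>s + (1 / \<sigma>c - 1 / \<sigma>s) * (if x \<in> ?D then (norm x)\<^sup>2 else 0)"
      by (simp add: conductivity_def left_diff_distrib)
    finally show ?thesis .
  qed
  have "(\<integral>x. (if x \<in> ?D then (norm x)\<^sup>2 else 0) \<partial>?M) = sqint ?D (\<lambda>x. x)"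
    unfolding sqint_def by (rule Lebesgue_Measure.integral_restrict[OF sub D_sets \<Omega>'])
  then show ?thesis
    unfolding sqint_def[of \<Omega>] eq using i1 i2 by simp
qed

end


section \<open>Second moments of domains close to a ball\<close>

lemma second_moment_near_ball:
  fixes A :: "'a::euclidean_space set"
  assumes A: "A \<in> lmeasurable" and vol: "measure lebesgue A = measure lebesgue (ball (0::'a) r)"
    and sub: "ball 0 (r - \<delta>) \<subseteq> A" "A \<subseteq> ball 0 (r + \<delta>)" and \<delta>: "0 \<le> \<delta>" "\<delta> \<le> r"
  shows "\<bar>sqint A (\<lambda>x. x) - sqint (ball 0 r) (\<lambda>x::'a. x)\<bar>
    \<le> (2 * r + \<delta>) * \<delta> * (measure lebesgue (ball (0::'a) (r + \<delta>)) - measure lebesgue (ball (0::'a) (r - \<delta>)))"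
proof -
  let ?B = "ball (0::'a) r" and ?Bp = "ball (0::'a) (r + \<delta>)" and ?Bm = "ball (0::'a) (r - \<delta>)"
  \<comment> \<open>c = (r + \<delta>)^2 - r^2, which also dominates r^2 - (r - \<delta>)^2 = c - 2
    \<delta>^2.\<close>
  define c where "c = (2 * r + \<delta>) * \<delta>"
  have int: "integrable lebesgue (\<lambda>x. indicator X x * ((norm x)\<^sup>2 - r\<^sup>2))"
    and int_eq: "(\<integral>x. indicator X x * ((norm x)\<^sup>2 - r\<^sup>2) \<partial>lebesgue) = sqint X (\<lambda>x. x) - r\<^sup>2 * measure lebesgue X"
    if X: "X \<in> lmeasurable" "X \<subseteq> ?Bp" for X :: "'a set"
  proof -
    have X': "X \<in> sets lebesgue" using X by auto
    have id: "(\<lambda>x. x) \<in> L2 X"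
      using X(2) by (intro L2_bounded[OF X(1), of _ "r + \<delta>"] continuous_borel_measurable_lebesgue_on continuous_intros)
        (auto simp: less_imp_le)
    interpret finite_measure "lebesgue_on X" using X(1) by (rule finite_measure_lebesgue_on)
    have i: "integrable (lebesgue_on X) (\<lambda>x. (norm x)\<^sup>2 - r\<^sup>2)"
      using L2_integrable[OF id] by simp
    have eq: "(\<lambda>x. indicator X x * ((norm x)\<^sup>2 - r\<^sup>2)) = (\<lambda>x. if x \<in> X then (norm x)\<^sup>2 - r\<^sup>2 else 0)"
      by (auto simp: indicator_def)
    show "integrable lebesgue (\<lambda>x. indicator X x * ((norm x)\<^sup>2 - r\<^sup>2))"
      unfolding eq by (rule Lebesgue_Measure.integrable_restrict_UNIV[OF X', THEN iffD2, OF i])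
    show "(\<integral>x. indicator X x * ((norm x)\<^sup>2 - r\<^sup>2) \<partial>lebesgue) = sqint X (\<lambda>x. x) - r\<^sup>2 * measure lebesgue X"
      unfolding eq Lebesgue_Measure.integral_restrict_UNIV[OF X'] sqint_def
      using L2_integrable[OF id] X' by (simp add: measure_restrict_space)
  qed
  have B: "?B \<in> lmeasurable" "?B \<subseteq> ?Bp" using \<delta> by auto
  \<comment> \<open>Subtracting r^2 from the integrand changes both moments by the same amount, as
    the volumes agree.\<close>
  have sq: "sqint A (\<lambda>x. x) - sqint ?B (\<lambda>x. x)
      = (\<integral>x. indicator A x * ((norm x)\<^sup>2 - r\<^sup>2) - indicator ?B x * ((norm x)\<^sup>2 - r\<^sup>2) \<partial>lebesgue)"
    using int[OF A sub(2)] int[OF B] by (simp add: int_eq[OF A sub(2)] int_eq[OF B] vol)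
  have "\<bar>\<integral>x. indicator A x * ((norm x)\<^sup>2 - r\<^sup>2) - indicator ?B x * ((norm x)\<^sup>2 - r\<^sup>2) \<partial>lebesgue\<bar>
      \<le> (\<integral>x. \<bar>indicator A x * ((norm x)\<^sup>2 - r\<^sup>2) - indicator ?B x * ((norm x)\<^sup>2 - r\<^sup>2)\<bar> \<partial>lebesgue)"
    by (rule integral_abs_bound)
  also have "\<dots> \<le> (\<integral>x. c * (indicator ?Bp x - indicator ?Bm x) \<partial>lebesgue)"
  proof (rule integral_mono)
    show "integrable lebesgue (\<lambda>x. \<bar>indicator A x * ((norm x)\<^sup>2 - r\<^sup>2) - indicator ?B x * ((norm x)\<^sup>2 - r\<^sup>2)\<bar>)"
      by (intro integrable_abs Bochner_Integration.integrable_diff int A sub B)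
    show "integrable lebesgue (\<lambda>x. c * (indicator ?Bp x - indicator ?Bm x))"
      using emeasure_bounded_finite[OF bounded_ball]
      by (intro integrable_mult_right Bochner_Integration.integrable_diff integrable_real_indicator) auto
    fix x :: 'a
    have c: "0 \<le> c" using \<delta> by (simp add: c_def)
    show "\<bar>indicator A x * ((norm x)\<^sup>2 - r\<^sup>2) - indicator ?B x * ((norm x)\<^sup>2 - r\<^sup>2)\<bar> \<le> c * (indicator ?Bp x - indicator ?Bm x)"
    proof (cases "x \<in> ?Bp \<and> x \<notin> ?Bm")
      case True
      then have x: "r - \<delta> \<le> norm x" "norm x \<le> r + \<delta>" by auto
      have "(norm x)\<^sup>2 \<le> (r + \<delta>)\<^sup>2" using x by (intro power_mono) auto
      moreover have "(r - \<delta>)\<^sup>2 \<le> (norm x)\<^sup>2" using x \<delta> by (intro power_mono) auto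
      moreover have "(r + \<delta>)\<^sup>2 = r\<^sup>2 + c" "(r - \<delta>)\<^sup>2 = r\<^sup>2 - c + 2 * \<delta>\<^sup>2"
        by (simp_all add: c_def power2_eq_square algebra_simps)
      ultimately have "\<bar>(norm x)\<^sup>2 - r\<^sup>2\<bar> \<le> c"
        using zero_le_power2[of \<delta>] unfolding abs_le_iff by linarith
      moreover have "indicator ?Bp x - indicator ?Bm x = (1::real)" using True by simp
      ultimately show ?thesis using c by (auto simp: indicator_def)
    next
      case False
      \<comment> \<open>Off the shell both indicators are 1 in the smaller ball and 0 outside the
        larger one.\<close>
      then have "indicator A x = (indicator ?B x :: real)" using sub B(2) \<delta> by (force simp: indicator_def)
      moreover have "0 \<le> indicator ?Bp x - (indicator ?Bm x :: real)" using \<delta> by (auto simp: indicator_def)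
      ultimately show ?thesis using c by simp
    qed
  qed
  also have "\<dots> = c * (measure lebesgue ?Bp - measure lebesgue ?Bm)"
    using emeasure_bounded_finite[OF bounded_ball]
    by (subst integral_mult_right_zero, subst Bochner_Integration.integral_diff)
       (auto intro!: integrable_real_indicator)
  finally show ?thesis unfolding sq c_def .
qed


section \<open>Curves of perturbations\<close>

lemma C2_fun_C1: "C2_fun f \<Longrightarrow> C1_fun f"
  by (simp add: C2_fun_def C1_fun_def C1_fun_continuous)

text \<open>A supremum in \<open>W2inf_norm\<close> bounds anything only if the range is bounded, so
  difference quotients of a curve must first be placed in \<open>C2inf\<close>.\<close>

lemma C2inf_combination:
  assumes f: "f \<in> C2inf" and g: "g \<in> C2inf"
  shows "(\<lambda>x. f x + c *\<^sub>R g x) \<in> C2inf"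
proof -
  have "C2_fun f" "C2_fun g" using f g by (auto simp: C2inf_def)
  then have C1: "C1_fun f" "C1_fun g" and C1': "i \<in> Basis \<Longrightarrow> C1_fun (pderiv_dir i f)" "i \<in> Basis \<Longrightarrow> C1_fun (pderiv_dir i g)" for i
    using C2_fun_C1 by (auto simp: C2_fun_def)
  have p: "pderiv_dir i (\<lambda>x. f x + c *\<^sub>R g x) = (\<lambda>x. pderiv_dir i f x + c *\<^sub>R pderiv_dir i g x)" for i
    by (simp add: fun_eq_iff C1_fun_add(2)[OF C1(1) C1_fun_scaleR(1)[OF C1(2)]] C1_fun_scaleR(2)[OF C1(2)])
  have pp: "pderiv_dir j (\<lambda>x. pderiv_dir i f x + c *\<^sub>R pderiv_dir i g x)
      = (\<lambda>x. pderiv_dir j (pderiv_dir i f) x + c *\<^sub>R pderiv_dir j (pderiv_dir i g) x)" if "i \<in> Basis" for i j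
    by (simp add: fun_eq_iff C1_fun_add(2)[OF C1'(1) C1_fun_scaleR(1)[OF C1'(2)]] C1_fun_scaleR(2)[OF C1'(2)] that)
  have b: "bounded (range (\<lambda>x. u x + c *\<^sub>R w x))" if "bounded (range u)" "bounded (range w)" for u w :: "'a \<Rightarrow> 'b"
    using bounded_plus_comp[OF that(1) bounded_scaleR_comp[OF that(2)]] .
  have "C2_fun (\<lambda>x. f x + c *\<^sub>R g x)"
    using C1_fun_add(1)[OF C1(1) C1_fun_scaleR(1)[OF C1(2)], of c]
      C1_fun_add(1)[OF C1'(1) C1_fun_scaleR(1)[OF C1'(2)], of _ _ c]
    unfolding C2_fun_def p by (auto simp: C1_fun_def[of "\<lambda>x. f x + c *\<^sub>R g x"])
  then show ?thesis
    using f g by (auto simp: C2inf_def p pp intro!: b)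
qed

lemma W2inf_norm_bounds:
  fixes f :: "'a::euclidean_space \<Rightarrow> 'b::real_normed_vector"
  assumes f: "f \<in> C2inf"
  shows "norm (f x) \<le> W2inf_norm f" "i \<in> Basis \<Longrightarrow> norm (pderiv_dir i f x) \<le> W2inf_norm f"
proof -
  have up: "norm (u x) \<le> (SUP x. norm (u x))" if "bounded (range u)" for u :: "'a \<Rightarrow> 'b" and x
    using that by (intro cSUP_upper) (auto simp: bounded_iff bdd_above_def)
  have nn: "0 \<le> (SUP x. norm (u x))" if "bounded (range u)" for u :: "'a \<Rightarrow> 'b"
    using order_trans[OF norm_ge_zero up[OF that]] .
  define s0 where "s0 = (SUP x. norm (f x))"
  define s1 where "s1 i = (SUP x. norm (pderiv_dir i f x))" for i
  define s2 where "s2 i j = (SUP x. norm (pderiv_dir j (pderiv_dir i f) x))" for i j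
  have W: "W2inf_norm f = s0 + (\<Sum>i\<in>Basis. s1 i) + (\<Sum>i\<in>Basis. \<Sum>j\<in>Basis. s2 i j)"
    by (simp add: W2inf_norm_def s0_def s1_def s2_def)
  have 0: "0 \<le> s0" "norm (f x) \<le> s0" using f nn up by (auto simp: s0_def C2inf_def)
  have 1: "0 \<le> s1 i" "norm (pderiv_dir i f x) \<le> s1 i" if "i \<in> Basis" for i
    using f nn up that by (auto simp: s1_def C2inf_def)
  have "0 \<le> s2 i j" if "i \<in> Basis" "j \<in> Basis" for i j
    using f nn that by (auto simp: s2_def C2inf_def)
  then have 2: "0 \<le> (\<Sum>i\<in>Basis. \<Sum>j\<in>Basis. s2 i j)" by (intro sum_nonneg)
  have 3: "0 \<le> (\<Sum>i\<in>Basis. s1 i)" using 1 by (intro sum_nonneg)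
  show "norm (f x) \<le> W2inf_norm f" using 0 2 3 by (simp add: W)
  assume i: "i \<in> Basis"
  have "s1 i \<le> (\<Sum>i\<in>Basis. s1 i)" using 1 i by (intro member_le_sum) auto
  then show "norm (pderiv_dir i f x) \<le> W2inf_norm f" using 0 2 1(2)[OF i] by (simp add: W)
qed

text \<open>For small t > 0 one has \<Phi>(t) = t (\<Phi>'(0) + F t), where F t, the error of the
  difference quotient at 0, has norm below 1. Hence K = 1 plus the norm of \<Phi>'(0).\<close>

lemma perturbation_linear_bound:
  fixes \<Phi> :: "real \<Rightarrow> 'a::euclidean_space \<Rightarrow> 'a"
  assumes "\<Phi> \<in> perturbations"
  obtains K \<epsilon> where "K > 0" "\<epsilon> > 0"
    "\<And>t. 0 \<le> t \<Longrightarrow> t < \<epsilon> \<Longrightarrow> C1_fun (\<Phi> t)"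
    "\<And>t x. 0 \<le> t \<Longrightarrow> t < \<epsilon> \<Longrightarrow> norm (\<Phi> t x) \<le> K * t"
    "\<And>t i x. 0 \<le> t \<Longrightarrow> t < \<epsilon> \<Longrightarrow> i \<in> Basis \<Longrightarrow> norm (pderiv_dir i (\<Phi> t) x) \<le> K * t"
proof -
  obtain \<Phi>' where \<Phi>0: "\<Phi> 0 = (\<lambda>x. 0)" and der: "curve_has_deriv \<Phi> \<Phi>'"
    using assms by (auto simp: perturbations_def)
  have C2: "\<Phi> t \<in> C2inf" "\<Phi>' t \<in> C2inf" if "0 \<le> t" "t < 1" for t
    using der that by (auto simp: curve_has_deriv_def)
  define F where "F s x = (1 / s) *\<^sub>R \<Phi> s x + (-1) *\<^sub>R \<Phi>' 0 x" for s x
  have lim: "((\<lambda>s. W2inf_norm (\<lambda>x. (\<Phi> s x - \<Phi> 0 x) /\<^sub>R (s - 0) - \<Phi>' 0 x)) \<longlongrightarrow> 0) (at 0 within {0..<1})"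
    using der unfolding curve_has_deriv_def by (auto dest!: bspec[of _ _ 0])
  have F_eq: "(\<lambda>x. (\<Phi> s x - \<Phi> 0 x) /\<^sub>R (s - 0) - \<Phi>' 0 x) = F s" for s
    by (simp add: \<Phi>0 fun_eq_iff F_def inverse_eq_divide)
  have "\<forall>\<^sub>F s in at 0 within {0..<1}. W2inf_norm (F s) < 1"
    using order_tendstoD(2)[OF lim[unfolded F_eq], of 1] by simp
  then obtain d where d: "d > 0" and small: "\<And>s. 0 < s \<Longrightarrow> s < 1 \<Longrightarrow> s < d \<Longrightarrow> W2inf_norm (F s) < 1"
    unfolding eventually_at by (auto simp: dist_real_def)
  define K where "K = 1 + W2inf_norm (\<Phi>' 0)"
  have C2': "\<Phi>' 0 \<in> C2inf" using C2 by simp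
  have K: "K > 0" using order_trans[OF norm_ge_zero W2inf_norm_bounds(1)[OF C2']] by (simp add: K_def add_pos_nonneg)
  have C1: "C1_fun (\<Phi> t)" if "0 \<le> t" "t < min d 1" for t
    using C2(1)[of t] that by (auto simp: C2inf_def C2_fun_C1)
  have est: "norm (\<Phi> t x) \<le> K * t" "\<And>i. i \<in> Basis \<Longrightarrow> norm (pderiv_dir i (\<Phi> t) x) \<le> K * t" if t: "0 < t" "t < min d 1" for t x
  proof -
    have Ct: "\<Phi> t \<in> C2inf" using C2 t by simp
    have z: "(\<lambda>x. 0) \<in> (C2inf :: ('a \<Rightarrow> 'a) set)" using C2inf_combination[OF Ct Ct, of "-1"] by simp
    have F: "F t \<in> C2inf"
      unfolding F_def[abs_def] using C2inf_combination[OF C2inf_combination[OF z Ct, of "1/t"] C2', of "-1"] by simp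
    have \<Phi>t: "\<Phi> t = (\<lambda>x. t *\<^sub>R (F t x + \<Phi>' 0 x))"
      using t by (simp add: F_def fun_eq_iff)
    have W: "W2inf_norm (F t) < 1" using small t by simp
    have "norm (F t x + \<Phi>' 0 x) \<le> K"
      using norm_triangle_ineq[of "F t x" "\<Phi>' 0 x"] W2inf_norm_bounds(1)[OF F, of x] W2inf_norm_bounds(1)[OF C2', of x] W
      by (simp add: K_def)
    then show "norm (\<Phi> t x) \<le> K * t" using t mult_left_mono[of _ K t] by (simp add: \<Phi>t mult.commute)
    have c1: "C1_fun (F t)" "C1_fun (\<Phi>' 0)" using F C2' by (auto simp: C2inf_def C2_fun_C1)
    fix i :: 'a assume i: "i \<in> Basis"
    have "pderiv_dir i (\<Phi> t) x = t *\<^sub>R (pderiv_dir i (F t) x + pderiv_dir i (\<Phi>' 0) x)"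
      unfolding \<Phi>t by (simp add: C1_fun_scaleR(2)[OF C1_fun_add(1)[OF c1]] C1_fun_add(2)[OF c1])
    moreover have "norm (pderiv_dir i (F t) x + pderiv_dir i (\<Phi>' 0) x) \<le> K"
      using norm_triangle_ineq[of "pderiv_dir i (F t) x" "pderiv_dir i (\<Phi>' 0) x"]
        W2inf_norm_bounds(2)[OF F i, of x] W2inf_norm_bounds(2)[OF C2' i, of x] W
      by (simp add: K_def)
    ultimately show "norm (pderiv_dir i (\<Phi> t) x) \<le> K * t" using t mult_left_mono[of _ K t] by (simp add: mult.commute)
  qed
  have zero: "pderiv_dir i (\<lambda>x::'a. 0::'a) x = 0" for i x
    by (rule pderiv_dir_eq) simp
  show thesis
  proof (rule that[OF K, of "min d 1"])
    show "norm (\<Phi> t x) \<le> K * t" if "0 \<le> t" "t < min d 1" for t x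
      using est(1)[of t x] that \<Phi>0 by (cases "t = 0") auto
    show "norm (pderiv_dir i (\<Phi> t) x) \<le> K * t" if "0 \<le> t" "t < min d 1" "i \<in> Basis" for t i x
      using est(2)[of t i x] that zero by (cases "t = 0") (auto simp: \<Phi>0)
  qed (use d C1 in auto)
qed


section \<open>The shape derivative\<close>

lemma critical_shape_concentric_balls:
  fixes R \<sigma>c \<sigma>s :: real
  assumes R: "0 < R" "R < 1" and \<sigma>: "0 < \<sigma>c" "0 < \<sigma>s"
  shows "critical_shape_fixed_volume (energy \<sigma>c \<sigma>s) (ball (0::'a::euclidean_space) R) (ball 0 1)"
  unfolding critical_shape_fixed_volume_def
proof (intro ballI impI, elim conjE)
  fix \<Phi> :: "real \<Rightarrow> 'a \<Rightarrow> 'a"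
  assume \<Phi>: "\<Phi> \<in> perturbations" and volR: "preserves_volume \<Phi> (ball 0 R)" and vol1: "preserves_volume \<Phi> (ball 0 1)"
  obtain K \<epsilon> where K: "K > 0" and \<epsilon>: "\<epsilon> > 0"
    and C1: "\<And>t. 0 \<le> t \<Longrightarrow> t < \<epsilon> \<Longrightarrow> C1_fun (\<Phi> t)"
    and b0: "\<And>t x. 0 \<le> t \<Longrightarrow> t < \<epsilon> \<Longrightarrow> norm (\<Phi> t x) \<le> K * t"
    and b1: "\<And>t i x. 0 \<le> t \<Longrightarrow> t < \<epsilon> \<Longrightarrow> i \<in> Basis \<Longrightarrow> norm (pderiv_dir i (\<Phi> t) x) \<le> K * t"
    using perturbation_linear_bound[OF \<Phi>] by metis
  obtain \<epsilon>R where \<epsilon>R: "\<epsilon>R > 0" "\<And>t. 0 \<le> t \<Longrightarrow> t < \<epsilon>R \<Longrightarrow> measure lebesgue (deform \<Phi> t (ball 0 R)) = measure lebesgue (ball (0::'a) R)"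
    using volR by (auto simp: preserves_volume_def)
  obtain \<epsilon>1 where \<epsilon>1: "\<epsilon>1 > 0" "\<And>t. 0 \<le> t \<Longrightarrow> t < \<epsilon>1 \<Longrightarrow> measure lebesgue (deform \<Phi> t (ball 0 1)) = measure lebesgue (ball (0::'a) 1)"
    using vol1 by (auto simp: preserves_volume_def)
  define N where "N = real DIM('a)"
  have N: "N \<ge> 1" using DIM_positive[where 'a='a] by (simp add: N_def)
  \<comment> \<open>Below \<tau> both volume constraints hold, and N K t \<le> R / 2 yields L \<le>
    1/2 and keeps the inner radius R - K t nonnegative.\<close>
  define \<tau> where "\<tau> = min (min \<epsilon> (min \<epsilon>R \<epsilon>1)) (R / (2 * N * K))"
  have \<tau>: "\<tau> > 0" using \<epsilon> \<epsilon>R \<epsilon>1 R N K by (simp add: \<tau>_def)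
  have Kt: "N * (K * t) \<le> 1 / 2" "K * t \<le> R" if "0 \<le> t" "t < \<tau>" for t
  proof -
    have "t * (2 * N * K) \<le> R"
      using that N K by (simp add: \<tau>_def pos_le_divide_eq[symmetric])
    then have p: "2 * (N * (K * t)) \<le> R" by (simp add: mult_ac)
    then show "N * (K * t) \<le> 1 / 2" using R by linarith
    have Kt: "0 \<le> K * t" using K that by simp
    have "1 * (K * t) \<le> N * (K * t)" by (rule mult_right_mono[OF N Kt])
    with Kt show "K * t \<le> R" using p by linarith
  qed
  define F where "F t = energy \<sigma>c \<sigma>s (deform \<Phi> t (ball 0 R)) (deform \<Phi> t (ball 0 1))" for t
  define m where "m A = sqint A (\<lambda>x::'a. x)" for A
  define Q where "Q t = (m (deform \<Phi> t (ball 0 1)) / \<sigma>s + (1 / \<sigma>c - 1 / \<sigma>s) * m (deform \<Phi> t (ball 0 R))) / N\<^sup>2" for t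
  define V where "V r = measure lebesgue (ball (0::'a) r)" for r
  \<comment> \<open>The error of \<open>energy_lower\<close> divided by t^2, with \<delta> = K t, L
    = N K t and the volume of the deformed unit ball equal to V 1.\<close>
  define c1 where "c1 = (K + 2 * (N * K))\<^sup>2 / min \<sigma>c \<sigma>s * V 1"
  have energy: "F t \<le> Q t" "Q t - c1 * t\<^sup>2 \<le> F t"
    and moment: "r \<in> {R, 1} \<Longrightarrow> \<bar>m (deform \<Phi> t (ball 0 r)) - m (ball 0 r)\<bar> \<le> (2 * r + K * t) * (K * t) * (V (r + K * t) - V (r - K * t))"
    if t: "0 \<le> t" "t < \<tau>" for t r
  proof -
    have t': "t < \<epsilon>" "t < \<epsilon>R" "t < \<epsilon>1" using t by (auto simp: \<tau>_def)
    \<comment> \<open>L = N K t because the locale asks for partial derivatives bounded by L /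
      N.\<close>
    interpret perturbed_balls "\<Phi> t" "K * t" "N * (K * t)" \<sigma>c \<sigma>s R
      by unfold_locales (use t t' C1 b0 b1 Kt \<sigma> R N in \<open>auto simp: N_def\<close>)
    have T: "deform \<Phi> t A = T ` A" for A by (simp add: deform_def T_def)
    have vol: "measure lebesgue (T ` ball 0 r) = measure lebesgue (ball (0::'a) r)" if "r \<in> {R, 1}" for r
      using that t t' \<epsilon>R(2) \<epsilon>1(2) by (auto simp flip: T)
    have P: "sqint \<Omega> P = Q t" unfolding sqint_P Q_def T m_def N_def by simp
    show "F t \<le> Q t" using energy_le unfolding P F_def T .
    have "(K * t + 2 * (N * (K * t)))\<^sup>2 / min \<sigma>c \<sigma>s * measure lebesgue \<Omega> = c1 * t\<^sup>2"
      by (simp add: c1_def V_def vol power2_eq_square algebra_simps)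
    then show "Q t - c1 * t\<^sup>2 \<le> F t" using energy_lower unfolding P F_def T by simp
    show "\<bar>m (deform \<Phi> t (ball 0 r)) - m (ball 0 r)\<bar> \<le> (2 * r + K * t) * (K * t) * (V (r + K * t) - V (r - K * t))"
      if r: "r \<in> {R, 1}"
      unfolding m_def V_def T
    proof (rule second_moment_near_ball)
      show "T ` ball 0 r \<in> lmeasurable"
        by (rule lmeasurable_open[OF bounded_subset[OF bounded_ball image_T_ball_subset] open_image_T]) simp
      show "K * t \<le> r" using r Kt(2)[OF t] R by auto
    qed (use vol[OF r] ball_subset_image_T image_T_ball_subset K t in auto)
  qed
  have id: "deform \<Phi> 0 A = A" for A
    using \<Phi> by (simp add: deform_def perturbations_def)
  \<comment> \<open>At t = 0 the upper and lower bounds coincide.\<close>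
  have F0: "F 0 = Q 0" using energy[of 0] \<tau> by simp
  define c2 where "c2 = 1 / \<sigma>s + \<bar>1 / \<sigma>c - 1 / \<sigma>s\<bar>"
  \<comment> \<open>Bounds the change of the second moment after division by t. The remaining
    factor, the volume of a shell, makes it tend to 0.\<close>
  define g where "g r t = (2 * r + K * t) * K * (V (r + K * t) - V (r - K * t))" for r t
  have Q: "\<bar>Q t - Q 0\<bar> \<le> c2 * t * (g 1 t + g R t)" if t: "0 \<le> t" "t < \<tau>" for t
  proof -
    define x y where "x = m (deform \<Phi> t (ball 0 1)) - m (ball 0 1)" and "y = m (deform \<Phi> t (ball 0 R)) - m (ball 0 R)"
    have x: "\<bar>x\<bar> \<le> t * g 1 t" and y: "\<bar>y\<bar> \<le> t * g R t"
      using moment[OF t, of 1] moment[OF t, of R] by (simp_all add: x_def y_def g_def mult_ac)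
    have "Q t - Q 0 = (x / \<sigma>s + (1 / \<sigma>c - 1 / \<sigma>s) * y) / N\<^sup>2"
      unfolding Q_def id x_def y_def
      by (simp add: diff_divide_distrib[symmetric] right_diff_distrib)
    also have "\<bar>\<dots>\<bar> \<le> \<bar>x / \<sigma>s + (1 / \<sigma>c - 1 / \<sigma>s) * y\<bar> / 1"
      unfolding abs_divide using N by (intro divide_left_mono) auto
    also have "\<dots> \<le> \<bar>x\<bar> * (1 / \<sigma>s) + \<bar>1 / \<sigma>c - 1 / \<sigma>s\<bar> * \<bar>y\<bar>"
      using abs_triangle_ineq[of "x / \<sigma>s" "(1 / \<sigma>c - 1 / \<sigma>s) * y"] \<sigma> by (simp add: abs_mult)
    also have "\<dots> \<le> (\<bar>x\<bar> + \<bar>y\<bar>) * (1 / \<sigma>s) + \<bar>1 / \<sigma>c - 1 / \<sigma>s\<bar> * (\<bar>x\<bar> + \<bar>y\<bar>)"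
      using \<sigma> by (intro add_mono mult_right_mono mult_left_mono) auto
    also have "\<dots> = c2 * (\<bar>x\<bar> + \<bar>y\<bar>)" by (simp add: c2_def algebra_simps)
    also have "\<dots> \<le> c2 * (t * g 1 t + t * g R t)"
      using x y \<sigma> by (intro mult_left_mono add_mono) (auto simp: c2_def)
    finally show ?thesis by (simp add: algebra_simps)
  qed
  have F: "\<bar>(F t - F 0) / (t - 0)\<bar> \<le> c1 * t + c2 * (g 1 t + g R t)" if t: "0 < t" "t < \<tau>" for t
  proof -
    \<comment> \<open>F t lies between Q t - c1 t^2 and Q t while F 0 = Q 0, so the change of F is
      that of Q up to c1 t^2.\<close>
    have "\<bar>F t - F 0\<bar> \<le> (c1 * t + c2 * (g 1 t + g R t)) * t"
    proof -
      have "0 \<le> c1 * t\<^sup>2" using \<sigma> by (simp add: c1_def V_def)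
      then show ?thesis
        using energy[of t] Q[of t] t unfolding F0 by (simp add: abs_le_iff algebra_simps power2_eq_square)
    qed
    then show ?thesis using t by (simp add: pos_divide_le_eq)
  qed
  have V: "V r = unit_ball_vol N * r ^ DIM('a)" if "0 \<le> r" for r
    using that by (simp add: V_def content_ball N_def)
  have g_lim: "(g r \<longlongrightarrow> 0) (at 0 within {0..<1})" if r: "r > 0" for r
  proof -
    have "((\<lambda>t::real. (2 * r + K * t) * K * (unit_ball_vol N * (r + K * t) ^ DIM('a) - unit_ball_vol N * (r - K * t) ^ DIM('a)))
        \<longlongrightarrow> (2 * r + K * 0) * K * (unit_ball_vol N * (r + K * 0) ^ DIM('a) - unit_ball_vol N * (r - K * 0) ^ DIM('a)))
        (at 0 within {0..<1})"
      by (intro tendsto_intros)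
    moreover have "\<forall>\<^sub>F t in at (0::real) within {0..<1}. (2 * r + K * t) * K * (unit_ball_vol N * (r + K * t) ^ DIM('a) - unit_ball_vol N * (r - K * t) ^ DIM('a)) = g r t"
      unfolding eventually_at
    \<comment> \<open>The power formula for V holds for nonnegative radii, hence the restriction K t
      \<le> r.\<close>
    proof (intro exI[of _ "r / K"] conjI ballI impI)
      fix t :: real assume "t \<in> {0..<1}" "t \<noteq> 0 \<and> dist t 0 < r / K"
      then have "0 \<le> t" "K * t \<le> r" using K by (auto simp: pos_less_divide_eq mult.commute)
      then show "(2 * r + K * t) * K * (unit_ball_vol N * (r + K * t) ^ DIM('a) - unit_ball_vol N * (r - K * t) ^ DIM('a)) = g r t"
        using r K by (simp add: g_def V)
    qed (use r K in auto)
    ultimately show ?thesis by (simp add: Lim_transform_eventually)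
  qed
  have "((\<lambda>t. (F t - F 0) / (t - 0)) \<longlongrightarrow> 0) (at 0 within {0..<1})"
  proof (rule Lim_null_comparison)
    show "\<forall>\<^sub>F t in at 0 within {0..<1}. norm ((F t - F 0) / (t - 0)) \<le> c1 * t + c2 * (g 1 t + g R t)"
      unfolding eventually_at using F \<tau> by (intro exI[of _ \<tau>]) auto
    have "((\<lambda>t. c1 * t + c2 * (g 1 t + g R t)) \<longlongrightarrow> c1 * 0 + c2 * (0 + 0)) (at 0 within {0..<1})"
      using R by (intro tendsto_intros g_lim) auto
    then show "((\<lambda>t. c1 * t + c2 * (g 1 t + g R t)) \<longlongrightarrow> 0) (at 0 within {0..<1})" by simp
  qed
  then show "has_shape_derivative (energy \<sigma>c \<sigma>s) (ball 0 R) (ball 0 1) \<Phi> 0"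
    unfolding has_shape_derivative_def has_field_derivative_iff F_def[symmetric] .
qed

theorem theorem1:
  fixes R \<sigma>c \<sigma>s :: real
  assumes "2 \<le> CARD('n::finite)"
    and "0 < R" and "R < 1" and "0 < \<sigma>c" and "0 < \<sigma>s"
  shows "critical_shape_fixed_volume (energy \<sigma>c \<sigma>s) (ball (0 :: real ^ 'n) R) (ball 0 1)"
  using assms(2-) by (rule critical_shape_concentric_balls)

end
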